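(* Let $2p>q>p\ge1$, $\alpha>-1$, $u\in H(\mathbb{B})$ and let $\varphi:\mathbb{B}\to\mathbb{B}$ be a holomorphic mapping. Suppose that $$\mathbb{Z}_{p,q}:=\{N\in\mathbb{N}:\ N\ge1,\ N<p<q<p+N\}\neq\emptyset.$$ Then the following statements are equivalent. (i) $W_{u,\varphi}:A^p_\alpha(\mathbb{B})\to A^q_\alpha(\mathbb{B})$ is bounded. (ii) There is a constant $C>0$ (independent of $f$) such that for every $f\in A^p_\alpha(\mathbb{B})$, $$\|W_{u,\varphi}f\|_{A^q_\alpha(\mathbb{B})}^q\le C\inf_{N\in\mathbb{Z}_{p,q}}\left(\sum_{i=1}^M\sum_{Q\in\mathcal{D}^i}V_\alpha\left(\widehat{K_{c(Q)}}\right)^{\frac qp}\left\langle|f|^N\right\rangle_{\widehat{K_{c(Q)}}}\cdot\left\langle|f|^{q-N}\right\rangle_{\widehat{K_{c(Q)}}}\right).$$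
   Context: $\mathbb{B}$ is the open unit ball of $\mathbb{C}^n$, $\mathbb{S}=\partial\mathbb{B}$, $H(\mathbb{B})$ the holomorphic functions on $\mathbb{B}$. For $\alpha>-1$, $dV_\alpha(z)=c_\alpha(1-|z|^2)^\alpha dV(z)$, where $dV$ is Lebesgue measure and $c_\alpha$ makes $V_\alpha$ a probability measure on $\mathbb{B}$. For $p\ge1$, $A^p_\alpha(\mathbb{B})$ is the space of $f\in H(\mathbb{B})$ with $\|f\|_{A^p_\alpha(\mathbb{B})}^p=\int_{\mathbb{B}}|f|^p\,dV_\alpha<\infty$. $W_{u,\varphi}f(z)=u(z)f(\varphi(z))$. Bergman metric: $\beta(z,w)=\frac12\log\frac{1+|\Phi_z(w)|}{1-|\Phi_z(w)|}$, where $\Phi_z$ is the involutive automorphism of $\mathbb{B}$ interchanging $z$ and $0$; $B_\beta(a,r)$ is the $\beta$-ball. Dyadic structure (for fixed parameters $\lambda,\theta>0$). A dyadic grid $\mathcal{D}=\{Q_j^N\}$ on $\mathbb{S}$ consists, for each generation $N\ge0$, of a finite partition $\{Q_j^N\}_{1\le j\le J_N}$ of $\mathbb{S}$ into Borel sets (with a single set in generation $0$), any two sets of $\mathcal{D}$ of different generations being nested or disjoint. Its Bergman tree is a set $\mathcal{T}=\{c_j^N\}\subset\mathbb{B}$ in one-to-one correspondence $c:\mathcal{D}\to\mathcal{T}$, $c(Q_j^N)=c_j^N$, where $\beta(0,c_j^N)=(N+\frac12)\theta$ and $c_j^N/|c_j^N|\in Q_j^N$; $c_i^{N+1}$ is a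 child of $c_j^N$ if $c_i^{N+1}/|c_i^{N+1}|\in Q_j^N$. To each $a\in\mathcal{T}$ is attached a Borel set $K_a\subset\mathbb{B}$ (the upper Whitney box) such that, with $\widehat{K_a}$ (the dyadic tent) denoting the union of $K_{a'}$ over $a'=a$ and all descendants $a'$ of $a$: (a) the $K_a$ are pairwise disjoint with union $\mathbb{B}$, and there are constants $C_1,C_2>0$ depending only on $\lambda,\theta$ with $B_\beta(a,C_1)\subset K_a\subset B_\beta(a,C_2)$ for all $a\in\mathcal{T}$; (b) $V_\alpha(\widehat{K_a})\simeq V_\alpha(K_a)\simeq(1-|a|^2)^{n+1+\alpha}\simeq e^{-2N\theta(n+1+\alpha)}$ for $N\theta\le\beta(0,a)<(N+1)\theta$; (c) every element of $\mathcal{T}$ has at most $e^{2n\theta}$ children. $\mathcal{D}^1,\dots,\mathcal{D}^M$ is a fixed finite collection of such dyadic grids, with Bergman trees $\mathcal{T}^1,\dots,\mathcal{T}^M$, such that for every $z\in\mathbb{B}$ there are $\ell\in\{1,\dots,M\}$ and $a\in\mathcal{T}^\ell$ with $T_z\subset\widehat{K_a}$ and $V_\alpha(\widehat{K_a})\simeq V_\alpha(T_z)$, where $T_z=\{w\in\mathbb{B}:|1-\langle z/|z|,w\rangle|<1-|z|\}$ is the Carleson tent over $z\ne0$ and $T_0=\mathbb{B}$. (Here $x\simeq y$ means two-sided bounds with constants independent of the points involved.) For measurable $E\subset\mathbb{B}$ and $g\ge0$, $\langle g\rangle_E=\frac1{V_\alpha(E)}\int_E g\,dV_\alpha$. Sums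 of nonnegative terms may equal $+\infty$. *)

theory Defs
  imports "HOL-Analysis.Analysis"
begin

text \<open>
  The space \<open>\<complex>\<^sup>n\<close> is \<open>complex ^ 'n\<close>, with \<open>n = CARD('n)\<close>; its library norm is the Euclidean
  one, so that the unit ball and its boundary are \<open>ball 0 1\<close> and \<open>sphere 0 1\<close>.
\<close>

definition herm :: "complex ^ 'n \<Rightarrow> complex ^ 'n \<Rightarrow> complex" where
  "herm z w = (\<Sum>i\<in>UNIV. z $ i * cnj (w $ i))"

definition holo_fun_on :: "(complex ^ 'n \<Rightarrow> complex) \<Rightarrow> (complex ^ 'n) set \<Rightarrow> bool" where
  "holo_fun_on f S \<longleftrightarrow>
     (\<forall>z\<in>S. \<exists>D. (f has_derivative D) (at z) \<and> (\<forall>a v. D (a *s v) = a * D v))"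

definition holo_map_on :: "(complex ^ 'n \<Rightarrow> complex ^ 'm) \<Rightarrow> (complex ^ 'n) set \<Rightarrow> bool" where
  "holo_map_on \<phi> S \<longleftrightarrow> (\<forall>i. holo_fun_on (\<lambda>z. \<phi> z $ i) S)"

definition c_alpha :: "'n::finite itself \<Rightarrow> real \<Rightarrow> real" where
  "c_alpha _ \<alpha> =
     inverse (LINT z:ball (0 :: complex ^ 'n) 1|lborel. (1 - (norm z)\<^sup>2) powr \<alpha>)"

text \<open>
  The space of the measure \<open>V_alpha \<alpha>\<close> is the ball itself, so that functions need only be
  measurable on the ball; their values elsewhere are irrelevant throughout.
\<close>

definition V_alpha :: "real \<Rightarrow> (complex ^ 'n) measure" where
  "V_alpha \<alpha> = density (restrict_space lborel (ball 0 1))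
     (\<lambda>z. ennreal (c_alpha TYPE('n) \<alpha> * (1 - (norm z)\<^sup>2) powr \<alpha>))"


text \<open>The \<open>p\<close>-th power of the Bergman norm, with value \<open>\<infinity>\<close> allowed.\<close>

definition bergman_pow :: "real \<Rightarrow> real \<Rightarrow> (complex ^ 'n \<Rightarrow> complex) \<Rightarrow> ennreal" where
  "bergman_pow \<alpha> p f = (\<integral>\<^sup>+ z. ennreal (cmod (f z) powr p) \<partial>V_alpha \<alpha>)"

definition bergman_space :: "real \<Rightarrow> real \<Rightarrow> (complex ^ 'n \<Rightarrow> complex) set" where
  "bergman_space \<alpha> p = {f. holo_fun_on f (ball 0 1) \<and> bergman_pow \<alpha> p f < \<infinity>}"

definition bergman_norm :: "real \<Rightarrow> real \<Rightarrow> (complex ^ 'n \<Rightarrow> complex) \<Rightarrow> real" where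
  "bergman_norm \<alpha> p f = enn2real (bergman_pow \<alpha> p f) powr (1 / p)"

definition bounded_bergman_operator ::
    "real \<Rightarrow> real \<Rightarrow> real \<Rightarrow>
     ((complex ^ 'n \<Rightarrow> complex) \<Rightarrow> (complex ^ 'n \<Rightarrow> complex)) \<Rightarrow> bool" where
  "bounded_bergman_operator \<alpha> p q T \<longleftrightarrow>
     (\<forall>f\<in>bergman_space \<alpha> p. T f \<in> bergman_space \<alpha> q) \<and>
     (\<exists>C. \<forall>f\<in>bergman_space \<alpha> p. bergman_norm \<alpha> q (T f) \<le> C * bergman_norm \<alpha> p f)"

definition weighted_comp ::
    "(complex ^ 'n \<Rightarrow> complex) \<Rightarrow> (complex ^ 'n \<Rightarrow> complex ^ 'n) \<Rightarrow>
     (complex ^ 'n \<Rightarrow> complex) \<Rightarrow> complex ^ 'n \<Rightarrow> complex" where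
  "weighted_comp u \<phi> f = (\<lambda>z. u z * f (\<phi> z))"


text \<open>
  \<open>ball_invol z\<close> is the usual involutive automorphism of the ball interchanging \<open>z\<close> and \<open>0\<close>:
  with \<open>P\<close> the orthogonal projection onto the complex line through \<open>z\<close> (and \<open>P = 0\<close> for \<open>z = 0\<close>,
  which is what division by zero yields),
  \<open>w \<mapsto> (z - P w - sqrt (1 - \<bar>z\<bar>\<^sup>2) (w - P w)) / (1 - \<langle>w, z\<rangle>)\<close>; for \<open>z = 0\<close> it is \<open>w \<mapsto> - w\<close>.
\<close>

definition line_proj :: "complex ^ 'n \<Rightarrow> complex ^ 'n \<Rightarrow> complex ^ 'n" where
  "line_proj z w = (herm w z / herm z z) *s z"

definition ball_invol :: "complex ^ 'n \<Rightarrow> complex ^ 'n \<Rightarrow> complex ^ 'n" where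
  "ball_invol z w =
     (1 / (1 - herm w z)) *s
       (z - line_proj z w - sqrt (1 - (norm z)\<^sup>2) *\<^sub>R (w - line_proj z w))"

definition bergman_dist :: "complex ^ 'n \<Rightarrow> complex ^ 'n \<Rightarrow> real" where
  "bergman_dist z w = ln ((1 + norm (ball_invol z w)) / (1 - norm (ball_invol z w))) / 2"

definition bergman_ball :: "complex ^ 'n \<Rightarrow> real \<Rightarrow> (complex ^ 'n) set" where
  "bergman_ball a r = {w \<in> ball 0 1. bergman_dist a w < r}"

definition carleson_tent :: "complex ^ 'n \<Rightarrow> (complex ^ 'n) set" where
  "carleson_tent z =
     (if z = 0 then ball 0 1
      else {w \<in> ball 0 1. cmod (1 - herm (z /\<^sub>R norm z) w) < 1 - norm z})"


text \<open>
  A grid is kept as a family indexed by generation \<open>N\<close> and position \<open>j \<in> {1..num_cubes D N}\<close>,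
  rather than as a set of sets: the same subset of the sphere may occur in several generations,
  and then counts as several members of the grid, with different centers.
\<close>

record ('n::finite) dyadic_structure =
  num_cubes :: "nat \<Rightarrow> nat"
  cube :: "nat \<Rightarrow> nat \<Rightarrow> (complex ^ 'n) set"
  center :: "nat \<Rightarrow> nat \<Rightarrow> complex ^ 'n"
  upper_box :: "complex ^ 'n \<Rightarrow> (complex ^ 'n) set"

definition grid_index :: "'n::finite dyadic_structure \<Rightarrow> (nat \<times> nat) set" where
  "grid_index D = {(N, j). 1 \<le> j \<and> j \<le> num_cubes D N}"

definition tree :: "'n::finite dyadic_structure \<Rightarrow> (complex ^ 'n) set" where
  "tree D = (\<lambda>(N, j). center D N j) ` grid_index D"

definition child_rel :: "'n::finite dyadic_structure \<Rightarrow> ((complex ^ 'n) \<times> (complex ^ 'n)) set" where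
  "child_rel D = {(b, a). \<exists>N i j. (Suc N, i) \<in> grid_index D \<and> (N, j) \<in> grid_index D \<and>
      b = center D (Suc N) i \<and> a = center D N j \<and> b /\<^sub>R norm b \<in> cube D N j}"

definition dyadic_tent :: "'n::finite dyadic_structure \<Rightarrow> complex ^ 'n \<Rightarrow> (complex ^ 'n) set" where
  "dyadic_tent D a = (\<Union>b\<in>{b. (b, a) \<in> (child_rel D)\<^sup>*}. upper_box D b)"

definition dyadic_grid :: "'n::finite dyadic_structure \<Rightarrow> bool" where
  "dyadic_grid D \<longleftrightarrow>
     num_cubes D 0 = 1 \<and>
     (\<forall>(N, j)\<in>grid_index D. cube D N j \<in> sets borel \<and> cube D N j \<noteq> {}) \<and>
     (\<forall>N. disjoint_family_on (cube D N) {1..num_cubes D N} \<and>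
          (\<Union>j\<in>{1..num_cubes D N}. cube D N j) = sphere 0 1) \<and>
     (\<forall>(N, j)\<in>grid_index D. \<forall>(N', j')\<in>grid_index D. N \<noteq> N' \<longrightarrow>
          cube D N j \<subseteq> cube D N' j' \<or> cube D N' j' \<subseteq> cube D N j \<or>
          cube D N j \<inter> cube D N' j' = {})"

definition bergman_tree :: "real \<Rightarrow> 'n::finite dyadic_structure \<Rightarrow> bool" where
  "bergman_tree \<theta> D \<longleftrightarrow>
     inj_on (\<lambda>(N, j). center D N j) (grid_index D) \<and>
     (\<forall>(N, j)\<in>grid_index D.
        center D N j \<in> ball 0 1 \<and>
        bergman_dist 0 (center D N j) = (real N + 1 / 2) * \<theta> \<and>
        center D N j /\<^sub>R norm (center D N j) \<in> cube D N j)"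

definition comparable_on :: "'a set \<Rightarrow> ('a \<Rightarrow> real) \<Rightarrow> ('a \<Rightarrow> real) \<Rightarrow> bool" where
  "comparable_on X F G \<longleftrightarrow>
     (\<exists>c>0. \<exists>C>0. \<forall>x\<in>X. c * G x \<le> F x \<and> F x \<le> C * G x)"

definition whitney_boxes ::
    "real \<Rightarrow> real \<Rightarrow> real \<Rightarrow> real \<Rightarrow> 'n::finite dyadic_structure \<Rightarrow> bool" where
  "whitney_boxes \<alpha> \<theta> C\<^sub>1 C\<^sub>2 D \<longleftrightarrow>
     (\<forall>a\<in>tree D. upper_box D a \<in> sets borel) \<and>
     disjoint_family_on (upper_box D) (tree D) \<and>
     (\<Union>a\<in>tree D. upper_box D a) = ball 0 1 \<and>
     (\<forall>a\<in>tree D. bergman_ball a C\<^sub>1 \<subseteq> upper_box D a \<and> upper_box D a \<subseteq> bergman_ball a C\<^sub>2) \<and>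
     comparable_on (tree D)
       (\<lambda>a. measure (V_alpha \<alpha>) (dyadic_tent D a))
       (\<lambda>a. measure (V_alpha \<alpha>) (upper_box D a)) \<and>
     comparable_on (tree D)
       (\<lambda>a. measure (V_alpha \<alpha>) (upper_box D a))
       (\<lambda>a. (1 - (norm a)\<^sup>2) powr (real CARD('n) + 1 + \<alpha>)) \<and>
     comparable_on {(N, a). a \<in> tree D \<and> real N * \<theta> \<le> bergman_dist 0 a \<and>
                            bergman_dist 0 a < (real N + 1) * \<theta>}
       (\<lambda>(N, a). (1 - (norm a)\<^sup>2) powr (real CARD('n) + 1 + \<alpha>))
       (\<lambda>(N, a). exp (- 2 * real N * \<theta> * (real CARD('n) + 1 + \<alpha>))) \<and>
     (\<forall>a\<in>tree D. real (card {b. (b, a) \<in> child_rel D}) \<le> exp (2 * real CARD('n) * \<theta>))"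

definition tents_dominated ::
    "real \<Rightarrow> nat \<Rightarrow> (nat \<Rightarrow> 'n::finite dyadic_structure) \<Rightarrow> bool" where
  "tents_dominated \<alpha> M \<D> \<longleftrightarrow>
     (\<exists>c>0. \<exists>C>0. \<forall>z\<in>ball 0 1. \<exists>l\<in>{1..M}. \<exists>a\<in>tree (\<D> l).
        carleson_tent z \<subseteq> dyadic_tent (\<D> l) a \<and>
        c * measure (V_alpha \<alpha>) (carleson_tent z) \<le> measure (V_alpha \<alpha>) (dyadic_tent (\<D> l) a) \<and>
        measure (V_alpha \<alpha>) (dyadic_tent (\<D> l) a) \<le> C * measure (V_alpha \<alpha>) (carleson_tent z))"

definition average :: "real \<Rightarrow> (complex ^ 'n) set \<Rightarrow> (complex ^ 'n \<Rightarrow> real) \<Rightarrow> ennreal" where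
  "average \<alpha> E g = (\<integral>\<^sup>+ z\<in>E. ennreal (g z) \<partial>V_alpha \<alpha>) / emeasure (V_alpha \<alpha>) E"

definition Z_set :: "real \<Rightarrow> real \<Rightarrow> nat set" where
  "Z_set p q = {N. 1 \<le> N \<and> real N < p \<and> p < q \<and> q < p + real N}"

end

theory Submission
  imports Defs "HOL-Complex_Analysis.Cauchy_Integral_Formula"
begin

text \<open>Let \<open>\<mu>(E)\<close> be the integral of \<open>\<bar>u\<bar>\<^sup>q\<close> over the preimage of \<open>E\<close> under \<open>\<phi>\<close>, so that the
  \<open>q\<close>-th power of the norm of \<open>u \<cdot> f \<circ> \<phi>\<close> is the integral of \<open>\<bar>f\<bar>\<^sup>q\<close> against \<open>\<mu>\<close>. Write \<open>h = n + 1 + \<alpha>\<close>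
  and \<open>\<delta>(a) = 1 - \<bar>a\<bar>\<^sup>2\<close>; boxes and tents at \<open>a\<close> have volume about \<open>\<delta>(a)\<^sup>h\<close>.

  From boundedness to the dyadic bound. Powers of the Cauchy kernel
  \<open>1 / (1 - \<langle>w, a\<rangle>)\<close> are large on the Whitney box of \<open>a\<close>, and their norms are controlled by the volumes
  of Carleson tents; testing the operator on them gives \<open>\<mu>(K\<^sub>a) \<le> C * \<delta>(a) powr (h * q / p)\<close>
  (\<open>cauchy_kernel_norm\<close>, \<open>pullback_box_mass\<close>). Now split the ball into the boxes of a single tree. On
  \<open>K\<^sub>a\<close> write \<open>\<bar>f\<bar>\<^sup>q\<close> as \<open>\<bar>f\<bar> ^ N * \<bar>f\<bar> powr (q - N)\<close> and bound both factors by their averages over a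
  tent around \<open>K\<^sub>a\<close> of comparable volume, which exists in one of the \<open>M\<close> trees: powers of holomorphic
  functions satisfy the sub-mean value inequality (\<open>box_sup_estimate\<close>). A tent is used for a
  bounded number of boxes only, because the boxes are disjoint and each fills a fixed portion of it.
  This gives \<open>weighted_comp_le_dyadic_sum\<close>.

  From the dyadic bound to boundedness. It has to be shown that the sum over one tree is at most
  a constant times the \<open>q\<close>-th power of the norm of \<open>f\<close> (\<open>dyadic_product_sum_le\<close>). Give a box that lies
  \<open>d\<close> generations below \<open>a\<close> the weight \<open>x\<^sup>d\<close>, with \<open>x > 1\<close> so small that the weight of a tent stays
  comparable to its volume; this is possible because the number of descendants grows more slowly
  than their volumes shrink, by \<open>\<alpha> > -1\<close>. A Hoelder-type splitting with this weight bounds each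
  summand, up to a constant, by the \<open>q / p\<close>-th power of the integral of \<open>\<bar>f\<bar>\<^sup>p\<close> over the tent, discounted by a negative power
  of \<open>x\<^sup>d\<close>. A point has one ancestor per generation, so the discounted tents add up to a bounded
  multiple of the whole integral, and \<open>q \<ge> p\<close> allows their \<open>q / p\<close>-th powers to be summed.

  The first half rests on a few facts about the ball. All the geometry is extracted from the single
  quantity \<open>\<bar>1 - \<langle>w, a\<rangle>\<bar>\<close>, which describes Bergman balls through the Moebius identity
  (\<open>bergman_ball_iff\<close>). Euclidean volumes of Bergman balls are not computed: a box of known volume lies
  between two multiples of one explicit convex set, whose volume is thereby known as well
  (\<open>aniso_vol_bounds\<close>).\<close>

section \<open>Hermitian geometry of the ball\<close>

lemma herm_add_left: "herm (x + y) w = herm x w + herm y w"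
  by (simp add: herm_def sum.distrib algebra_simps)

lemma herm_diff_left: "herm (x - y) w = herm x w - herm y w"
  by (simp add: herm_def sum_subtractf algebra_simps)

lemma herm_diff_right: "herm w (x - y) = herm w x - herm w y"
  by (simp add: herm_def sum_subtractf algebra_simps)

lemma herm_mult_left: "herm (c *s x) w = c * herm x w"
  by (simp add: herm_def sum_distrib_left algebra_simps)

lemma herm_scaleR_left: "herm (r *\<^sub>R x) w = of_real r * herm x w"
  unfolding herm_def vector_scaleR_component by (simp add: sum_distrib_left scaleR_conv_of_real mult_ac)

lemma herm_scaleR_right: "herm w (r *\<^sub>R x) = of_real r * herm w x"
  unfolding herm_def vector_scaleR_component by (simp add: sum_distrib_left scaleR_conv_of_real mult_ac)

lemma herm_cnj: "cnj (herm x y) = herm y x"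
  by (simp add: herm_def algebra_simps)

lemma Re_herm: "Re (herm x y) = inner x y"
  by (simp add: herm_def inner_vec_def inner_complex_def)

lemma herm_self: "herm x x = of_real ((norm x)\<^sup>2)"
proof -
  have "Im (herm x x) = 0" using herm_cnj[of x x] by (simp add: complex_eq_iff)
  then show ?thesis using Re_herm[of x x] by (simp add: complex_eq_iff power2_norm_eq_inner)
qed

lemma norm_cmult_vec: "norm (c *s x) = cmod c * norm (x :: complex ^ 'n)"
proof -
  have "of_real ((norm (c *s x))\<^sup>2) = (of_real ((cmod c * norm x)\<^sup>2) :: complex)"
    unfolding herm_self[symmetric] herm_mult_left
    by (subst herm_cnj[symmetric], subst herm_mult_left)
       (simp add: herm_self power_mult_distrib complex_norm_square[symmetric] mult_ac)
  then have "(norm (c *s x))\<^sup>2 = (cmod c * norm x)\<^sup>2" using of_real_eq_iff by blast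
  then show ?thesis by (simp add: power2_eq_iff_nonneg)
qed

lemma herm_Cauchy_Schwarz: "cmod (herm x y) \<le> norm x * norm y"
proof (cases "herm x y = 0")
  case False
  \<comment> \<open>rotate \<open>x\<close> so that the product becomes real, where it is the real inner product\<close>
  define c where "c = cnj (herm x y) / cmod (herm x y)"
  have c: "cmod c = 1" using False by (simp add: c_def norm_divide)
  have "c * herm x y = of_real (cmod (herm x y))"
    using False by (simp add: c_def complex_norm_square[symmetric] mult.commute power2_eq_square)
  then have "cmod (herm x y) = Re (herm (c *s x) y)" by (simp add: herm_mult_left)
  also have "\<dots> \<le> norm (c *s x) * norm y" unfolding Re_herm by (rule norm_cauchy_schwarz)
  finally show ?thesis by (simp add: norm_cmult_vec c)
qed simp

lemma norm_diff_sq_herm: "(norm (x - y))\<^sup>2 = (norm x)\<^sup>2 + (norm y)\<^sup>2 - 2 * Re (herm x y)"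
  unfolding Re_herm by (simp add: power2_norm_eq_inner inner_diff inner_commute)

definition defect :: "complex ^ 'n \<Rightarrow> real" where
  "defect z = 1 - (norm z)\<^sup>2"

lemma defect_pos: "z \<in> ball 0 1 \<Longrightarrow> 0 < defect z"
  by (simp add: defect_def power_less_one_iff)

lemma defect_pos_iff: "0 < defect z \<longleftrightarrow> z \<in> ball 0 1"
  by (simp add: defect_def abs_square_less_1)

text \<open>This identity makes \<open>\<bar>1 - \<langle>w, a\<rangle>\<bar>\<close> the only geometric quantity that is needed: it dominates both
  defects and the squared Euclidean distance.\<close>

lemma Re_one_minus_herm:
  "2 * Re (1 - herm w a) = defect a + defect w + (norm (w - a))\<^sup>2"
  by (simp add: norm_diff_sq_herm defect_def)

lemma defect_le_one_minus_herm: "defect a + defect w \<le> 2 * cmod (1 - herm w a)"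
  using Re_one_minus_herm[of w a] complex_Re_le_cmod[of "1 - herm w a"] zero_le_power2[of "norm (w - a)"]
  by linarith

lemma one_minus_herm_pos:
  assumes "a \<in> ball 0 1" "w \<in> ball 0 1"
  shows "cmod (1 - herm w a) > 0"
  using defect_le_one_minus_herm[of a w] defect_pos[OF assms(1)] defect_pos[OF assms(2)] by linarith

lemma norm_diff_sq_le:
  assumes "w \<in> ball 0 1" "a \<in> ball 0 1"
  shows "(norm (w - a))\<^sup>2 \<le> 2 * cmod (1 - herm w a)"
  using Re_one_minus_herm[of w a] complex_Re_le_cmod[of "1 - herm w a"] 
    defect_pos[OF assms(1)] defect_pos[OF assms(2)] by linarith

lemma one_minus_herm_commute: "cmod (1 - herm x y) = cmod (1 - herm y x)"
  by (metis complex_cnj_diff complex_cnj_one complex_mod_cnj herm_cnj)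

text \<open>The square root of \<open>\<bar>1 - \<langle>w, z\<rangle>\<bar>\<close> is a metric up to constants. Inserting \<open>z\<close> produces the cross term
  \<open>\<langle>w - z, z - a\<rangle>\<close>, which the Cauchy-Schwarz inequality bounds by Euclidean distances and hence by the two
  quantities on the right.\<close>

lemma one_minus_herm_triangle:
  assumes "w \<in> ball 0 1" "z \<in> ball 0 1" "a \<in> ball 0 1"
  shows "cmod (1 - herm w a) \<le> 4 * (cmod (1 - herm w z) + cmod (1 - herm z a))"
proof -
  let ?s = "cmod (1 - herm w z)" and ?t = "cmod (1 - herm z a)"
  have eq: "1 - herm w a = (1 - herm w z) + herm (w - z) (z - a) + (herm z z - 1) + (1 - herm z a)"
    by (simp add: herm_diff_left herm_diff_right)
  have 1: "cmod (herm (w - z) (z - a)) \<le> ?s + ?t"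
  proof -
    have "cmod (herm (w - z) (z - a)) \<le> norm (w - z) * norm (z - a)" by (rule herm_Cauchy_Schwarz)
    also have "\<dots> \<le> ((norm (w - z))\<^sup>2 + (norm (z - a))\<^sup>2) / 2"
      using sum_squares_bound[of "norm (w - z)" "norm (z - a)"] by simp
    also have "\<dots> \<le> ?s + ?t" using norm_diff_sq_le[of w z] norm_diff_sq_le[of z a] assms by simp
    finally show ?thesis .
  qed
  have 2: "cmod (herm z z - 1) \<le> 2 * ?t"
  proof -
    have "cmod (herm z z - 1) = cmod (of_real ((norm z)\<^sup>2 - 1))" unfolding herm_self by simp
    also have "\<dots> = defect z"
      unfolding norm_of_real using defect_pos[OF assms(2)] by (simp add: defect_def)
    also have "\<dots> \<le> 2 * ?t"
      using defect_le_one_minus_herm[of z a] defect_pos[OF assms(3)]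
      by (simp add: one_minus_herm_commute[of z a])
    finally show ?thesis .
  qed
  have "cmod (1 - herm w a) \<le> ?s + cmod (herm (w - z) (z - a)) + cmod (herm z z - 1) + ?t"
    unfolding eq by (intro order_trans[OF norm_triangle_ineq] add_right_mono order_refl)
  then show ?thesis using 1 2 norm_ge_zero[of "1 - herm w z"] norm_ge_zero[of "1 - herm z a"]
    by argo
qed

text \<open>The Moebius identity. The numerator of the involution splits orthogonally along \<open>a\<close>, so that
  its squared norm is a polynomial in \<open>\<langle>w, a\<rangle>\<close> and the two norms.\<close>

lemma one_minus_norm_ball_invol_sq:
  assumes "a \<in> ball 0 1" "w \<in> ball 0 1"
  shows "1 - (norm (ball_invol a w))\<^sup>2 = defect a * defect w / (cmod (1 - herm w a))\<^sup>2"
proof -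
  define h where "h = herm w a"
  define lam where "lam = h / herm a a"
  define s where "s = sqrt (1 - (norm a)\<^sup>2)"
  have s2: "s\<^sup>2 = 1 - (norm a)\<^sup>2" using defect_pos[OF assms(1)] by (simp add: s_def defect_def)
  have h0: "cmod (1 - h) > 0"
    using one_minus_herm_pos[OF assms] unfolding h_def .
  let ?num = "a - lam *s a - s *\<^sub>R (w - lam *s a)"
  have num: "(norm ?num)\<^sup>2 = (cmod (1 - h))\<^sup>2 - defect a * defect w"
  proof (cases "a = 0")
    case True
    then show ?thesis using s2 by (simp add: h_def herm_def defect_def power_mult_distrib)
  next
    case False
    then have na: "norm a > 0" by simp
    have lam: "lam * of_real ((norm a)\<^sup>2) = h"
      using False by (simp add: lam_def herm_self)
    have orth: "herm (w - lam *s a) a = 0"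
      using lam by (simp add: herm_diff_left herm_mult_left herm_self h_def)
    have orth': "inner ((1 - lam) *s a) (w - lam *s a) = 0"
      unfolding Re_herm[symmetric] herm_mult_left by (subst herm_cnj[symmetric]) (simp add: orth)
    have cl: "(cmod lam)\<^sup>2 * (norm a)\<^sup>2 * (norm a)\<^sup>2 = (cmod h)\<^sup>2"
      unfolding lam[symmetric] by (simp add: norm_mult power_mult_distrib norm_power power2_eq_square)
    have r: "Re lam * (norm a)\<^sup>2 = Re h"
      unfolding lam[symmetric] by (simp del: of_real_power)
    have w: "(norm (w - lam *s a))\<^sup>2 = (norm w)\<^sup>2 - (cmod lam)\<^sup>2 * (norm a)\<^sup>2"
    proof -
      have "(norm w)\<^sup>2 = (norm ((w - lam *s a) + lam *s a))\<^sup>2" by simp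
      also have "\<dots> = (norm (w - lam *s a))\<^sup>2 + (norm (lam *s a))\<^sup>2"
      proof -
        have "orthogonal (lam *s a) (w - lam *s a)"
          unfolding orthogonal_def Re_herm[symmetric] herm_mult_left
          by (subst herm_cnj[symmetric]) (simp add: orth)
        then show ?thesis by (intro norm_add_Pythagorean) (simp add: orthogonal_commute)
      qed
      finally show ?thesis by (simp add: norm_cmult_vec power_mult_distrib)
    qed
    have "?num = (1 - lam) *s a - s *\<^sub>R (w - lam *s a)"
      by (simp add: vec_eq_iff algebra_simps)
    then have "(norm ?num)\<^sup>2 = (norm ((1 - lam) *s a + (- s) *\<^sub>R (w - lam *s a)))\<^sup>2"
      by simp
    also have "\<dots> = (norm ((1 - lam) *s a))\<^sup>2 + (norm ((- s) *\<^sub>R (w - lam *s a)))\<^sup>2"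
      by (rule norm_add_Pythagorean) (use orth' in \<open>simp add: orthogonal_def inner_commute\<close>)
    also have "\<dots> = (norm ((1 - lam) *s a))\<^sup>2 + s\<^sup>2 * (norm (w - lam *s a))\<^sup>2"
      by (simp add: power_mult_distrib)
    also have "\<dots> = (cmod (1 - lam))\<^sup>2 * (norm a)\<^sup>2
        + (1 - (norm a)\<^sup>2) * ((norm w)\<^sup>2 - (cmod lam)\<^sup>2 * (norm a)\<^sup>2)"
      by (simp only: s2 w norm_cmult_vec power_mult_distrib)
    also have "(cmod (1 - lam))\<^sup>2 = 1 - 2 * Re lam + (cmod lam)\<^sup>2"
      unfolding cmod_power2 by (simp add: power2_eq_square algebra_simps)
    also have "(1 - 2 * Re lam + (cmod lam)\<^sup>2) * (norm a)\<^sup>2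
        + (1 - (norm a)\<^sup>2) * ((norm w)\<^sup>2 - (cmod lam)\<^sup>2 * (norm a)\<^sup>2)
      = (norm a)\<^sup>2 - 2 * (Re lam * (norm a)\<^sup>2) + (cmod lam)\<^sup>2 * (norm a)\<^sup>2 * (norm a)\<^sup>2
        + (1 - (norm a)\<^sup>2) * (norm w)\<^sup>2"
      by algebra
    also have "\<dots> = (norm a)\<^sup>2 - 2 * Re h + (cmod h)\<^sup>2 + (1 - (norm a)\<^sup>2) * (norm w)\<^sup>2"
      unfolding cl r ..
    also have "\<dots> = (cmod (1 - h))\<^sup>2 - defect a * defect w"
      unfolding cmod_power2 by (simp add: power2_eq_square algebra_simps defect_def)
    finally show ?thesis .
  qed
  have "ball_invol a w = (1 / (1 - h)) *s ?num"
    by (simp add: ball_invol_def line_proj_def h_def lam_def s_def)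
  then have "(norm (ball_invol a w))\<^sup>2 = (norm ?num)\<^sup>2 / (cmod (1 - h))\<^sup>2"
    by (simp only: norm_cmult_vec norm_divide norm_one power_mult_distrib power_divide) simp
  then show ?thesis unfolding num using h0 by (simp add: h_def field_simps)
qed

text \<open>Membership in a Bergman ball compares \<open>\<bar>1 - \<langle>w, a\<rangle>\<bar>\<^sup>2\<close> with the product of the defects; in this form
  Bergman balls can be compared with tents and with Euclidean sets.\<close>

lemma bergman_ball_iff:
  assumes "a \<in> ball 0 1" "w \<in> ball 0 1" "r > 0"
  shows "w \<in> bergman_ball a r \<longleftrightarrow>
    (1 - (tanh r)\<^sup>2) * (cmod (1 - herm w a))\<^sup>2 < defect a * defect w"
proof -
  define x where "x = norm (ball_invol a w)"
  have h0: "cmod (1 - herm w a) > 0"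
    using one_minus_herm_pos assms by blast
  have id: "1 - x\<^sup>2 = defect a * defect w / (cmod (1 - herm w a))\<^sup>2"
    using one_minus_norm_ball_invol_sq assms unfolding x_def by blast
  also have "\<dots> > 0" using h0 defect_pos[OF assms(1)] defect_pos[OF assms(2)]
    by (intro divide_pos_pos mult_pos_pos zero_less_power)
  finally have x1: "x < 1" using x_def by (simp add: abs_square_less_1)
  have x0: "x \<ge> 0" by (simp add: x_def)
  have "bergman_dist a w = artanh x"
    using x1 x0 by (simp add: bergman_dist_def x_def artanh_def)
  moreover have "artanh x < r \<longleftrightarrow> x < tanh r"
  proof -
    have "tanh (artanh x) = x"
    proof -
      have y: "exp (- 2 * artanh x) = (1 - x) / (1 + x)"
        using x0 x1 by (simp add: artanh_def exp_minus)
      then show ?thesis using x0 x1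
        unfolding tanh_real_altdef y by (simp add: field_simps)
    qed
    then show ?thesis using tanh_real_less_iff[of "artanh x" r] by simp
  qed
  moreover have "x < tanh r \<longleftrightarrow> x\<^sup>2 < (tanh r)\<^sup>2"
    using x0 assms(3) by (metis less_eq_real_def power_strict_mono pos2 power2_less_imp_less tanh_real_pos_iff)
  moreover have "x\<^sup>2 < (tanh r)\<^sup>2 \<longleftrightarrow> 1 - (tanh r)\<^sup>2 < 1 - x\<^sup>2" by simp
  moreover have "\<dots> \<longleftrightarrow> (1 - (tanh r)\<^sup>2) * (cmod (1 - herm w a))\<^sup>2 < defect a * defect w"
    unfolding id using h0 by (simp add: pos_less_divide_eq)
  ultimately show ?thesis using assms(2) by (simp add: bergman_ball_def)
qed

section \<open>Mean values over balanced sets\<close>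

lemma nn_integral_lborel_translate:
  assumes [measurable]: "f \<in> borel_measurable borel"
  shows "(\<integral>\<^sup>+y. f (a + y) \<partial>lborel) = (\<integral>\<^sup>+y. f y \<partial>(lborel :: 'a::euclidean_space measure))"
  by (subst (2) lborel_distr_plus[of a, symmetric], subst nn_integral_distr) auto

lemma nn_integral_lborel_reflect:
  assumes [measurable]: "f \<in> borel_measurable borel"
  shows "(\<integral>\<^sup>+y. f (a - y) \<partial>lborel) = (\<integral>\<^sup>+y. f y \<partial>(lborel :: 'a::euclidean_space measure))"
proof -
  have "(lborel :: 'a measure) = density (distr lborel borel (\<lambda>x. a - x)) (\<lambda>_. 1)"
    using lborel_affine[of "-1" a] by simp
  then have "(lborel :: 'a measure) = distr lborel borel (\<lambda>x. a - x)"
    by (simp add: density_1)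
  then have "(\<integral>\<^sup>+y. f y \<partial>lborel) = (\<integral>\<^sup>+y. f y \<partial>distr lborel borel (\<lambda>x. a - x))"
    by simp
  then show ?thesis by (subst (asm) nn_integral_distr) auto
qed

text \<open>This is the uniqueness of translation-invariant measures. Integrate the indicator of
  \<open>T x \<in> A\<close>, \<open>T x + y \<in> B\<close> over \<open>x\<close> and \<open>y\<close>, with \<open>B\<close> the unit ball: integrating \<open>y\<close> first gives the
  product of the image measure of \<open>A\<close> and the volume of \<open>B\<close>; shifting \<open>x\<close> first gives the product of the
  volume of \<open>A\<close> and the image measure of \<open>B\<close>, which equals its volume because \<open>T\<close> preserves norms.\<close>

lemma lborel_distr_linear_isometry:
  fixes T :: "'a::euclidean_space \<Rightarrow> 'a"
  assumes T: "linear T" and iso: "\<And>x. norm (T x) = norm x"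
  shows "distr lborel borel T = lborel"
proof (rule measure_eqI)
  fix A :: "'a set" assume "A \<in> sets (distr lborel borel T)"
  then have A [measurable]: "A \<in> sets borel" by simp
  have surj: "surj T"
  proof (rule linear_inj_imp_surj[OF T])
    show "inj T" unfolding linear_injective_0[OF T] by (metis iso norm_eq_zero)
  qed
  have meas [measurable]: "T \<in> borel_measurable borel"
    by (intro borel_measurable_continuous_onI linear_continuous_on) (use T in \<open>simp add: linear_conv_bounded_linear\<close>)
  define B where "B = ball (0 :: 'a) 1"
  have [measurable]: "B \<in> sets borel" by (simp add: B_def)
  have TB: "indicator B (T x) = (indicator B x :: ennreal)" for x
    by (simp add: B_def indicator_def iso)
  have "(\<integral>\<^sup>+x. indicator A (T x) \<partial>lborel) * emeasure lborel B
      = (\<integral>\<^sup>+x. indicator A (T x) * (\<integral>\<^sup>+y. indicator B y \<partial>lborel) \<partial>lborel)"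
    by (subst nn_integral_multc[symmetric]) auto
  also have "\<dots> = (\<integral>\<^sup>+x. indicator A (T x) * (\<integral>\<^sup>+y. indicator B (T x + y) \<partial>lborel) \<partial>lborel)"
    by (subst nn_integral_lborel_translate) auto
  also have "\<dots> = (\<integral>\<^sup>+x. (\<integral>\<^sup>+y. indicator A (T x) * indicator B (T x + y) \<partial>lborel) \<partial>lborel)"
    by (intro nn_integral_cong nn_integral_cmult[symmetric]) auto
  also have "\<dots> = (\<integral>\<^sup>+y. (\<integral>\<^sup>+x. indicator A (T x) * indicator B (T x + y) \<partial>lborel) \<partial>lborel)"
    by (rule lborel_pair.Fubini') measurable
  also have "\<dots> = (\<integral>\<^sup>+y. (\<integral>\<^sup>+x. indicator A (T x - y) * indicator B (T x) \<partial>lborel) \<partial>lborel)"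
  proof (rule nn_integral_cong)
    fix y :: 'a
    obtain y' where y': "y = T y'" using surj by (metis surj_def)
    have "(\<integral>\<^sup>+x. indicator A (T x - y) * indicator B (T x) \<partial>lborel)
      = (\<integral>\<^sup>+x. (indicator A (T (y' + x) - y) * indicator B (T (y' + x)) :: ennreal) \<partial>lborel)"
      by (rule nn_integral_lborel_translate[symmetric]) measurable
    then show "(\<integral>\<^sup>+x. indicator A (T x) * indicator B (T x + y) \<partial>lborel)
      = (\<integral>\<^sup>+x. (indicator A (T x - y) * indicator B (T x) :: ennreal) \<partial>lborel)"
      by (simp add: linear_add[OF T] y' add.commute)
  qed
  also have "\<dots> = (\<integral>\<^sup>+x. (\<integral>\<^sup>+y. indicator A (T x - y) * indicator B (T x) \<partial>lborel) \<partial>lborel)"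
    by (rule lborel_pair.Fubini'[symmetric]) measurable
  also have "\<dots> = (\<integral>\<^sup>+x. emeasure lborel A * indicator B x \<partial>lborel)"
    by (subst nn_integral_multc) (auto simp: TB nn_integral_lborel_reflect)
  also have "\<dots> = emeasure lborel A * emeasure lborel B"
    by (subst nn_integral_cmult) auto
  finally have eq: "(\<integral>\<^sup>+x. indicator A (T x) \<partial>lborel) * emeasure lborel B = emeasure lborel A * emeasure lborel B" .
  have B: "emeasure lborel B \<noteq> 0" "emeasure lborel B \<noteq> \<infinity>"
    unfolding B_def using emeasure_bounded_finite[of "ball (0::'a) 1"]
    using less_imp_neq[OF unit_ball_vol_pos[of "real DIM('a)", OF of_nat_0_le_iff]] by (auto simp: emeasure_ball simp del: unit_ball_vol_pos)
  have "(\<integral>\<^sup>+x. indicator A (T x) \<partial>lborel) = emeasure (distr lborel borel T) A"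
    by (subst nn_integral_indicator[symmetric], simp, subst nn_integral_distr) auto
  moreover have "x = y" if "x * emeasure lborel B = y * emeasure lborel B" for x y :: ennreal
    using that B by (metis ennreal_mult_divide_eq infinity_ennreal_def)
  ultimately show "emeasure (distr lborel borel T) A = emeasure lborel A"
    using eq by simp
qed simp

lemma distr_lborel_rotation:
  assumes "cmod c = 1"
  shows "distr lborel borel ((*s) c) = (lborel :: (complex ^ 'n::finite) measure)"
proof (rule lborel_distr_linear_isometry)
  show "linear ((*s) c :: complex ^ 'n \<Rightarrow> _)"
    by (rule linearI) (simp_all add: vec_eq_iff algebra_simps)
qed (simp add: norm_cmult_vec assms)

lemma borel_measurable_cmult_vec [measurable]: "((*s) c) \<in> borel_measurable (borel :: (complex ^ 'n) measure)"
  by (intro borel_measurable_continuous_onI) (simp add: vector_scalar_mult_def continuous_intros)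

lemma continuous_on_holo_fun: "holo_fun_on f S \<Longrightarrow> continuous_on S f"
  unfolding holo_fun_on_def continuous_on_eq_continuous_within
  by (meson continuous_at_imp_continuous_at_within has_derivative_continuous)

lemma holo_fun_on_mult:
  assumes "holo_fun_on f S" "holo_fun_on g S"
  shows "holo_fun_on (\<lambda>z. f z * g z) S"
  unfolding holo_fun_on_def
proof
  fix z assume "z \<in> S"
  then obtain D E where D: "(f has_derivative D) (at z)" "\<And>a v. D (a *s v) = a * D v"
    and E: "(g has_derivative E) (at z)" "\<And>a v. E (a *s v) = a * E v"
    using assms unfolding holo_fun_on_def by meson
  show "\<exists>D. ((\<lambda>z. f z * g z) has_derivative D) (at z) \<and> (\<forall>a v. D (a *s v) = a * D v)"
    by (intro exI conjI, rule has_derivative_mult[OF D(1) E(1)])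
       (simp add: D(2) E(2) algebra_simps)
qed

lemma holo_fun_on_const: "holo_fun_on (\<lambda>z. c) S"
  unfolding holo_fun_on_def by (intro ballI exI[of _ "\<lambda>_. 0"]) auto

lemma holo_fun_on_power: "holo_fun_on f S \<Longrightarrow> holo_fun_on (\<lambda>z. f z ^ k) S"
  by (induction k) (auto simp: holo_fun_on_const holo_fun_on_mult)

lemma continuous_on_cmult_vec [continuous_intros]:
  "continuous_on A f \<Longrightarrow> continuous_on A g \<Longrightarrow> continuous_on A (\<lambda>x. f x *s (g x :: complex ^ 'n))"
  unfolding vector_scalar_mult_def by (intro continuous_intros)

text \<open>Cauchy's formula on the complex line through \<open>x\<close> in direction \<open>v\<close>.\<close>

lemma holo_norm_le_circle_mean:
  fixes f :: "complex ^ 'n \<Rightarrow> complex"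
  assumes "open S" and f: "holo_fun_on f S" and xv: "\<And>t. cmod t \<le> 1 \<Longrightarrow> x + t *s v \<in> S"
  shows "ennreal (cmod (f x))
    \<le> (\<integral>\<^sup>+t. indicator {0..1} t * ennreal (cmod (f (x + cis (2 * pi * t) *s v))) \<partial>lborel)"
proof -
  define g where "g = (\<lambda>t. f (x + t *s v))"
  have deriv: "(g has_field_derivative D v) (at t)"
    if D: "(f has_derivative D) (at (x + t *s v))" "\<And>a v. D (a *s v) = a * D v" for t D
  proof -
    have "((\<lambda>t. x + t *s v) has_derivative (\<lambda>h. h *s v)) (at t)"
    proof (rule has_derivative_add_const[of "\<lambda>t. t *s v" "\<lambda>h. h *s v" "at t" x, simplified add.commute])
      have "linear (\<lambda>t :: complex. t *s v)"
        by (rule linearI) (simp_all add: vec_eq_iff algebra_simps)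
      then show "((\<lambda>t. t *s v) has_derivative (\<lambda>h. h *s v)) (at t)"
        by (intro bounded_linear_imp_has_derivative) (simp add: linear_conv_bounded_linear)
    qed
    from diff_chain_at[OF this D(1)] show ?thesis
      unfolding has_field_derivative_def g_def by (simp add: o_def D(2) mult.commute[of _ "D v"])
  qed
  have "g holomorphic_on cball 0 1"
    unfolding holomorphic_on_def
  proof
    fix t :: complex assume "t \<in> cball 0 1"
    then have "x + t *s v \<in> S" using xv by simp
    then obtain D where "(f has_derivative D) (at (x + t *s v))" "\<And>a v. D (a *s v) = a * D v"
      using f unfolding holo_fun_on_def by meson
    from deriv[OF this] show "g field_differentiable at t within cball 0 1"
      using field_differentiable_at_within field_differentiable_def by blast
  qed
  from Cauchy_integral_circlepath_simple[OF this, of 0]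
  have "((\<lambda>t. g (circlepath 0 1 t) / circlepath 0 1 t *
      vector_derivative (circlepath 0 1) (at t)) has_integral 2 * pi * \<i> * g 0) {0..1}"
    by (simp add: has_contour_integral)
  then have "((\<lambda>t. (2 * pi * \<i>) * g (cis (2 * pi * t))) has_integral 2 * pi * \<i> * g 0) {0..1}"
    by (rule has_integral_eq[rotated])
       (simp only: vector_derivative_circlepath, simp add: circlepath cis_conv_exp mult_ac)
  then have int: "((\<lambda>t. g (cis (2 * pi * t))) has_integral g 0) {0..1}"
    by (subst (asm) has_integral_mult_right_iff) auto
  have cont: "continuous_on {0..1} (\<lambda>t. g (cis (2 * pi * t)))"
    unfolding g_def
  proof (rule continuous_on_compose2[OF continuous_on_holo_fun[OF f]])
    show "continuous_on {0..1} (\<lambda>t. x + cis (2 * pi * t) *s v)"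
      by (intro continuous_intros)
  qed (auto intro!: xv)
  have si: "set_integrable lborel {0..1} (\<lambda>t. g (cis (2 * pi * t)))"
    by (rule borel_integrable_atLeastAtMost'[OF cont])
  have "g 0 = (LINT t:{0..1}|lborel. g (cis (2 * pi * t)))"
    using int set_borel_integral_eq_integral(2)[OF si] by (simp add: integral_unique)
  then have "ennreal (cmod (g 0)) \<le> (\<integral>\<^sup>+t. ennreal (cmod (indicator {0..1} t *\<^sub>R g (cis (2 * pi * t)))) \<partial>lborel)"
    using integral_norm_bound_ennreal[OF si[unfolded set_integrable_def]]
    by (simp add: set_lebesgue_integral_def)
  also have "\<dots> = (\<integral>\<^sup>+t. indicator {0..1} t * ennreal (cmod (g (cis (2 * pi * t)))) \<partial>lborel)"
    by (intro nn_integral_cong) (auto simp: indicator_def)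
  finally show ?thesis by (simp add: g_def)
qed

text \<open>Average the circle means over \<open>v \<in> D\<close>. Multiplication by a unimodular number preserves both \<open>D\<close> and
  Lebesgue measure, so after exchanging the integrals the angle disappears. It will be used with
  elongated sets \<open>D\<close> that imitate Bergman balls.\<close>

lemma holo_mean_value_balanced:
  fixes f :: "complex ^ 'n::finite \<Rightarrow> complex"
  assumes S: "open S" and f: "holo_fun_on f S"
    and D: "D \<in> sets borel" and bal: "\<And>c v. cmod c \<le> 1 \<Longrightarrow> v \<in> D \<Longrightarrow> c *s v \<in> D"
    and xD: "\<And>v. v \<in> D \<Longrightarrow> x + v \<in> S"
  shows "ennreal (cmod (f x)) * emeasure lborel D
    \<le> (\<integral>\<^sup>+v. indicator D v * ennreal (cmod (f (x + v))) \<partial>lborel)"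
proof -
  define F where "F = (\<lambda>x. indicator S x *\<^sub>R f x)"
  have [measurable]: "F \<in> borel_measurable borel"
    unfolding F_def using S continuous_on_holo_fun[OF f]
    by (intro borel_measurable_continuous_on_indicator) auto
  have [measurable]: "D \<in> sets borel" by (rule D)
  have Ff: "F (x + v) = f (x + v)" if "v \<in> D" for v
    using xD[OF that] by (simp add: F_def)
  have joint: "(\<lambda>(v :: complex ^ 'n, t). x + cis (2 * pi * t) *s v) \<in> borel_measurable (lborel \<Otimes>\<^sub>M lborel)"
  proof -
    have "(\<lambda>(v :: complex ^ 'n, t). x + cis (2 * pi * t) *s v) \<in> borel_measurable borel"
      by (intro borel_measurable_continuous_onI)
         (auto intro!: continuous_intros simp: case_prod_unfold)
    then show ?thesis unfolding lborel_prod by simp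
  qed
  define h :: "complex ^ 'n \<Rightarrow> real \<Rightarrow> ennreal" where
    "h = (\<lambda>v t. indicator D v * (indicator {0..1} t * ennreal (cmod (F (x + cis (2 * pi * t) *s v)))))"
  have h [measurable]: "case_prod h \<in> borel_measurable (lborel \<Otimes>\<^sub>M lborel)"
  proof -
    have "(\<lambda>p. F ((\<lambda>(v :: complex ^ 'n, t). x + cis (2 * pi * t) *s v) p)) \<in> borel_measurable (lborel \<Otimes>\<^sub>M lborel)"
      by (rule measurable_compose[OF joint]) simp
    then have [measurable]: "(\<lambda>p. F (x + cis (2 * pi * snd p) *s fst p)) \<in> borel_measurable (lborel \<Otimes>\<^sub>M lborel)"
      by (simp add: case_prod_unfold)
    show ?thesis unfolding h_def case_prod_unfold by measurable
  qed
  have "ennreal (cmod (f x)) * emeasure lborel D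
      = (\<integral>\<^sup>+v. indicator D v * ennreal (cmod (f x)) \<partial>lborel)"
    by (subst mult.commute, subst nn_integral_multc) (auto)
  also have "\<dots> \<le> (\<integral>\<^sup>+v. \<integral>\<^sup>+t. h v t \<partial>lborel \<partial>lborel)"
  proof (rule nn_integral_mono)
    fix v :: "complex ^ 'n"
    show "indicator D v * ennreal (cmod (f x)) \<le> (\<integral>\<^sup>+t. h v t \<partial>lborel)"
    proof (cases "v \<in> D")
      case True
      have "ennreal (cmod (f x))
        \<le> (\<integral>\<^sup>+t. indicator {0..1} t * ennreal (cmod (f (x + cis (2 * pi * t) *s v))) \<partial>lborel)"
        by (rule holo_norm_le_circle_mean[OF S f]) (auto intro!: xD bal True)
      also have "\<dots> = (\<integral>\<^sup>+t. h v t \<partial>lborel)"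
        by (intro nn_integral_cong) (auto simp: h_def True Ff bal)
      finally show ?thesis by (simp add: True)
    qed simp
  qed
  also have "\<dots> = (\<integral>\<^sup>+t. \<integral>\<^sup>+v. h v t \<partial>lborel \<partial>lborel)"
    by (rule lborel_pair.Fubini'[OF h, symmetric])
  also have "\<dots> = (\<integral>\<^sup>+t. indicator {0..1} (t :: real) * (\<integral>\<^sup>+v. indicator D v * ennreal (cmod (F (x + v))) \<partial>lborel) \<partial>lborel)"
  proof (rule nn_integral_cong)
    fix t :: real
    let ?c = "cis (2 * pi * t)"
    have D': "?c *s v \<in> D \<longleftrightarrow> v \<in> D" for v :: "complex ^ 'n"
    proof (rule iffI)
      assume "?c *s v \<in> D"
      then have *: "cnj ?c *s (?c *s v) \<in> D" by (rule bal[rotated]) simp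
      have "cnj ?c * ?c = 1" by (simp add: complex_norm_square[symmetric] mult.commute)
      then have "cnj ?c *s (?c *s v) = v" by (simp only: vector_smult_assoc vector_smult_lid)
      with * show "v \<in> D" by (rule back_subst[of "\<lambda>v. v \<in> D"])
    next
      assume "v \<in> D" then show "?c *s v \<in> D" by (intro bal) auto
    qed
    have "(\<integral>\<^sup>+v. h v t \<partial>lborel)
      = indicator {0..1} t * (\<integral>\<^sup>+v. indicator D v * ennreal (cmod (F (x + ?c *s v))) \<partial>lborel)"
      unfolding h_def by (subst nn_integral_cmult[symmetric]) (auto intro!: nn_integral_cong simp: mult_ac)
    also have "(\<integral>\<^sup>+v. indicator D v * ennreal (cmod (F (x + ?c *s v))) \<partial>lborel)
      = (\<integral>\<^sup>+v. indicator D (?c *s v) * ennreal (cmod (F (x + ?c *s v))) \<partial>lborel)"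
      by (intro nn_integral_cong) (auto simp: indicator_def D')
    also have "\<dots> = (\<integral>\<^sup>+v. indicator D v * ennreal (cmod (F (x + v))) \<partial>distr lborel borel ((*s) ?c))"
      by (subst nn_integral_distr) auto
    also have "\<dots> = (\<integral>\<^sup>+v. indicator D v * ennreal (cmod (F (x + v))) \<partial>lborel)"
      by (subst distr_lborel_rotation) auto
    finally show "(\<integral>\<^sup>+v. h v t \<partial>lborel)
      = indicator {0..1} t * (\<integral>\<^sup>+v. indicator D v * ennreal (cmod (F (x + v))) \<partial>lborel)" .
  qed
  also have "\<dots> = (\<integral>\<^sup>+v. indicator D v * ennreal (cmod (F (x + v))) \<partial>lborel)"
    by (subst nn_integral_multc) auto
  also have "\<dots> = (\<integral>\<^sup>+v. indicator D v * ennreal (cmod (f (x + v))) \<partial>lborel)"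
    by (intro nn_integral_cong) (auto simp: indicator_def Ff)
  finally show ?thesis .
qed

section \<open>The sub-mean value inequality for positive powers\<close>

lemma emeasure_lborel_scaleR:
  fixes D :: "'a::euclidean_space set"
  assumes D: "D \<in> sets borel" and c: "c > 0"
  shows "(\<lambda>w. c *\<^sub>R w) ` D \<in> sets borel"
    "emeasure lborel ((\<lambda>w. c *\<^sub>R w) ` D) = ennreal (c ^ DIM('a)) * emeasure lborel D"
proof -
  have eq: "(\<lambda>w. c *\<^sub>R w) ` D = (\<lambda>w. (1 / c) *\<^sub>R w) -` D"
  proof (intro set_eqI iffI)
    fix w assume "w \<in> (\<lambda>w. (1 / c) *\<^sub>R w) -` D"
    then show "w \<in> (\<lambda>w. c *\<^sub>R w) ` D" using c by (intro image_eqI[of _ _ "(1 / c) *\<^sub>R w"]) auto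
  qed (use c in auto)
  have "(\<lambda>w :: 'a. (1 / c) *\<^sub>R w) \<in> borel_measurable borel"
    by (intro borel_measurable_continuous_onI continuous_intros)
  from measurable_sets[OF this D] show m: "(\<lambda>w. c *\<^sub>R w) ` D \<in> sets borel" unfolding eq by simp
  have "emeasure lborel ((\<lambda>w. c *\<^sub>R w) ` D)
      = emeasure (density (distr lborel borel (\<lambda>x. 0 + c *\<^sub>R x)) (\<lambda>_. ennreal (\<bar>c\<bar> ^ DIM('a)))) ((\<lambda>w. c *\<^sub>R w) ` D)"
    using lborel_affine[of c "0 :: 'a"] c by simp
  also have "\<dots> = ennreal (c ^ DIM('a)) * emeasure lborel ((\<lambda>w. c *\<^sub>R w) -` (\<lambda>w. c *\<^sub>R w) ` D)"
    using m c by (simp add: emeasure_density nn_integral_cmult nn_integral_indicator emeasure_distr)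
  also have "(\<lambda>w. c *\<^sub>R w) -` (\<lambda>w. c *\<^sub>R w) ` D = D"
    using c by auto
  finally show "emeasure lborel ((\<lambda>w. c *\<^sub>R w) ` D) = ennreal (c ^ DIM('a)) * emeasure lborel D" .
qed

lemma scaleR_eq_cmult_vec: "r *\<^sub>R v = (of_real r :: complex) *s v"
  by (simp add: vec_eq_iff) (simp add: scaleR_conv_of_real)

text \<open>The argument of Hardy and Littlewood for powers below \<open>1\<close>. Let \<open>m\<close> be the supremum of
  \<open>(1 - r) powr (d / s) * \<bar>f\<bar>\<close> over the points of \<open>x + r D\<close> and over \<open>r < 1\<close>. The mean value
  inequality on a copy of \<open>D\<close> of size \<open>\<rho> = (1 - r) / 2\<close>, combined with the bound
  \<open>\<bar>f\<bar> \<le> \<bar>f\<bar> powr s * (m * \<rho> powr (- d / s)) powr (1 - s)\<close> there, gives \<open>m \<le> B * m powr (1 - s)\<close>, where \<open>B\<close>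
  is the mean of \<open>\<bar>f\<bar> powr s\<close> up to a constant. Since \<open>f\<close> is bounded, \<open>m\<close> is finite and can be cancelled.\<close>

lemma holo_sub_mean_value_le_one:
  fixes f :: "complex ^ 'n::finite \<Rightarrow> complex"
  assumes S: "open S" and f: "holo_fun_on f S"
    and D: "D \<in> sets borel" and bal: "\<And>c v. cmod c \<le> 1 \<Longrightarrow> v \<in> D \<Longrightarrow> c *s v \<in> D"
    and conv: "convex D" and xD: "\<And>v. v \<in> D \<Longrightarrow> x + v \<in> S"
    and K: "\<And>v. v \<in> D \<Longrightarrow> cmod (f (x + v)) \<le> K"
    and s: "0 < s" "s \<le> 1"
    and L: "emeasure lborel D = ennreal L" "L > 0"
  shows "ennreal (cmod (f x) powr s) * emeasure lborel D
    \<le> ennreal (2 powr (DIM(complex ^ 'n) / s)) *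
        (\<integral>\<^sup>+v. indicator D v * ennreal (cmod (f (x + v)) powr s) \<partial>lborel)"
proof (cases "f x = 0")
  case False
  define d where "d = real DIM(complex ^ 'n)"
  define F where "F = (\<lambda>x. indicator S x *\<^sub>R f x)"
  have [measurable]: "F \<in> borel_measurable borel"
    unfolding F_def using S continuous_on_holo_fun[OF f]
    by (intro borel_measurable_continuous_on_indicator) auto
  have [measurable]: "D \<in> sets borel" by (rule D)
  have Ff: "F (x + v) = f (x + v)" if "v \<in> D" for v
    using xD[OF that] by (simp add: F_def)
  have "D \<noteq> {}" using L by auto
  then obtain v0 where "v0 \<in> D" by auto
  from bal[OF _ this, of 0] have D0: "0 \<in> D" by simp
  have K0: "K \<ge> 0" using K[OF D0] norm_ge_zero order_trans by blast
  have balr: "r *\<^sub>R v \<in> D" if "v \<in> D" "0 \<le> r" "r \<le> 1" for r :: real and v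
    using bal[OF _ that(1), of "of_real r"] that(2,3) by (simp add: scaleR_eq_cmult_vec)
  define I where "I = (\<integral>\<^sup>+v. indicator D v * ennreal (cmod (f (x + v)) powr s) \<partial>lborel)"
  have "I \<le> (\<integral>\<^sup>+v. indicator D v * ennreal (K powr s) \<partial>lborel)"
    unfolding I_def using powr_mono2[OF less_imp_le[OF s(1)] norm_ge_zero K]
    by (intro nn_integral_mono) (auto simp: indicator_def intro!: ennreal_leI)
  also have "\<dots> = ennreal L * ennreal (K powr s)" by (subst nn_integral_multc) (auto simp: L)
  also have "\<dots> < \<infinity>" by (simp add: ennreal_mult_less_top)
  finally obtain A where A: "I = ennreal A" "A \<ge> 0"
    by (metis ennreal_cases infinity_ennreal_def less_irrefl)
  define X where "X = {(1 - r) powr (d / s) * cmod (f (x + r *\<^sub>R v)) | r v. 0 \<le> r \<and> r < 1 \<and> v \<in> D}"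
  have XK: "y \<le> K" if yX: "y \<in> X" for y
  proof -
    obtain r v where rv: "y = (1 - r) powr (d / s) * cmod (f (x + r *\<^sub>R v))" "0 \<le> r" "r < 1" "v \<in> D"
      using yX by (auto simp: X_def)
    have "(1 - r) powr (d / s) \<le> 1" using rv s by (intro powr_le1) (auto simp: d_def)
    moreover have "cmod (f (x + r *\<^sub>R v)) \<le> K" by (intro K balr rv less_imp_le)
    ultimately show ?thesis unfolding rv(1) using K0 by (metis mult_mono mult_1 norm_ge_zero zero_le_one)
  qed
  then have bdd: "bdd_above X" by (rule bdd_aboveI)
  define m where "m = Sup X"
  have mX: "y \<le> m" if "y \<in> X" for y unfolding m_def by (rule cSup_upper[OF that bdd])
  have fxX: "cmod (f x) \<in> X" unfolding X_def
    by (rule CollectI, rule exI[of _ 0], rule exI[of _ 0]) (simp add: D0)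
  then have fm: "cmod (f x) \<le> m" by (rule mX)
  then have m: "m > 0" using False less_le_trans[of 0 "cmod (f x)" m] by simp
  define B where "B = 2 powr (d / s) * A / L"
  have "y \<le> B * m powr (1 - s)" if yX: "y \<in> X" for y
  proof -
    obtain r v where rv: "y = (1 - r) powr (d / s) * cmod (f (x + r *\<^sub>R v))" "0 \<le> r" "r < 1" "v \<in> D"
      using yX by (auto simp: X_def)
    define \<rho> where "\<rho> = (1 - r) / 2"
    have \<rho>: "\<rho> > 0" "r + \<rho> = 1 - \<rho>" "r + \<rho> < 1" using rv by (auto simp: \<rho>_def field_simps)
    define E where "E = (\<lambda>w. \<rho> *\<^sub>R w) ` D"
    have E [measurable]: "E \<in> sets borel" unfolding E_def by (rule emeasure_lborel_scaleR(1)[OF D \<rho>(1)])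
    \<comment> \<open>a point of \<open>r D\<close>, moved by \<open>\<rho> D\<close>, stays in \<open>(r + \<rho>) D = (1 - \<rho>) D\<close>\<close>
    have ED: "\<exists>w'\<in>D. r *\<^sub>R v + w = (1 - \<rho>) *\<^sub>R w'" if wE: "w \<in> E" for w
    proof -
      obtain u where u: "u \<in> D" "w = \<rho> *\<^sub>R u" using wE by (auto simp: E_def)
      have "(r / (1 - \<rho>)) *\<^sub>R v + (\<rho> / (1 - \<rho>)) *\<^sub>R u \<in> D"
      proof (rule convexD[OF conv rv(4) u(1)])
        have "1 - \<rho> > 0" using rv \<rho> by linarith
        then show "0 \<le> r / (1 - \<rho>)" "0 \<le> \<rho> / (1 - \<rho>)" "r / (1 - \<rho>) + \<rho> / (1 - \<rho>) = 1"
          using rv \<rho> by (auto simp flip: add_divide_distrib)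
      qed
      moreover have "r *\<^sub>R v + w = (1 - \<rho>) *\<^sub>R ((r / (1 - \<rho>)) *\<^sub>R v + (\<rho> / (1 - \<rho>)) *\<^sub>R u)"
        using \<rho> rv(2) by (auto simp: u scaleR_right_distrib)
      ultimately show ?thesis by blast
    qed
    have ED': "r *\<^sub>R v + w \<in> D" if "w \<in> E" for w
      using ED[OF that] balr \<rho> rv by (metis diff_ge_0_iff_ge less_imp_le add_nonneg_nonneg)
    define c where "c = (m * \<rho> powr (- d / s)) powr (1 - s)"
    have bd: "cmod (f (x + r *\<^sub>R v + w)) \<le> cmod (f (x + r *\<^sub>R v + w)) powr s * c" if w: "w \<in> E" for w
    proof -
      let ?z = "cmod (f (x + r *\<^sub>R v + w))"
      obtain w' where w': "w' \<in> D" "r *\<^sub>R v + w = (1 - \<rho>) *\<^sub>R w'" using ED[OF w] by blast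
      have "\<rho> powr (d / s) * ?z \<in> X" unfolding X_def
        using w' \<rho> rv by (intro CollectI exI[of _ "1 - \<rho>"] exI[of _ w']) (auto simp: add.assoc)
      then have "\<rho> powr (d / s) * ?z \<le> m" by (rule mX)
      then have "?z \<le> m * \<rho> powr (- d / s)"
        using \<rho> by (simp add: powr_minus_divide pos_le_divide_eq mult.commute)
      then have "?z powr (1 - s) \<le> c" unfolding c_def by (intro powr_mono2) (use s in auto)
      then have "?z powr s * ?z powr (1 - s) \<le> ?z powr s * c" by (intro mult_left_mono) auto
      then show ?thesis by (simp flip: powr_add)
    qed
    have "ennreal (cmod (f (x + r *\<^sub>R v))) * emeasure lborel E
        \<le> (\<integral>\<^sup>+w. indicator E w * ennreal (cmod (f (x + r *\<^sub>R v + w))) \<partial>lborel)"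
    proof (rule holo_mean_value_balanced[OF S f E])
      show "c *s w \<in> E" if c: "cmod c \<le> 1" and w: "w \<in> E" for c w
      proof -
        obtain u where u: "u \<in> D" "w = \<rho> *\<^sub>R u" using w by (auto simp: E_def)
        have "c *s w = \<rho> *\<^sub>R (c *s u)" by (simp add: u vec_eq_iff)
        then show ?thesis unfolding E_def by (rule image_eqI) (rule bal[OF c u(1)])
      qed
    qed (metis xD ED' add.assoc)
    also have "\<dots> \<le> (\<integral>\<^sup>+w. ennreal c * (indicator D (r *\<^sub>R v + w) * ennreal (cmod (F (x + (r *\<^sub>R v + w))) powr s)) \<partial>lborel)"
    proof (rule nn_integral_mono)
      fix w
      show "indicator E w * ennreal (cmod (f (x + r *\<^sub>R v + w)))
        \<le> ennreal c * (indicator D (r *\<^sub>R v + w) * ennreal (cmod (F (x + (r *\<^sub>R v + w))) powr s))"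
      proof (cases "w \<in> E")
        case True
        then show ?thesis using bd[OF True] ED'[OF True]
          by (simp add: Ff add.assoc c_def mult.commute flip: ennreal_mult)
      qed simp
    qed
    also have "\<dots> = ennreal c * (\<integral>\<^sup>+w. indicator D (r *\<^sub>R v + w) * ennreal (cmod (F (x + (r *\<^sub>R v + w))) powr s) \<partial>lborel)"
      by (subst nn_integral_cmult) auto
    also have "(\<integral>\<^sup>+w. indicator D (r *\<^sub>R v + w) * ennreal (cmod (F (x + (r *\<^sub>R v + w))) powr s) \<partial>lborel)
      = (\<integral>\<^sup>+w. indicator D w * ennreal (cmod (F (x + w)) powr s) \<partial>lborel)"
      by (rule nn_integral_lborel_translate) measurable
    also have "\<dots> = I"
      unfolding I_def by (intro nn_integral_cong) (auto simp: indicator_def Ff)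
    finally have "ennreal (cmod (f (x + r *\<^sub>R v))) * (ennreal (\<rho> ^ DIM(complex ^ 'n)) * ennreal L) \<le> ennreal c * ennreal A"
      unfolding E_def emeasure_lborel_scaleR(2)[OF D \<rho>(1)] A L .
    then have "cmod (f (x + r *\<^sub>R v)) * (\<rho> ^ DIM(complex ^ 'n) * L) \<le> c * A"
      using \<rho> L A by (simp add: c_def flip: ennreal_mult)
    then have "cmod (f (x + r *\<^sub>R v)) \<le> c * A / (\<rho> powr d * L)"
      using \<rho> L powr_realpow[OF \<rho>(1), of "DIM(complex ^ 'n)"]
      by (simp add: pos_le_divide_eq d_def del: DIM_cart)
    moreover have "1 - r = 2 * \<rho>" by (simp add: \<rho>_def)
    ultimately have "y \<le> (2 * \<rho>) powr (d / s) * (c * A / (\<rho> powr d * L))"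
      unfolding rv(1) by (simp only: mult_left_mono powr_ge_zero)
    also have "\<dots> = 2 powr (d / s) * A / L * m powr (1 - s) * (\<rho> powr (d / s) * (\<rho> powr (- d / s)) powr (1 - s) / \<rho> powr d)"
      using \<rho> m by (simp add: c_def powr_mult mult_ac)
    also have "\<rho> powr (d / s) * (\<rho> powr (- d / s)) powr (1 - s) / \<rho> powr d = \<rho> powr (d / s + (- d / s) * (1 - s) - d)"
      by (simp only: powr_powr powr_add[symmetric] powr_diff[symmetric])
    also have "d / s + (- d / s) * (1 - s) - d = 0" using s by (simp add: field_simps)
    finally show ?thesis using \<rho> by (simp add: B_def)
  qed
  then have "m \<le> B * m powr (1 - s)"
    unfolding m_def using fxX by (intro cSup_least) auto
  then have "m powr s * m powr (1 - s) \<le> B * m powr (1 - s)" using m by (simp flip: powr_add)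
  then have "m powr s \<le> B" using m by simp
  then have "cmod (f x) powr s \<le> B" using powr_mono2[OF _ _ fm, of s] s by simp
  then have "cmod (f x) powr s * L \<le> 2 powr (d / s) * A"
    using L by (simp add: B_def pos_le_divide_eq)
  then show ?thesis unfolding I_def[symmetric] A L using A L
    by (simp add: d_def flip: ennreal_mult)
qed (use s in simp)

text \<open>Any positive power of \<open>\<bar>f\<bar>\<close> is a power at most \<open>1\<close> of \<open>\<bar>f\<^sup>k\<bar>\<close> for some natural \<open>k\<close>.\<close>

lemma holo_sub_mean_value:
  fixes t :: real
  assumes t: "t > 0"
  obtains C where "C > 0" "\<And>(f :: complex ^ 'n::finite \<Rightarrow> complex) S D x. \<lbrakk>open S; holo_fun_on f S; compact D;
     \<And>c v. cmod c \<le> 1 \<Longrightarrow> v \<in> D \<Longrightarrow> c *s v \<in> D; convex D; \<And>v. v \<in> D \<Longrightarrow> x + v \<in> S\<rbrakk> \<Longrightarrow>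
     ennreal (cmod (f x) powr t) * emeasure lborel D
    \<le> ennreal C * (\<integral>\<^sup>+v. indicator D v * ennreal (cmod (f (x + v)) powr t) \<partial>lborel)"
proof -
  define k where "k = nat \<lceil>t\<rceil>"
  have k: "k > 0" "t \<le> real k" using t by (auto simp: k_def) 
  define s where "s = t / k"
  have s: "0 < s" "s \<le> 1" "t = real k * s" using k t by (auto simp: s_def)
  have pw: "y powr t = (y ^ k) powr s" if "y \<ge> 0" for y :: real
    using that s k by (cases "y = 0") (auto simp: powr_powr simp flip: powr_realpow)
  show ?thesis
  proof (rule that[of "2 powr (DIM(complex ^ 'n) / s)"])
    fix f :: "complex ^ 'n \<Rightarrow> complex" and S D :: "(complex ^ 'n) set" and x :: "complex ^ 'n"
    assume S: "open S" and f: "holo_fun_on f S" and D: "compact D"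
      and bal: "\<And>c v. cmod c \<le> 1 \<Longrightarrow> v \<in> D \<Longrightarrow> c *s v \<in> D" and conv: "convex D"
      and xD: "\<And>v. v \<in> D \<Longrightarrow> x + v \<in> S"
    have "continuous_on D (\<lambda>v. f (x + v) ^ k)"
      by (intro continuous_intros continuous_on_compose2[OF continuous_on_holo_fun[OF f]]) (auto intro: xD)
    then have "compact ((\<lambda>v. f (x + v) ^ k) ` D)" using D by (rule compact_continuous_image)
    then obtain K where K: "\<And>v. v \<in> D \<Longrightarrow> cmod (f (x + v) ^ k) \<le> K"
      by (meson bounded_iff compact_imp_bounded image_eqI)
    have fin: "emeasure lborel D < \<infinity>" using emeasure_bounded_finite[OF compact_imp_bounded[OF D]] .
    then obtain L where L: "emeasure lborel D = ennreal L" "L \<ge> 0"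
      by (metis ennreal_cases infinity_ennreal_def less_irrefl)
    show "ennreal (cmod (f x) powr t) * emeasure lborel D
      \<le> ennreal (2 powr (DIM(complex ^ 'n) / s)) * (\<integral>\<^sup>+v. indicator D v * ennreal (cmod (f (x + v)) powr t) \<partial>lborel)"
    proof (cases "L = 0")
      case False
      then show ?thesis
        using holo_sub_mean_value_le_one[OF S holo_fun_on_power[OF f, of k] _ bal conv xD K s(1,2) L(1)] L D
        by (simp add: norm_power pw borel_compact)
    qed (simp add: L)
  qed simp
qed

section \<open>The weighted measure and anisotropic balls\<close>

lemma powr_comparable:
  fixes x d G \<alpha> :: real
  assumes "0 < d" "d \<le> G * x" "x \<le> G * d" "G \<ge> 1"
  shows "G powr (- \<bar>\<alpha>\<bar>) * d powr \<alpha> \<le> x powr \<alpha>" "x powr \<alpha> \<le> G powr \<bar>\<alpha>\<bar> * d powr \<alpha>"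
proof -
  have x: "x > 0" using assms by (metis less_le_trans not_less zero_less_mult_pos zero_less_one)
  have "x powr \<alpha> \<le> G powr \<bar>\<alpha>\<bar> * y powr \<alpha> \<and> G powr (- \<bar>\<alpha>\<bar>) * y powr \<alpha> \<le> x powr \<alpha>"
    if "0 < y" "y \<le> G * x" "x \<le> G * y" "x > 0" for x y
  proof -
    have *: "x powr \<alpha> \<le> G powr \<bar>\<alpha>\<bar> * y powr \<alpha>" if "0 < y" "y \<le> G * x" "x \<le> G * y" "x > 0" for x y
    proof (cases "\<alpha> \<ge> 0")
      case True
      then have "x powr \<alpha> \<le> (G * y) powr \<alpha>" using that by (intro powr_mono2) auto
      then show ?thesis using True that assms by (simp add: powr_mult)
    next
      case False
      then have "(G * x) powr \<alpha> \<le> y powr \<alpha>" using that by (intro powr_mono2') auto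
      then have "G powr (- \<alpha>) * (G powr \<alpha> * x powr \<alpha>) \<le> G powr (- \<alpha>) * y powr \<alpha>"
        using that assms by (intro mult_left_mono) (auto simp: powr_mult)
      also have "G powr (- \<alpha>) * (G powr \<alpha> * x powr \<alpha>) = x powr \<alpha>"
        using assms by (simp add: powr_minus)
      finally show ?thesis using False by simp
    qed
    have "y powr \<alpha> \<le> G powr \<bar>\<alpha>\<bar> * x powr \<alpha>" by (rule *) (use that in auto)
    then have "G powr (- \<bar>\<alpha>\<bar>) * y powr \<alpha> \<le> G powr (- \<bar>\<alpha>\<bar>) * (G powr \<bar>\<alpha>\<bar> * x powr \<alpha>)"
      by (intro mult_left_mono) auto
    also have "\<dots> = x powr \<alpha>" using assms by (simp add: powr_minus)
    finally show ?thesis using *[OF that] by simp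
  qed
  from this[OF assms(1-3) x] show "G powr (- \<bar>\<alpha>\<bar>) * d powr \<alpha> \<le> x powr \<alpha>" "x powr \<alpha> \<le> G powr \<bar>\<alpha>\<bar> * d powr \<alpha>"
    by auto
qed

lemma defect_measurable [measurable]: "defect \<in> borel_measurable borel"
  unfolding defect_def by measurable

lemma continuous_on_herm [continuous_intros]:
  assumes "continuous_on A f" "continuous_on A g"
  shows "continuous_on A (\<lambda>x. herm (f x) (g x))"
  unfolding herm_def by (intro continuous_intros assms)

lemma herm_measurable [measurable]: "(\<lambda>w. herm w a) \<in> borel_measurable borel"
  by (intro borel_measurable_continuous_onI continuous_intros)

text \<open>The density of \<open>V_alpha \<alpha>\<close>.\<close>

definition weight :: "real \<Rightarrow> complex ^ 'n::finite \<Rightarrow> real" where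
  "weight \<alpha> z = c_alpha TYPE('n) \<alpha> * defect z powr \<alpha>"

lemma c_alpha_nonneg: "c_alpha TYPE('n::finite) \<alpha> \<ge> 0"
  unfolding c_alpha_def set_lebesgue_integral_def by (auto intro!: integral_nonneg simp: indicator_def)

lemma weight_measurable [measurable]: "weight \<alpha> \<in> borel_measurable borel"
  unfolding weight_def by measurable

lemma space_V_alpha [simp]: "space (V_alpha \<alpha>) = ball 0 1"
  by (simp add: V_alpha_def space_restrict_space)

lemma sets_V_alpha [measurable_cong]:
  "sets (V_alpha \<alpha> :: (complex ^ 'n::finite) measure) = sets (restrict_space borel (ball 0 1))"
  by (simp add: V_alpha_def) (metis sets_lborel sets_restrict_space_cong)

lemma in_sets_V_alpha: "A \<in> sets borel \<Longrightarrow> A \<subseteq> ball 0 1 \<Longrightarrow> A \<in> sets (V_alpha \<alpha>)"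
  by (auto simp: sets_V_alpha sets_restrict_space)

lemma measurable_V_alpha_borel:
  "f \<in> borel_measurable borel \<Longrightarrow> f \<in> borel_measurable (V_alpha \<alpha>)"
  unfolding measurable_cong_sets[OF sets_V_alpha refl] by (rule measurable_restrict_space1)

lemma measurable_V_alpha_continuous:
  "continuous_on (ball 0 1) f \<Longrightarrow> f \<in> borel_measurable (V_alpha \<alpha>)"
  unfolding measurable_cong_sets[OF sets_V_alpha refl] by (rule borel_measurable_continuous_on_restrict)

lemma nn_integral_V_alpha:
  assumes "g \<in> borel_measurable (V_alpha \<alpha>)"
  shows "(\<integral>\<^sup>+z. g z \<partial>V_alpha \<alpha>)
    = (\<integral>\<^sup>+z. indicator (ball 0 1) z * (ennreal (weight \<alpha> z) * g z) \<partial>lborel)"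
proof -
  have W: "(\<lambda>z. ennreal (weight \<alpha> z)) \<in> borel_measurable (restrict_space lborel (ball 0 1))"
    by (intro measurable_restrict_space1) measurable
  have V: "V_alpha \<alpha> = density (restrict_space lborel (ball 0 1)) (\<lambda>z. ennreal (weight \<alpha> z))"
    by (simp add: V_alpha_def weight_def defect_def)
  have g: "g \<in> borel_measurable (restrict_space lborel (ball 0 1))"
    using assms unfolding V by simp
  show ?thesis unfolding V
    by (subst nn_integral_density[OF W g], subst nn_integral_restrict_space) (auto simp: mult.commute)
qed

lemma emeasure_V_alpha:
  assumes "A \<in> sets borel" "A \<subseteq> ball 0 1"
  shows "emeasure (V_alpha \<alpha>) A = (\<integral>\<^sup>+z. indicator A z * ennreal (weight \<alpha> z) \<partial>lborel)"
proof -
  have "emeasure (V_alpha \<alpha>) A = (\<integral>\<^sup>+z. indicator A z \<partial>V_alpha \<alpha>)"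
    using in_sets_V_alpha[OF assms] by simp
  also have "\<dots> = (\<integral>\<^sup>+z. indicator (ball 0 1) z * (ennreal (weight \<alpha> z) * indicator A z) \<partial>lborel)"
    by (rule nn_integral_V_alpha) (use assms in \<open>simp add: measurable_V_alpha_borel\<close>)
  also have "\<dots> = (\<integral>\<^sup>+z. indicator A z * ennreal (weight \<alpha> z) \<partial>lborel)"
    using assms(2) by (intro nn_integral_cong) (auto simp: indicator_def)
  finally show ?thesis .
qed

text \<open>Where the defect is comparable to a constant \<open>d\<close>, the measure is a multiple of Lebesgue measure, up to
  factors that depend on the comparison constant only.\<close>

lemma emeasure_V_alpha_comparable:
  fixes A :: "(complex ^ 'n::finite) set"
  assumes "A \<in> sets borel" "A \<subseteq> ball 0 1" "d > 0" "G \<ge> 1"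
    and "\<And>w. w \<in> A \<Longrightarrow> d \<le> G * defect w \<and> defect w \<le> G * d"
  shows "ennreal (c_alpha TYPE('n) \<alpha> * G powr (- \<bar>\<alpha>\<bar>) * d powr \<alpha>) * emeasure lborel A \<le> emeasure (V_alpha \<alpha>) A"
    "emeasure (V_alpha \<alpha>) A \<le> ennreal (c_alpha TYPE('n) \<alpha> * G powr \<bar>\<alpha>\<bar> * d powr \<alpha>) * emeasure lborel A"
proof -
  have const: "(\<integral>\<^sup>+z. indicator A z * ennreal c \<partial>lborel) = ennreal c * emeasure lborel A" for c
    using assms(1) by (subst nn_integral_multc) (auto simp: mult.commute)
  have b: "c_alpha TYPE('n) \<alpha> * G powr (- \<bar>\<alpha>\<bar>) * d powr \<alpha> \<le> weight \<alpha> w"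
    "weight \<alpha> w \<le> c_alpha TYPE('n) \<alpha> * G powr \<bar>\<alpha>\<bar> * d powr \<alpha>" if "w \<in> A" for w
    using powr_comparable[of d G "defect w" \<alpha>] assms(3,4) assms(5)[OF that]
    by (auto simp: weight_def mult.assoc intro!: mult_left_mono c_alpha_nonneg)
  show "ennreal (c_alpha TYPE('n) \<alpha> * G powr (- \<bar>\<alpha>\<bar>) * d powr \<alpha>) * emeasure lborel A \<le> emeasure (V_alpha \<alpha>) A"
    unfolding emeasure_V_alpha[OF assms(1,2)] const[symmetric]
    by (intro nn_integral_mono) (auto simp: indicator_def intro!: ennreal_leI b)
  show "emeasure (V_alpha \<alpha>) A \<le> ennreal (c_alpha TYPE('n) \<alpha> * G powr \<bar>\<alpha>\<bar> * d powr \<alpha>) * emeasure lborel A"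
    unfolding emeasure_V_alpha[OF assms(1,2)] const[symmetric]
    by (intro nn_integral_mono) (auto simp: indicator_def intro!: ennreal_leI b)
qed

text \<open>Up to constants, \<open>a + aniso_ball a r\<close> is a Bergman ball around \<open>a\<close>: its extent is the defect in the
  complex direction of \<open>a\<close> and the square root of the defect in the other directions. Bounding \<open>\<langle>v, a\<rangle>\<close>
  instead of a projection of \<open>v\<close> makes it obvious that the set is convex and balanced, and homogeneous
  in \<open>r\<close>.\<close>

definition aniso_ball :: "complex ^ 'n \<Rightarrow> real \<Rightarrow> (complex ^ 'n) set" where
  "aniso_ball a r = {v. cmod (herm v a) \<le> r * defect a \<and> norm v \<le> r * sqrt (defect a)}"

lemma closed_aniso_ball: "closed (aniso_ball a r)"
  unfolding aniso_ball_def by (intro closed_Collect_conj closed_Collect_le continuous_intros)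

lemma aniso_ball_borel [measurable]: "aniso_ball a r \<in> sets borel"
  using closed_aniso_ball by (rule borel_closed)

lemma compact_aniso_ball: "compact (aniso_ball a r)"
proof -
  have "bounded (aniso_ball a r)"
    by (rule bounded_subset[of "cball 0 (r * sqrt (defect a))"]) (auto simp: aniso_ball_def)
  then show ?thesis using closed_aniso_ball compact_eq_bounded_closed by blast
qed

lemma convex_aniso_ball: "convex (aniso_ball (a :: complex ^ 'n) r)"
proof (rule convexI)
  fix x y :: "complex ^ 'n" and s t :: real
  assume xy: "x \<in> aniso_ball a r" "y \<in> aniso_ball a r" and st: "0 \<le> s" "0 \<le> t" "s + t = 1"
  have conv: "s * c + t * c = c" for c using st(3) by (simp flip: distrib_right)
  have "cmod (herm (s *\<^sub>R x + t *\<^sub>R y) a) \<le> s * cmod (herm x a) + t * cmod (herm y a)"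
    unfolding herm_add_left herm_scaleR_left
    by (rule order_trans[OF norm_triangle_ineq]) (use st in \<open>simp add: norm_mult\<close>)
  also have "\<dots> \<le> s * (r * defect a) + t * (r * defect a)"
    using xy st by (intro add_mono mult_left_mono) (auto simp: aniso_ball_def)
  finally have 1: "cmod (herm (s *\<^sub>R x + t *\<^sub>R y) a) \<le> r * defect a" by (simp only: conv)
  have "norm (s *\<^sub>R x + t *\<^sub>R y) \<le> s * norm x + t * norm y"
    by (rule order_trans[OF norm_triangle_ineq]) (use st in simp)
  also have "\<dots> \<le> s * (r * sqrt (defect a)) + t * (r * sqrt (defect a))"
    using xy st by (intro add_mono mult_left_mono) (auto simp: aniso_ball_def)
  finally show "s *\<^sub>R x + t *\<^sub>R y \<in> aniso_ball a r" using 1 by (simp only: conv aniso_ball_def mem_Collect_eq)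
qed

lemma balanced_aniso_ball:
  assumes "cmod c \<le> 1" "v \<in> aniso_ball a r"
  shows "c *s v \<in> aniso_ball a r"
proof -
  have "cmod c * cmod (herm v a) \<le> cmod (herm v a)" "cmod c * norm v \<le> norm v"
    using assms(1) by (simp_all add: mult_left_le_one_le)
  with assms(2) have "cmod c * cmod (herm v a) \<le> r * defect a" "cmod c * norm v \<le> r * sqrt (defect a)"
    unfolding aniso_ball_def by simp_all
  then show ?thesis by (simp add: aniso_ball_def herm_mult_left norm_mult norm_cmult_vec)
qed

lemma aniso_ball_scaleR:
  assumes "r > 0"
  shows "aniso_ball a r = (\<lambda>v. r *\<^sub>R v) ` aniso_ball a 1"
proof -
  have *: "r *\<^sub>R v \<in> aniso_ball a r \<longleftrightarrow> v \<in> aniso_ball a 1" for v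
    using assms by (simp add: aniso_ball_def herm_scaleR_left norm_mult mult.assoc)
  show ?thesis
  proof (intro set_eqI iffI)
    fix v assume "v \<in> aniso_ball a r"
    then have "(1 / r) *\<^sub>R v \<in> aniso_ball a 1" using assms by (subst *[symmetric]) simp
    then show "v \<in> (\<lambda>v. r *\<^sub>R v) ` aniso_ball a 1"
      by (rule rev_image_eqI) (use assms in simp)
  qed (use * in auto)
qed

lemma emeasure_aniso_ball:
  fixes a :: "complex ^ 'n::finite"
  assumes "r > 0"
  shows "emeasure lborel (aniso_ball a r) = ennreal (r ^ DIM(complex ^ 'n)) * emeasure lborel (aniso_ball a 1)"
  unfolding aniso_ball_scaleR[OF assms] by (rule emeasure_lborel_scaleR(2)[OF aniso_ball_borel assms])

lemma emeasure_aniso_ball_finite: "emeasure lborel (aniso_ball a r) < \<infinity>"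
  using emeasure_bounded_finite[OF compact_imp_bounded[OF compact_aniso_ball]] .

text \<open>The quantity \<open>\<bar>1 - \<langle>w, a\<rangle>\<bar>\<close> controls \<open>\<langle>w - a, a\<rangle>\<close> linearly and \<open>\<bar>w - a\<bar>\<close> through its square root, which is
  the anisotropy of \<open>aniso_ball\<close>.\<close>

lemma diff_in_aniso_ball:
  assumes "w \<in> ball 0 1" "a \<in> ball 0 1" "cmod (1 - herm w a) \<le> b * defect a" "b \<ge> 1"
  shows "w - a \<in> aniso_ball a (2 * b)"
proof -
  have d: "defect a > 0" using assms(2) by (rule defect_pos)
  have "herm (w - a) a = of_real (defect a) - (1 - herm w a)"
    by (simp add: herm_diff_left herm_self defect_def)
  then have "cmod (herm (w - a) a) \<le> defect a + cmod (1 - herm w a)"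
    by (metis norm_triangle_ineq4 norm_of_real abs_of_pos d)
  also have "\<dots> \<le> 1 * defect a + b * defect a" using assms by simp
  also have "\<dots> \<le> b * defect a + b * defect a" using assms d by (intro add_right_mono mult_right_mono) auto
  finally have 1: "cmod (herm (w - a) a) \<le> 2 * b * defect a" by simp
  have "(norm (w - a))\<^sup>2 \<le> 2 * cmod (1 - herm w a)" by (rule norm_diff_sq_le) (use assms in auto)
  also have "\<dots> \<le> (2 * b) * defect a" using assms by simp
  also have "\<dots> \<le> (2 * b)\<^sup>2 * defect a"
    using assms d by (intro mult_right_mono) (auto simp: power2_eq_square)
  also have "\<dots> = (2 * b * sqrt (defect a))\<^sup>2" using d by (simp add: power_mult_distrib)
  finally have "norm (w - a) \<le> 2 * b * sqrt (defect a)"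
    by (rule power2_le_imp_le) (use assms d in auto)
  then show ?thesis using 1 by (simp add: aniso_ball_def)
qed

section \<open>Whitney boxes\<close>

text \<open>What the estimates near a single box need to know about one Bergman tree: the boxes \<open>K a\<close> partition
  the ball, lie between two Bergman balls around \<open>a\<close>, and have the expected volume. Everything up to the
  testing of the operator is local in this sense.\<close>

locale whitney_cover =
  fixes T :: "(complex ^ 'n::finite) set" and K :: "complex ^ 'n \<Rightarrow> (complex ^ 'n) set"
    and \<alpha> r1 r2 c\<^sub>V C\<^sub>V :: real
  assumes countable_T: "countable T" and T_ball: "T \<subseteq> ball 0 1"
    and K_borel: "\<And>a. a \<in> T \<Longrightarrow> K a \<in> sets borel"
    and K_disjoint: "disjoint_family_on K T" and K_cover: "(\<Union>a\<in>T. K a) = ball 0 1"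
    and r1: "0 < r1" and r2: "0 < r2"
    and K_inner: "\<And>a. a \<in> T \<Longrightarrow> bergman_ball a r1 \<subseteq> K a"
    and K_outer: "\<And>a. a \<in> T \<Longrightarrow> K a \<subseteq> bergman_ball a r2"
    and c\<^sub>V: "0 < c\<^sub>V" and C\<^sub>V: "0 < C\<^sub>V"
    and K_lower: "\<And>a. a \<in> T \<Longrightarrow> c\<^sub>V * defect a powr (CARD('n) + 1 + \<alpha>) \<le> measure (V_alpha \<alpha>) (K a)"
    and K_upper: "\<And>a. a \<in> T \<Longrightarrow> measure (V_alpha \<alpha>) (K a) \<le> C\<^sub>V * defect a powr (CARD('n) + 1 + \<alpha>)"
    and finite_V: "emeasure (V_alpha \<alpha> :: (complex ^ 'n) measure) (ball 0 1) < \<infinity>"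
    and \<alpha>: "\<alpha> > -1"
begin

definition hom_dim :: real where "hom_dim = CARD('n) + 1 + \<alpha>"

lemma hom_dim_pos: "hom_dim > 0"
  using \<alpha> by (simp add: hom_dim_def)

lemma K_ball: "a \<in> T \<Longrightarrow> K a \<subseteq> ball 0 1"
  using K_cover by blast

lemma emeasure_V_finite: "A \<subseteq> ball 0 1 \<Longrightarrow> emeasure (V_alpha \<alpha>) (A :: (complex ^ 'n) set) < \<infinity>"
  using emeasure_mono[of A "ball 0 1" "V_alpha \<alpha>"] finite_V
  by (metis in_sets_V_alpha order_le_less_trans open_ball borel_open order_refl)

lemma emeasure_V_eq: "A \<subseteq> ball 0 1 \<Longrightarrow> emeasure (V_alpha \<alpha>) (A :: (complex ^ 'n) set) = ennreal (measure (V_alpha \<alpha>) A)"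
  using emeasure_V_finite[of A] by (intro emeasure_eq_ennreal_measure) auto

text \<open>If the integral that defines the normalising constant diverged, the constant would be \<open>0\<close> and every box
  a null set, contrary to the lower bound on their volumes.\<close>

lemma c_alpha_pos: "c_alpha TYPE('n) \<alpha> > 0"
proof (rule ccontr)
  assume "\<not> c_alpha TYPE('n) \<alpha> > 0"
  then have c0: "c_alpha TYPE('n) \<alpha> = 0" using c_alpha_nonneg by (metis less_eq_real_def)
  have "(0 :: complex ^ 'n) \<in> (\<Union>a\<in>T. K a)" unfolding K_cover by simp
  then obtain a where a: "a \<in> T" by blast
  have "emeasure (V_alpha \<alpha>) (K a) = 0"
    by (subst emeasure_V_alpha[OF K_borel[OF a] K_ball[OF a]]) (simp add: weight_def c0)
  then have "measure (V_alpha \<alpha>) (K a) = 0" by (simp add: measure_def)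
  moreover have "defect a > 0" using a T_ball defect_pos by blast
  ultimately show False using K_lower[OF a] c\<^sub>V by (simp add: mult_le_0_iff)
qed

definition \<Gamma> :: real where "\<Gamma> = 4 / (1 - (tanh r2)\<^sup>2)"

lemma \<Gamma>_ge_4: "\<Gamma> \<ge> 4"
proof -
  have "tanh r2 < 1" by (rule tanh_real_lt_1)
  moreover have "tanh r2 > 0" using r2 by simp
  ultimately have "(tanh r2)\<^sup>2 < 1" by (simp add: power_less_one_iff)
  then show ?thesis by (simp add: \<Gamma>_def field_simps)
qed

text \<open>By \<open>bergman_ball_iff\<close> a box lies where \<open>\<kappa> \<bar>1 - \<langle>w, a\<rangle>\<bar>\<^sup>2\<close> is below the product of the defects, while
  \<open>\<bar>1 - \<langle>w, a\<rangle>\<bar>\<close> is at least half their sum. Both are possible only if the two defects are comparable.\<close>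

lemma box_geometry:
  assumes a: "a \<in> T" and w: "w \<in> K a"
  shows "defect w \<le> \<Gamma> * defect a" "defect a \<le> \<Gamma> * defect w" "cmod (1 - herm w a) \<le> \<Gamma> * defect a"
proof -
  define \<kappa> where "\<kappa> = 1 - (tanh r2)\<^sup>2"
  have \<kappa>: "\<kappa> > 0" "\<Gamma> = 4 / \<kappa>"
  proof -
    show "\<Gamma> = 4 / \<kappa>" by (simp add: \<Gamma>_def \<kappa>_def)
    then have "0 < 4 / \<kappa>" using \<Gamma>_ge_4 by linarith
    then show "\<kappa> > 0" unfolding zero_less_divide_iff by auto
  qed
  have ab: "a \<in> ball 0 1" using a T_ball by blast
  have wb: "w \<in> ball 0 1" using K_ball a w by blast
  have da: "defect a > 0" "defect w > 0" using ab wb by (simp_all add: defect_pos del: mem_ball_0)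
  let ?h = "cmod (1 - herm w a)"
  have "w \<in> bergman_ball a r2" using K_outer a w by blast
  then have main: "\<kappa> * ?h\<^sup>2 < defect a * defect w"
    unfolding \<kappa>_def using bergman_ball_iff[OF ab wb r2] by blast
  have h: "defect a + defect w \<le> 2 * ?h" by (rule defect_le_one_minus_herm)
  have sq: "\<kappa> * (defect a + defect w)\<^sup>2 \<le> 4 * (\<kappa> * ?h\<^sup>2)"
  proof -
    have "(defect a + defect w)\<^sup>2 \<le> (2 * ?h)\<^sup>2" using h da by (intro power_mono) auto
    then have "\<kappa> * (defect a + defect w)\<^sup>2 \<le> \<kappa> * (2 * ?h)\<^sup>2" using \<kappa> by (intro mult_left_mono) auto
    then show ?thesis by (simp add: power_mult_distrib)
  qed
  have 0: "\<kappa> * (defect a + defect w)\<^sup>2 < 4 * (defect a * defect w)" using sq main by linarith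
  have gen: "y \<le> \<Gamma> * x" if "\<kappa> * (x + y)\<^sup>2 < 4 * (x * y)" "x > 0" "y > 0" for x y
  proof -
    have "\<kappa> * y * y \<le> \<kappa> * (x + y)\<^sup>2"
      using that \<kappa> by (simp add: power2_eq_square algebra_simps)
    then have "(\<kappa> * y) * y < (4 * x) * y" using that by linarith
    then have "\<kappa> * y < 4 * x" using that by (simp only: mult_less_cancel_right_pos[OF \<open>y > 0\<close>])
    then show ?thesis using \<kappa> by (simp add: pos_le_divide_eq mult.commute)
  qed
  show 1: "defect w \<le> \<Gamma> * defect a" by (rule gen) (use 0 da in auto)
  show 2: "defect a \<le> \<Gamma> * defect w" by (rule gen) (use 0 da in \<open>auto simp: add.commute mult.commute\<close>)
  show "?h \<le> \<Gamma> * defect a"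
  proof (rule power2_le_imp_le)
    have "?h\<^sup>2 \<le> defect a * defect w / \<kappa>" using main \<kappa> by (simp add: pos_le_divide_eq mult.commute)
    also have "\<dots> = defect a * defect w * \<Gamma> / 4" using \<kappa> by simp
    also have "\<dots> \<le> defect a * (\<Gamma> * defect a) * \<Gamma> / 4"
      using 1 da \<Gamma>_ge_4 by (intro divide_right_mono mult_right_mono mult_left_mono) auto
    also have "\<dots> = (\<Gamma> * defect a)\<^sup>2 / 4" by (simp add: power2_eq_square)
    also have "\<dots> \<le> (\<Gamma> * defect a)\<^sup>2" by simp
    finally show "?h\<^sup>2 \<le> (\<Gamma> * defect a)\<^sup>2" .
  qed (use \<Gamma>_ge_4 da in auto)
qed

text \<open>Near \<open>a\<close> the quotient \<open>\<delta>(a) \<delta>(w) / \<bar>1 - \<langle>w, a\<rangle>\<bar>\<^sup>2\<close> is close to \<open>1\<close>, uniformly in \<open>a\<close> when the displacement is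
  measured by \<open>aniso_ball\<close>, so that it exceeds the threshold of the inner Bergman ball.\<close>

lemma aniso_ball_inside_box:
  obtains \<epsilon> where "\<epsilon> > 0" "\<And>a v. a \<in> T \<Longrightarrow> v \<in> aniso_ball a \<epsilon> \<Longrightarrow> a + v \<in> K a"
proof -
  define \<kappa> where "\<kappa> = 1 - (tanh r1)\<^sup>2"
  have t: "0 < tanh r1" "tanh r1 < 1" using r1 by (simp_all add: tanh_real_lt_1)
  then have "0 < (tanh r1)\<^sup>2" "(tanh r1)\<^sup>2 < 1" by (simp_all add: power_less_one_iff)
  then have \<kappa>: "0 < \<kappa>" "\<kappa> < 1" by (simp_all add: \<kappa>_def)
  \<comment> \<open>then \<open>\<kappa> (1 + \<epsilon>)\<^sup>2 < 1 - 3 \<epsilon>\<close>\<close>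
  define \<epsilon> where "\<epsilon> = (1 - \<kappa>) / 10"
  have \<epsilon>: "0 < \<epsilon>" "\<epsilon> < 1 / 10" using \<kappa> by (simp_all add: \<epsilon>_def)
  have e2: "\<epsilon>\<^sup>2 \<le> \<epsilon>" using \<epsilon> by (simp add: power2_eq_square mult_le_cancel_right1)
  show ?thesis
  proof (rule that[OF \<epsilon>(1)])
    fix a v assume a: "a \<in> T" and v: "v \<in> aniso_ball a \<epsilon>"
    have ab: "a \<in> ball 0 1" using a T_ball by blast
    then have da: "defect a > 0" by (rule defect_pos)
    have v1: "cmod (herm v a) \<le> \<epsilon> * defect a" and v2: "norm v \<le> \<epsilon> * sqrt (defect a)"
      using v by (simp_all add: aniso_ball_def)
    have "(norm v)\<^sup>2 \<le> (\<epsilon> * sqrt (defect a))\<^sup>2" using v2 by (intro power_mono) auto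
    also have "\<dots> = \<epsilon>\<^sup>2 * defect a" using da by (simp add: power_mult_distrib)
    also have "\<dots> \<le> \<epsilon> * defect a" using e2 da by (intro mult_right_mono) auto
    finally have v3: "(norm v)\<^sup>2 \<le> \<epsilon> * defect a" .
    have "defect (a + v) = defect a - 2 * Re (herm v a) - (norm v)\<^sup>2"
      unfolding Re_herm defect_def power2_norm_eq_inner by (simp add: inner_add inner_commute)
    moreover have "Re (herm v a) \<le> \<epsilon> * defect a" using v1 complex_Re_le_cmod order_trans by blast
    ultimately have dl: "defect (a + v) \<ge> (1 - 3 * \<epsilon>) * defect a" using v3 by (simp add: algebra_simps)
    moreover have "(1 - 3 * \<epsilon>) * defect a > 0" using \<epsilon> da by simp
    ultimately have "defect (a + v) > 0" by (rule less_le_trans[rotated])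
    then have wb: "a + v \<in> ball 0 1" by (simp add: defect_pos_iff)
    have "1 - herm (a + v) a = of_real (defect a) - herm v a"
      by (simp add: herm_add_left herm_self defect_def)
    then have "cmod (1 - herm (a + v) a) \<le> defect a + cmod (herm v a)"
      by (metis norm_triangle_ineq4 norm_of_real abs_of_pos da)
    also have "\<dots> \<le> (1 + \<epsilon>) * defect a" using v1 by (simp add: algebra_simps)
    finally have "(cmod (1 - herm (a + v) a))\<^sup>2 \<le> ((1 + \<epsilon>) * defect a)\<^sup>2" by (intro power_mono) auto
    then have "\<kappa> * (cmod (1 - herm (a + v) a))\<^sup>2 \<le> \<kappa> * ((1 + \<epsilon>) * defect a)\<^sup>2"
      using \<kappa> by (intro mult_left_mono) auto
    also have "\<dots> = (\<kappa> * (1 + \<epsilon>)\<^sup>2) * (defect a)\<^sup>2" by (simp add: power_mult_distrib)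
    also have "\<dots> < (1 - 3 * \<epsilon>) * (defect a)\<^sup>2"
    proof (rule mult_strict_right_mono)
      have "\<kappa> * (1 + \<epsilon>)\<^sup>2 = \<kappa> + \<kappa> * (2 * \<epsilon> + \<epsilon>\<^sup>2)" by (simp add: power2_eq_square algebra_simps)
      also have "\<dots> \<le> \<kappa> + 1 * (3 * \<epsilon>)" using \<kappa> \<epsilon> e2 by (intro add_left_mono mult_mono) auto
      also have "\<dots> < 1 - 3 * \<epsilon>"
      proof -
        have "10 * \<epsilon> = 1 - \<kappa>" by (simp add: \<epsilon>_def)
        then show ?thesis using \<epsilon>(1) by linarith
      qed
      finally show "\<kappa> * (1 + \<epsilon>)\<^sup>2 < 1 - 3 * \<epsilon>" .
    qed (use da in auto)
    also have "\<dots> = defect a * ((1 - 3 * \<epsilon>) * defect a)" by (simp add: power2_eq_square)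
    also have "\<dots> \<le> defect a * defect (a + v)" using dl da by (intro mult_left_mono) auto
    finally have "a + v \<in> bergman_ball a r1"
      using bergman_ball_iff[OF ab wb r1] by (simp add: \<kappa>_def)
    then show "a + v \<in> K a" using K_inner[OF a] by blast
  qed
qed

lemma emeasure_lborel_translate:
  fixes A :: "(complex ^ 'n) set"
  assumes "A \<in> sets borel"
  shows "emeasure lborel ((\<lambda>v. a + v) -` A) = emeasure lborel A"
proof -
  have "emeasure lborel A = emeasure (distr lborel borel ((+) a)) A" by (simp add: lborel_distr_plus)
  also have "\<dots> = emeasure lborel ((\<lambda>v. a + v) -` A)" using assms by (subst emeasure_distr) auto
  finally show ?thesis ..
qed

definition aniso_vol :: "complex ^ 'n \<Rightarrow> real" where "aniso_vol a = measure lborel (aniso_ball a 1)"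

lemma emeasure_aniso_ball_aniso_vol:
  assumes "r > 0"
  shows "emeasure lborel (aniso_ball a r) = ennreal (r ^ DIM(complex ^ 'n) * aniso_vol a)"
proof -
  have "emeasure lborel (aniso_ball a 1) = ennreal (aniso_vol a)"
    unfolding aniso_vol_def using emeasure_aniso_ball_finite[of a 1] by (intro emeasure_eq_ennreal_measure) auto
  then show ?thesis
    unfolding emeasure_aniso_ball[OF assms] using assms by (simp add: ennreal_mult aniso_vol_def del: DIM_cart)
qed

text \<open>A box has weighted volume about \<open>\<delta>(a) powr (n + 1 + \<alpha>)\<close> and density about \<open>\<delta>(a) powr \<alpha>\<close>, hence Lebesgue
  measure about \<open>\<delta>(a) powr (n + 1)\<close>; and it lies between two dilates of the anisotropic ball.\<close>

lemma aniso_vol_bounds: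
  obtains c C where "c > 0" "C > 0"
    "\<And>a. a \<in> T \<Longrightarrow> c * defect a powr (CARD('n) + 1) \<le> aniso_vol a"
    "\<And>a. a \<in> T \<Longrightarrow> aniso_vol a \<le> C * defect a powr (CARD('n) + 1)"
proof -
  obtain \<epsilon> where \<epsilon>: "\<epsilon> > 0" "\<And>a v. a \<in> T \<Longrightarrow> v \<in> aniso_ball a \<epsilon> \<Longrightarrow> a + v \<in> K a"
    using aniso_ball_inside_box by blast
  let ?d = "DIM(complex ^ 'n)"
  define c0 where "c0 = c_alpha TYPE('n) \<alpha>"
  have c0: "c0 > 0" unfolding c0_def by (rule c_alpha_pos)
  define cl where "cl = c\<^sub>V / (c0 * \<Gamma> powr \<bar>\<alpha>\<bar> * (2 * \<Gamma>) ^ ?d)"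
  define cu where "cu = C\<^sub>V / (c0 * \<Gamma> powr (- \<bar>\<alpha>\<bar>) * \<epsilon> ^ ?d)"
  show ?thesis
  proof (rule that[of cl cu])
    show "cl > 0" "cu > 0" using c0 \<Gamma>_ge_4 \<epsilon>(1) c\<^sub>V C\<^sub>V by (simp_all add: cl_def cu_def)
  next
    fix a assume a: "a \<in> T"
    then have ab: "a \<in> ball 0 1" using T_ball by blast
    then have da: "defect a > 0" by (rule defect_pos)
    have pw: "defect a powr (CARD('n) + 1 + \<alpha>) = defect a powr (CARD('n) + 1) * defect a powr \<alpha>"
      by (simp add: powr_add)
    have comp: "defect a \<le> \<Gamma> * defect w \<and> defect w \<le> \<Gamma> * defect a" if "w \<in> K a" for w
      using box_geometry[OF a that] by blast
    have "K a \<subseteq> (\<lambda>v. - a + v) -` aniso_ball a (2 * \<Gamma>)"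
    proof
      fix w assume w: "w \<in> K a"
      have "w - a \<in> aniso_ball a (2 * \<Gamma>)"
        by (rule diff_in_aniso_ball[OF subsetD[OF K_ball[OF a] w] ab box_geometry(3)[OF a w]])
          (use \<Gamma>_ge_4 in linarith)
      then show "w \<in> (\<lambda>v. - a + v) -` aniso_ball a (2 * \<Gamma>)" by simp
    qed
    then have "emeasure lborel (K a) \<le> emeasure lborel ((\<lambda>v. - a + v) -` aniso_ball a (2 * \<Gamma>))"
      by (rule emeasure_mono) (simp add: closed_vimage closed_aniso_ball borel_closed continuous_intros)
    also have "\<dots> = ennreal ((2 * \<Gamma>) ^ ?d * aniso_vol a)"
      unfolding emeasure_lborel_translate[OF aniso_ball_borel]
      by (rule emeasure_aniso_ball_aniso_vol) (use \<Gamma>_ge_4 in simp)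
    finally have "emeasure lborel (K a) \<le> ennreal ((2 * \<Gamma>) ^ ?d * aniso_vol a)" .
    moreover have "emeasure (V_alpha \<alpha>) (K a)
      \<le> ennreal (c0 * \<Gamma> powr \<bar>\<alpha>\<bar> * defect a powr \<alpha>) * emeasure lborel (K a)"
      unfolding c0_def by (rule emeasure_V_alpha_comparable(2)[OF K_borel[OF a] K_ball[OF a] da _ comp])
        (use \<Gamma>_ge_4 in simp)
    ultimately have "ennreal (measure (V_alpha \<alpha>) (K a))
      \<le> ennreal (c0 * \<Gamma> powr \<bar>\<alpha>\<bar> * defect a powr \<alpha>) * ennreal ((2 * \<Gamma>) ^ ?d * aniso_vol a)"
      unfolding emeasure_V_eq[OF K_ball[OF a]] by (meson mult_left_mono order_trans zero_le)
    also have "\<dots> = ennreal (c0 * \<Gamma> powr \<bar>\<alpha>\<bar> * defect a powr \<alpha> * ((2 * \<Gamma>) ^ ?d * aniso_vol a))"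
      using c0 \<Gamma>_ge_4 by (intro ennreal_mult[symmetric]) (auto simp: aniso_vol_def)
    finally have "measure (V_alpha \<alpha>) (K a) \<le> c0 * \<Gamma> powr \<bar>\<alpha>\<bar> * defect a powr \<alpha> * ((2 * \<Gamma>) ^ ?d * aniso_vol a)"
      using c0 \<Gamma>_ge_4 by (subst (asm) ennreal_le_iff) (auto simp: aniso_vol_def simp del: DIM_cart)
    then have "c\<^sub>V * (defect a powr (CARD('n) + 1) * defect a powr \<alpha>)
        \<le> c0 * \<Gamma> powr \<bar>\<alpha>\<bar> * defect a powr \<alpha> * ((2 * \<Gamma>) ^ ?d * aniso_vol a)"
      using K_lower[OF a] unfolding pw by linarith
    then have "(c\<^sub>V * defect a powr (CARD('n) + 1)) * defect a powr \<alpha>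
        \<le> (c0 * \<Gamma> powr \<bar>\<alpha>\<bar> * (2 * \<Gamma>) ^ ?d * aniso_vol a) * defect a powr \<alpha>"
      by (simp only: mult_ac)
    then have "c\<^sub>V * defect a powr (CARD('n) + 1) \<le> c0 * \<Gamma> powr \<bar>\<alpha>\<bar> * (2 * \<Gamma>) ^ ?d * aniso_vol a"
      using da by (simp only: mult_le_cancel_right_pos powr_gt_zero)
    then show "cl * defect a powr (CARD('n) + 1) \<le> aniso_vol a"
      using c0 \<Gamma>_ge_4 by (simp add: cl_def pos_divide_le_eq mult_ac del: DIM_cart)
    have "(\<lambda>v. - a + v) -` aniso_ball a \<epsilon> \<subseteq> K a"
    proof
      fix w assume "w \<in> (\<lambda>v. - a + v) -` aniso_ball a \<epsilon>"
      then show "w \<in> K a" using \<epsilon>(2)[OF a, of "- a + w"] by simp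
    qed
    then have "emeasure lborel ((\<lambda>v. - a + v) -` aniso_ball a \<epsilon>) \<le> emeasure lborel (K a)"
      using K_borel[OF a] by (intro emeasure_mono) auto
    then have "ennreal (\<epsilon> ^ ?d * aniso_vol a) \<le> emeasure lborel (K a)"
      unfolding emeasure_lborel_translate[OF aniso_ball_borel] emeasure_aniso_ball_aniso_vol[OF \<epsilon>(1)] .
    moreover have "ennreal (c0 * \<Gamma> powr (- \<bar>\<alpha>\<bar>) * defect a powr \<alpha>) * emeasure lborel (K a)
      \<le> emeasure (V_alpha \<alpha>) (K a)"
      unfolding c0_def by (rule emeasure_V_alpha_comparable(1)[OF K_borel[OF a] K_ball[OF a] da _ comp])
        (use \<Gamma>_ge_4 in simp)
    ultimately have "ennreal (c0 * \<Gamma> powr (- \<bar>\<alpha>\<bar>) * defect a powr \<alpha>) * ennreal (\<epsilon> ^ ?d * aniso_vol a) \<le> ennreal (measure (V_alpha \<alpha>) (K a))"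
      unfolding emeasure_V_eq[OF K_ball[OF a]] by (meson mult_left_mono order_trans zero_le)
    then have "ennreal (c0 * \<Gamma> powr (- \<bar>\<alpha>\<bar>) * defect a powr \<alpha> * (\<epsilon> ^ ?d * aniso_vol a)) \<le> ennreal (measure (V_alpha \<alpha>) (K a))"
      using c0 \<epsilon>(1) by (subst ennreal_mult) (auto simp: aniso_vol_def simp del: DIM_cart)
    then have "c0 * \<Gamma> powr (- \<bar>\<alpha>\<bar>) * defect a powr \<alpha> * (\<epsilon> ^ ?d * aniso_vol a) \<le> measure (V_alpha \<alpha>) (K a)"
      by (simp add: ennreal_le_iff del: DIM_cart)
    then have "c0 * \<Gamma> powr (- \<bar>\<alpha>\<bar>) * defect a powr \<alpha> * (\<epsilon> ^ ?d * aniso_vol a)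
       \<le> C\<^sub>V * (defect a powr (CARD('n) + 1) * defect a powr \<alpha>)"
      using K_upper[OF a] unfolding pw by linarith
    then have "(c0 * \<Gamma> powr (- \<bar>\<alpha>\<bar>) * \<epsilon> ^ ?d * aniso_vol a) * defect a powr \<alpha>
       \<le> (C\<^sub>V * defect a powr (CARD('n) + 1)) * defect a powr \<alpha>"
      by (simp only: mult_ac)
    then have "c0 * \<Gamma> powr (- \<bar>\<alpha>\<bar>) * \<epsilon> ^ ?d * aniso_vol a \<le> C\<^sub>V * defect a powr (CARD('n) + 1)"
      using da by (simp only: mult_le_cancel_right_pos powr_gt_zero)
    then show "aniso_vol a \<le> cu * defect a powr (CARD('n) + 1)"
      using c0 \<Gamma>_ge_4 \<epsilon>(1) by (simp add: cu_def pos_le_divide_eq mult_ac del: DIM_cart)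
  qed
qed

end

section \<open>Volumes of tents\<close>

text \<open>For \<open>\<bar>b\<bar> = 1\<close> this is the Carleson tent of height \<open>t\<close> at the boundary point \<open>b\<close>; vertices inside the ball
  are admitted because the Cauchy kernel at \<open>a\<close> has the sets \<open>tent a t\<close> as superlevel sets.\<close>

definition tent :: "complex ^ 'n \<Rightarrow> real \<Rightarrow> (complex ^ 'n) set" where
  "tent b t = {w \<in> ball 0 1. cmod (1 - herm w b) < t}"

lemma tent_ball: "tent b t \<subseteq> ball 0 1"
  by (auto simp: tent_def)

lemma tent_borel [measurable]: "tent b t \<in> sets borel"
proof -
  have "tent b t = ball 0 1 \<inter> {w. cmod (1 - herm w b) < t}" by (auto simp: tent_def)
  also have "open \<dots>"
    by (intro open_Int open_ball open_Collect_less continuous_intros)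
  finally show ?thesis by (rule borel_open)
qed

lemma carleson_tent_eq_tent: "z \<noteq> 0 \<Longrightarrow> carleson_tent z = tent (z /\<^sub>R norm z) (1 - norm z)"
  by (auto simp: carleson_tent_def tent_def one_minus_herm_commute)

lemma one_minus_norm_le_defect: "norm x \<le> 1 \<Longrightarrow> 1 - norm x \<le> defect x"
  by (simp add: defect_def power2_eq_square mult_left_le_one_le)

lemma tent_change_vertex:
  assumes "b \<noteq> 0" "norm b < 1"
  shows "tent b t \<subseteq> tent (b /\<^sub>R norm b) (t + defect b)"
proof
  fix w assume w: "w \<in> tent b t"
  let ?z = "b /\<^sub>R norm b"
  have "herm w b = of_real (norm b) * herm w ?z" using assms by (simp add: herm_scaleR_right)
  then have "1 - herm w ?z = (1 - herm w b) - of_real (1 - norm b) * herm w ?z"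
    by (simp add: algebra_simps)
  then have "cmod (1 - herm w ?z) \<le> cmod (1 - herm w b) + (1 - norm b) * cmod (herm w ?z)"
    using assms by (metis norm_triangle_ineq4 norm_mult norm_of_real abs_of_pos diff_gt_0_iff_gt)
  also have "\<dots> \<le> cmod (1 - herm w b) + (1 - norm b) * 1"
  proof (intro add_left_mono mult_left_mono)
    have "cmod (herm w ?z) \<le> norm w * norm ?z" by (rule herm_Cauchy_Schwarz)
    also have "\<dots> \<le> 1" using w assms by (simp add: tent_def)
    finally show "cmod (herm w ?z) \<le> 1" .
  qed (use assms in simp)
  also have "1 - norm b \<le> defect b"
    using assms by (intro one_minus_norm_le_defect) simp
  finally show "w \<in> tent ?z (t + defect b)" using w by (simp add: tent_def)
qed

lemma nn_integral_powr_le: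
  fixes y \<alpha> :: real
  assumes "y > 0" "\<alpha> > -1"
  shows "(\<integral>\<^sup>+s. indicator {0<..<y} s * ennreal ((y - s) powr \<alpha>) \<partial>lborel) \<le> ennreal (y powr (\<alpha> + 1) / (\<alpha> + 1))"
proof -
  define f :: "real \<Rightarrow> ennreal" where "f = (\<lambda>r. indicator {0<..<y} r * ennreal (r powr \<alpha>))"
  have f [measurable]: "f \<in> borel_measurable borel" unfolding f_def by measurable
  have "(\<integral>\<^sup>+s. indicator {0<..<y} s * ennreal ((y - s) powr \<alpha>) \<partial>lborel) = (\<integral>\<^sup>+s. f (y - s) \<partial>lborel)"
    unfolding f_def by (intro nn_integral_cong) (auto simp: indicator_def)
  also have "\<dots> = (\<integral>\<^sup>+r. f r \<partial>lborel)" by (rule nn_integral_lborel_reflect[OF f])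
  also have "\<dots> \<le> (\<integral>\<^sup>+r. ennreal (if r \<in> {0..y} then r powr \<alpha> else 0) \<partial>lborel)"
    unfolding f_def by (intro nn_integral_mono) (auto simp: indicator_def)
  also have "\<dots> = ennreal (y powr (\<alpha> + 1) / (\<alpha> + 1))"
  proof (rule nn_integral_has_integral_lborel)
    have "((\<lambda>r. r powr \<alpha>) has_integral y powr (\<alpha> + 1) / (\<alpha> + 1)) {0..y}"
      using assms by (intro has_integral_powr_from_0) auto
    then show "((\<lambda>r. if r \<in> {0..y} then r powr \<alpha> else 0) has_integral y powr (\<alpha> + 1) / (\<alpha> + 1)) UNIV"
      by (simp only: has_integral_restrict_UNIV)
  qed auto
  finally show ?thesis .
qed

lemma tent_defect_le: "norm b = 1 \<Longrightarrow> w \<in> tent b t \<Longrightarrow> defect w \<le> 2 * t"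
  using defect_le_one_minus_herm[of b w] by (simp add: tent_def defect_def)

text \<open>For \<open>\<alpha> < 0\<close> the density is unbounded in a tent, and the volume is estimated by averaging over the
  dilations \<open>w = x / (1 - s)\<close>, \<open>0 < s < t\<close>. Each of them changes the integral by a bounded factor and keeps
  the point in a tent of twice the height, while the singular factor is at most
  \<open>(1 - \<bar>x\<bar> - s) powr \<alpha>\<close>. Integrated over \<open>s\<close> first, this is finite because \<open>\<alpha> > -1\<close>.\<close>

lemma nn_integral_defect_powr_tent:
  fixes b :: "complex ^ 'n::finite"
  assumes b: "norm b = 1" and \<alpha>: "-1 < \<alpha>" "\<alpha> < 0" and t: "0 < t" "t \<le> 1/2"
  shows "ennreal t * (\<integral>\<^sup>+w. indicator (tent b t) w * ennreal (defect w powr \<alpha>) \<partial>lborel)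
    \<le> ennreal (2 ^ DIM(complex ^ 'n) * ((4 * t) powr (\<alpha> + 1) / (\<alpha> + 1))) * emeasure lborel (tent b (2 * t))"
proof -
  let ?d = "DIM(complex ^ 'n)"
  define G :: "complex ^ 'n \<Rightarrow> ennreal" where "G = (\<lambda>w. indicator (tent b t) w * ennreal (defect w powr \<alpha>))"
  have G [measurable]: "G \<in> borel_measurable borel" unfolding G_def by measurable
  define H :: "complex ^ 'n \<Rightarrow> real \<Rightarrow> ennreal" where
    "H = (\<lambda>x s. indicator (tent b (2 * t)) x * (indicator {0<..<1 - norm x} s * ennreal ((1 - norm x - s) powr \<alpha>)))"
  have ind: "indicator {0<..<1 - norm x} s = (if 0 < s \<and> s < 1 - norm x then 1 else 0 :: ennreal)"
    for x :: "complex ^ 'n" and s by (simp add: indicator_def)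
  have H [measurable]: "case_prod H \<in> borel_measurable (lborel \<Otimes>\<^sub>M lborel)"
    unfolding H_def ind by measurable
  have scale: "(\<integral>\<^sup>+w. G w \<partial>lborel) \<le> ennreal (2 ^ ?d) * (\<integral>\<^sup>+x. H x s \<partial>lborel)" if s: "0 < s" "s < t" for s
  proof -
    define c where "c = 1 / (1 - s)"
    have c: "0 < c" "c \<le> 2" using s t by (auto simp: c_def divide_simps)
    have "(\<integral>\<^sup>+w. G w \<partial>lborel) = ennreal (c ^ ?d) * (\<integral>\<^sup>+x. G (c *\<^sub>R x) \<partial>lborel)"
    proof -
      have "(\<integral>\<^sup>+w. G w \<partial>lborel) = (\<integral>\<^sup>+w. G w \<partial>density (distr lborel borel (\<lambda>x. 0 + c *\<^sub>R x)) (\<lambda>_. ennreal (\<bar>c\<bar> ^ ?d)))"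
        using lborel_affine[of c "0 :: complex ^ 'n"] c by simp
      also have "\<dots> = ennreal (c ^ ?d) * (\<integral>\<^sup>+x. G (c *\<^sub>R x) \<partial>lborel)"
        using c by (simp add: nn_integral_density nn_integral_cmult nn_integral_distr)
      finally show ?thesis .
    qed
    also have "\<dots> \<le> ennreal (2 ^ ?d) * (\<integral>\<^sup>+x. H x s \<partial>lborel)"
    proof (intro mult_mono ennreal_leI power_mono nn_integral_mono)
      fix x
      show "G (c *\<^sub>R x) \<le> H x s"
      proof (cases "c *\<^sub>R x \<in> tent b t")
        case True
        have cx: "norm x < 1 - s" using True c s t by (simp add: tent_def c_def divide_simps)
        have "1 - herm x b = of_real (1 - s) * (1 - herm (c *\<^sub>R x) b) + of_real s"
          using s t by (simp add: herm_scaleR_left c_def algebra_simps) (simp add: field_simps)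
        then have "cmod (1 - herm x b) \<le> cmod (of_real (1 - s) * (1 - herm (c *\<^sub>R x) b)) + cmod (of_real s)"
          by (simp only: norm_triangle_ineq)
        also have "\<dots> = (1 - s) * cmod (1 - herm (c *\<^sub>R x) b) + s"
          unfolding norm_mult norm_of_real using s t by simp
        also have "\<dots> \<le> 1 * cmod (1 - herm (c *\<^sub>R x) b) + s"
          using s by (intro add_right_mono mult_right_mono) auto
        also have "\<dots> < 2 * t" using True s by (simp add: tent_def)
        finally have x: "x \<in> tent b (2 * t)" using cx s by (simp add: tent_def)
        have "1 - norm x - s \<le> defect (c *\<^sub>R x)"
        proof -
          have "1 - norm x - s = (1 - s) * (1 - norm (c *\<^sub>R x))"
            using s t by (simp add: c_def field_simps)
          also have "\<dots> \<le> 1 * (1 - norm (c *\<^sub>R x))"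
            using True s by (intro mult_right_mono) (auto simp: tent_def)
          also have "\<dots> \<le> defect (c *\<^sub>R x)"
            using one_minus_norm_le_defect[of "c *\<^sub>R x"] True by (simp add: tent_def)
          finally show ?thesis .
        qed
        then have "defect (c *\<^sub>R x) powr \<alpha> \<le> (1 - norm x - s) powr \<alpha>"
          using \<alpha> cx by (intro powr_mono2') auto
        then show ?thesis using True x cx s by (simp add: G_def H_def ennreal_leI)
      qed (simp add: G_def)
    qed (use c in auto)
    finally show ?thesis .
  qed
  have "ennreal t * (\<integral>\<^sup>+w. G w \<partial>lborel) = (\<integral>\<^sup>+s. indicator {0<..<t} s * (\<integral>\<^sup>+w. G w \<partial>lborel) \<partial>lborel)"
    using t by (subst nn_integral_multc) auto
  also have "\<dots> \<le> (\<integral>\<^sup>+s. ennreal (2 ^ ?d) * (\<integral>\<^sup>+x. H x s \<partial>lborel) \<partial>lborel)"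
    by (intro nn_integral_mono) (use scale in \<open>auto simp: indicator_def simp del: DIM_cart\<close>)
  also have "\<dots> = ennreal (2 ^ ?d) * (\<integral>\<^sup>+s. (\<integral>\<^sup>+x. H x s \<partial>lborel) \<partial>lborel)"
    by (rule nn_integral_cmult) measurable
  also have "(\<integral>\<^sup>+s. (\<integral>\<^sup>+x. H x s \<partial>lborel) \<partial>lborel) = (\<integral>\<^sup>+x. (\<integral>\<^sup>+s. H x s \<partial>lborel) \<partial>lborel)"
    by (rule lborel_pair.Fubini'[OF H])
  also have "\<dots> \<le> (\<integral>\<^sup>+x. indicator (tent b (2 * t)) x * ennreal ((4 * t) powr (\<alpha> + 1) / (\<alpha> + 1)) \<partial>lborel)"
  proof (rule nn_integral_mono)
    fix x
    show "(\<integral>\<^sup>+s. H x s \<partial>lborel) \<le> indicator (tent b (2 * t)) x * ennreal ((4 * t) powr (\<alpha> + 1) / (\<alpha> + 1))"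
    proof (cases "x \<in> tent b (2 * t)")
      case True
      then have nx: "norm x < 1" by (simp add: tent_def)
      have "1 - norm x \<le> defect x"
        using nx by (intro one_minus_norm_le_defect) simp
      also have "\<dots> \<le> 4 * t" using tent_defect_le[OF b True] by simp
      finally have y: "1 - norm x \<le> 4 * t" .
      have "(\<integral>\<^sup>+s. H x s \<partial>lborel) \<le> ennreal ((1 - norm x) powr (\<alpha> + 1) / (\<alpha> + 1))"
        using True nn_integral_powr_le[of "1 - norm x" \<alpha>] nx \<alpha> by (simp add: H_def)
      also have "\<dots> \<le> ennreal ((4 * t) powr (\<alpha> + 1) / (\<alpha> + 1))"
        using y nx \<alpha> by (intro ennreal_leI divide_right_mono powr_mono2) auto
      finally show ?thesis using True by simp
    qed (simp add: H_def)
  qed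
  also have "\<dots> = ennreal ((4 * t) powr (\<alpha> + 1) / (\<alpha> + 1)) * emeasure lborel (tent b (2 * t))"
    by (subst nn_integral_multc) (auto simp: mult.commute)
  finally have *: "ennreal t * (\<integral>\<^sup>+w. G w \<partial>lborel)
    \<le> ennreal (2 ^ ?d) * (ennreal ((4 * t) powr (\<alpha> + 1) / (\<alpha> + 1)) * emeasure lborel (tent b (2 * t)))"
    by (simp add: mult_left_mono del: DIM_cart)
  have "ennreal (2 ^ ?d * ((4 * t) powr (\<alpha> + 1) / (\<alpha> + 1)))
      = ennreal (2 ^ ?d) * ennreal ((4 * t) powr (\<alpha> + 1) / (\<alpha> + 1))"
    by (rule ennreal_mult) (use \<alpha> in auto)
  then show ?thesis using * unfolding G_def by (simp only: mult.assoc)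
qed

context whitney_cover begin

text \<open>The point \<open>(1 - t) b\<close> lies in some box \<open>K a\<close>, and then \<open>\<delta>(a)\<close> is comparable to \<open>t\<close>. By the quasi-triangle
  inequality the whole tent lies in a bounded dilate of the anisotropic ball around this \<open>a\<close>.\<close>

lemma emeasure_lborel_tent:
  obtains C where "C > 0"
    "\<And>b t. norm b = 1 \<Longrightarrow> t > 0 \<Longrightarrow> emeasure lborel (tent (b :: complex ^ 'n) t) \<le> ennreal (C * t powr (CARD('n) + 1))"
proof -
  let ?d = "DIM(complex ^ 'n)"
  obtain Cv where Cv: "Cv > 0" "\<And>a. a \<in> T \<Longrightarrow> aniso_vol a \<le> Cv * defect a powr (CARD('n) + 1)"
    using aniso_vol_bounds by metis
  define B where "B = measure lborel (ball (0 :: complex ^ 'n) 1)"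
  have B: "emeasure lborel (ball (0 :: complex ^ 'n) 1) = ennreal B" "B \<ge> 0"
    unfolding B_def using emeasure_bounded_finite[of "ball (0 :: complex ^ 'n) 1"]
    by (auto simp: emeasure_eq_ennreal_measure)
  define A where "A = (24 * \<Gamma>) ^ ?d * (Cv * (2 * \<Gamma>) powr (CARD('n) + 1))"
  have A: "A > 0" using \<Gamma>_ge_4 Cv by (simp add: A_def)
  show ?thesis
  proof (rule that[of "A + B"])
    fix b :: "complex ^ 'n" and t :: real assume b: "norm b = 1" and t: "t > 0"
    show "emeasure lborel (tent b t) \<le> ennreal ((A + B) * t powr (CARD('n) + 1))"
    proof (cases "t < 1")
      case True
      define z where "z = (1 - t) *\<^sub>R b"
      have nz: "norm z = 1 - t" using True t b by (simp add: z_def)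
      then have zb: "z \<in> ball 0 1" using t by simp
      have "defect z = t * (2 - t)" unfolding defect_def nz by (simp add: power2_eq_square algebra_simps)
      then have dz: "t \<le> defect z" "defect z \<le> 2 * t"
        using t True mult_left_mono[of 1 "2 - t" t] mult_left_mono[of "2 - t" 2 t] by auto
      obtain a where a: "a \<in> T" "z \<in> K a" using zb K_cover by blast
      note g = box_geometry[OF a]
      have ab: "a \<in> ball 0 1" using a T_ball by blast
      have ta: "t \<le> \<Gamma> * defect a" using dz g by linarith
      have "defect a \<le> \<Gamma> * (2 * t)" using g(2) dz(2) \<Gamma>_ge_4 mult_left_mono[of "defect z" "2 * t" \<Gamma>] by linarith
      then have da: "defect a \<le> 2 * \<Gamma> * t" by simp
      have sub: "tent b t \<subseteq> (\<lambda>v. - a + v) -` aniso_ball a (24 * \<Gamma>)"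
      proof
        fix w assume w: "w \<in> tent b t"
        have wb: "w \<in> ball 0 1" using w tent_ball by blast
        have "herm w z = of_real (1 - t) * herm w b"
          by (simp only: z_def herm_scaleR_right)
        then have "1 - herm w z = (1 - herm w b) + of_real t * herm w b"
          by (simp add: algebra_simps)
        then have "cmod (1 - herm w z) \<le> cmod (1 - herm w b) + t * cmod (herm w b)"
          using t by (metis norm_triangle_ineq norm_mult norm_of_real abs_of_pos)
        also have "\<dots> \<le> t + t * 1"
        proof (intro add_mono mult_left_mono)
          show "cmod (herm w b) \<le> 1"
            using herm_Cauchy_Schwarz[of w b] b wb by simp
        qed (use w t in \<open>auto simp: tent_def\<close>)
        finally have wz: "cmod (1 - herm w z) \<le> 2 * t" by simp
        have "cmod (1 - herm w a) \<le> 4 * (cmod (1 - herm w z) + cmod (1 - herm z a))"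
          by (rule one_minus_herm_triangle[OF wb zb ab])
        also have "\<dots> \<le> 4 * (2 * t + \<Gamma> * defect a)"
          by (intro mult_left_mono add_mono g(3) wz) simp
        also have "\<dots> \<le> 12 * \<Gamma> * defect a" using ta by (simp add: algebra_simps)
        finally have "w - a \<in> aniso_ball a (2 * (12 * \<Gamma>))"
          by (intro diff_in_aniso_ball wb ab) (use \<Gamma>_ge_4 in auto)
        then show "w \<in> (\<lambda>v. - a + v) -` aniso_ball a (24 * \<Gamma>)" by simp
      qed
      have "emeasure lborel (tent b t) \<le> emeasure lborel ((\<lambda>v. - a + v) -` aniso_ball a (24 * \<Gamma>))"
        using sub by (rule emeasure_mono) (simp add: closed_vimage closed_aniso_ball borel_closed continuous_intros)
      also have "\<dots> = ennreal ((24 * \<Gamma>) ^ ?d * aniso_vol a)"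
        unfolding emeasure_lborel_translate[OF aniso_ball_borel]
        by (rule emeasure_aniso_ball_aniso_vol) (use \<Gamma>_ge_4 in simp)
      also have "\<dots> \<le> ennreal ((24 * \<Gamma>) ^ ?d * (Cv * (2 * \<Gamma> * t) powr (CARD('n) + 1)))"
        using Cv(2)[OF a(1)] da \<Gamma>_ge_4 Cv(1) defect_pos[OF ab]
        by (intro ennreal_leI mult_left_mono order_trans[OF Cv(2)[OF a(1)]] powr_mono2) auto
      also have "\<dots> = ennreal (A * t powr (CARD('n) + 1))"
        using \<Gamma>_ge_4 t by (simp add: A_def powr_mult mult.assoc del: DIM_cart)
      also have "\<dots> \<le> ennreal ((A + B) * t powr (CARD('n) + 1))"
        using B by (intro ennreal_leI mult_right_mono) auto
      finally show ?thesis .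
    next
      case False
      have "emeasure lborel (tent b t) \<le> ennreal B"
        unfolding B(1)[symmetric] by (rule emeasure_mono[OF tent_ball]) auto
      also have "\<dots> \<le> ennreal ((A + B) * t powr (CARD('n) + 1))"
      proof (rule ennreal_leI)
        have "B * 1 \<le> (A + B) * t powr (CARD('n) + 1)"
          using A B False by (intro mult_mono ge_one_powr_ge_zero) auto
        then show "B \<le> (A + B) * t powr (CARD('n) + 1)" by simp
      qed
      finally show ?thesis .
    qed
  qed (use A B in simp)
qed

lemma emeasure_V_tent:
  obtains C where "C > 0"
    "\<And>b t. norm b = 1 \<Longrightarrow> t > 0 \<Longrightarrow> emeasure (V_alpha \<alpha>) (tent (b :: complex ^ 'n) t) \<le> ennreal (C * t powr hom_dim)"
proof -
  let ?d = "DIM(complex ^ 'n)"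
  obtain C where C: "C > 0"
    "\<And>b t. norm b = 1 \<Longrightarrow> t > 0 \<Longrightarrow> emeasure lborel (tent (b :: complex ^ 'n) t) \<le> ennreal (C * t powr (CARD('n) + 1))"
    using emeasure_lborel_tent by metis
  define c0 where "c0 = c_alpha TYPE('n) \<alpha>"
  have c0: "c0 > 0" unfolding c0_def by (rule c_alpha_pos)
  define B where "B = measure (V_alpha \<alpha>) (ball (0 :: complex ^ 'n) 1)"
  have V: "emeasure (V_alpha \<alpha>) (tent b t)
      = ennreal c0 * (\<integral>\<^sup>+w. indicator (tent b t) w * ennreal (defect w powr \<alpha>) \<partial>lborel)" for b :: "complex ^ 'n" and t
  proof -
    have "emeasure (V_alpha \<alpha>) (tent b t) = (\<integral>\<^sup>+w. indicator (tent b t) w * ennreal (weight \<alpha> w) \<partial>lborel)"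
      by (rule emeasure_V_alpha[OF tent_borel tent_ball])
    also have "\<dots> = (\<integral>\<^sup>+w. ennreal c0 * (indicator (tent b t) w * ennreal (defect w powr \<alpha>)) \<partial>lborel)"
      using c0 by (intro nn_integral_cong) (simp add: weight_def c0_def ennreal_mult mult_ac)
    also have "\<dots> = ennreal c0 * (\<integral>\<^sup>+w. indicator (tent b t) w * ennreal (defect w powr \<alpha>) \<partial>lborel)"
      by (rule nn_integral_cmult) measurable
    finally show ?thesis .
  qed
  show ?thesis
  proof (cases "\<alpha> \<ge> 0")
    case True
    show ?thesis
    proof (rule that[of "c0 * 2 powr \<alpha> * C"])
      fix b :: "complex ^ 'n" and t :: real assume b: "norm b = 1" and t: "t > 0"
      have "(\<integral>\<^sup>+w. indicator (tent b t) w * ennreal (defect w powr \<alpha>) \<partial>lborel)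
          \<le> (\<integral>\<^sup>+w. indicator (tent b t) w * ennreal ((2 * t) powr \<alpha>) \<partial>lborel)"
      proof (rule nn_integral_mono)
        fix w
        show "indicator (tent b t) w * ennreal (defect w powr \<alpha>) \<le> indicator (tent b t) w * ennreal ((2 * t) powr \<alpha>)"
        proof (cases "w \<in> tent b t")
          case w: True
          have "defect w > 0" using w tent_ball defect_pos by blast
          then show ?thesis using tent_defect_le[OF b w] True w by (auto intro!: ennreal_leI powr_mono2)
        qed simp
      qed
      also have "\<dots> = ennreal ((2 * t) powr \<alpha>) * emeasure lborel (tent b t)"
        by (subst nn_integral_multc) (auto simp: mult.commute)
      also have "\<dots> \<le> ennreal ((2 * t) powr \<alpha>) * ennreal (C * t powr (CARD('n) + 1))"
        by (intro mult_left_mono C b t) auto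
      finally have "emeasure (V_alpha \<alpha>) (tent b t) \<le> ennreal c0 * (ennreal ((2 * t) powr \<alpha>) * ennreal (C * t powr (CARD('n) + 1)))"
        unfolding V by (intro mult_left_mono) auto
      also have "\<dots> = ennreal (c0 * 2 powr \<alpha> * C * t powr hom_dim)"
        using c0 C t by (simp add: hom_dim_def powr_add powr_mult mult_ac flip: ennreal_mult)
      finally show "emeasure (V_alpha \<alpha>) (tent b t) \<le> ennreal (c0 * 2 powr \<alpha> * C * t powr hom_dim)" .
    qed (use c0 C in simp)
  next
    case False
    define A where "A = c0 * (2 ^ ?d * (4 powr (\<alpha> + 1) / (\<alpha> + 1))) * (C * 2 powr (CARD('n) + 1))"
    have A: "A > 0" using c0 C \<alpha> by (simp add: A_def)
    show ?thesis
    proof (rule that[of "A + B * 2 powr hom_dim"])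
      fix b :: "complex ^ 'n" and t :: real assume b: "norm b = 1" and t: "t > 0"
      show "emeasure (V_alpha \<alpha>) (tent b t) \<le> ennreal ((A + B * 2 powr hom_dim) * t powr hom_dim)"
      proof (cases "t \<le> 1/2")
        case True
        have "ennreal t * emeasure (V_alpha \<alpha>) (tent b t)
          = ennreal c0 * (ennreal t * (\<integral>\<^sup>+w. indicator (tent b t) w * ennreal (defect w powr \<alpha>) \<partial>lborel))"
          unfolding V by (simp add: mult_ac)
        also have "\<dots> \<le> ennreal c0 * (ennreal (2 ^ ?d * ((4 * t) powr (\<alpha> + 1) / (\<alpha> + 1))) * ennreal (C * (2 * t) powr (CARD('n) + 1)))"
          using False \<alpha> t True
          by (intro mult_left_mono order_trans[OF nn_integral_defect_powr_tent[OF b]] C(2) b) auto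
        also have "\<dots> = ennreal (t * (A * t powr hom_dim))"
          using c0 C t \<alpha> by (simp add: A_def hom_dim_def powr_add powr_mult mult_ac flip: ennreal_mult del: DIM_cart)
        finally have "ennreal t * ennreal (measure (V_alpha \<alpha>) (tent b t)) \<le> ennreal (t * (A * t powr hom_dim))"
          unfolding emeasure_V_eq[OF tent_ball] .
        then have "t * measure (V_alpha \<alpha>) (tent b t) \<le> t * (A * t powr hom_dim)"
          using t A by (simp flip: ennreal_mult)
        then have "measure (V_alpha \<alpha>) (tent b t) \<le> A * t powr hom_dim" using t by simp
        also have "\<dots> \<le> (A + B * 2 powr hom_dim) * t powr hom_dim"
          by (intro mult_right_mono) (auto simp: B_def)
        finally show ?thesis unfolding emeasure_V_eq[OF tent_ball] by (rule ennreal_leI)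
      next
        case False
        have "emeasure (V_alpha \<alpha>) (tent b t) \<le> emeasure (V_alpha \<alpha>) (ball (0 :: complex ^ 'n) 1)"
          by (rule emeasure_mono[OF tent_ball]) (simp add: in_sets_V_alpha)
        also have "\<dots> = ennreal B" unfolding B_def by (rule emeasure_V_eq) simp
        also have "\<dots> \<le> ennreal ((A + B * 2 powr hom_dim) * t powr hom_dim)"
        proof (rule ennreal_leI)
          have "B * 1 \<le> B * (2 * t) powr hom_dim"
            using False hom_dim_pos by (intro mult_left_mono ge_one_powr_ge_zero) (auto simp: B_def)
          also have "\<dots> = (B * 2 powr hom_dim) * t powr hom_dim" using t by (simp add: powr_mult)
          also have "\<dots> \<le> (A + B * 2 powr hom_dim) * t powr hom_dim"
            using A by (intro mult_right_mono) auto
          finally show "B \<le> (A + B * 2 powr hom_dim) * t powr hom_dim" by simp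
        qed
        finally show ?thesis .
      qed
    qed (use A in \<open>auto simp: B_def intro: add_pos_nonneg\<close>)
  qed
qed

text \<open>Replacing the vertex \<open>a\<close> by its radial projection changes the height by at most \<open>\<delta>(a)\<close>.\<close>

lemma emeasure_V_tent_inner:
  obtains C where "C > 0"
    "\<And>a t. a \<in> ball 0 1 \<Longrightarrow> defect a \<le> 2 * t \<Longrightarrow> emeasure (V_alpha \<alpha>) (tent (a :: complex ^ 'n) t) \<le> ennreal (C * t powr hom_dim)"
proof -
  obtain C where C: "C > 0"
    "\<And>b t. norm b = 1 \<Longrightarrow> t > 0 \<Longrightarrow> emeasure (V_alpha \<alpha>) (tent (b :: complex ^ 'n) t) \<le> ennreal (C * t powr hom_dim)"
    using emeasure_V_tent by metis
  define B where "B = measure (V_alpha \<alpha>) (ball (0 :: complex ^ 'n) 1)"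
  have B0: "B \<ge> 0" by (simp add: B_def)
  show ?thesis
  proof (rule that[of "C * 3 powr hom_dim + B * 2 powr hom_dim"])
    fix a :: "complex ^ 'n" and t assume ab: "a \<in> ball 0 1" and t: "defect a \<le> 2 * t"
    have t0: "t > 0" using defect_pos[OF ab] t by linarith
    show "emeasure (V_alpha \<alpha>) (tent a t) \<le> ennreal ((C * 3 powr hom_dim + B * 2 powr hom_dim) * t powr hom_dim)"
    proof (cases "a = 0")
      case True
      then have t1: "2 * t \<ge> 1" using t by (simp add: defect_def)
      have "emeasure (V_alpha \<alpha>) (tent a t) \<le> emeasure (V_alpha \<alpha>) (ball (0 :: complex ^ 'n) 1)"
        by (rule emeasure_mono[OF tent_ball]) (simp add: in_sets_V_alpha)
      also have "\<dots> = ennreal B" unfolding B_def by (rule emeasure_V_eq) simp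
      also have "\<dots> \<le> ennreal ((C * 3 powr hom_dim + B * 2 powr hom_dim) * t powr hom_dim)"
      proof (rule ennreal_leI)
        have "B * 1 \<le> B * (2 * t) powr hom_dim"
          using t1 hom_dim_pos B0 by (intro mult_left_mono ge_one_powr_ge_zero) auto
        also have "\<dots> = (B * 2 powr hom_dim) * t powr hom_dim" using t0 by (simp add: powr_mult)
        also have "\<dots> \<le> (C * 3 powr hom_dim + B * 2 powr hom_dim) * t powr hom_dim"
          using C by (intro mult_right_mono) auto
        finally show "B \<le> (C * 3 powr hom_dim + B * 2 powr hom_dim) * t powr hom_dim" by simp
      qed
      finally show ?thesis .
    next
      case False
      let ?b = "a /\<^sub>R norm a"
      have "tent a t \<subseteq> tent ?b (t + defect a)" using False ab by (intro tent_change_vertex) auto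
      also have "\<dots> \<subseteq> tent ?b (3 * t)" using t by (auto simp: tent_def)
      finally have "emeasure (V_alpha \<alpha>) (tent a t) \<le> emeasure (V_alpha \<alpha>) (tent ?b (3 * t))"
        by (rule emeasure_mono) (simp add: in_sets_V_alpha tent_ball)
      also have "\<dots> \<le> ennreal (C * (3 * t) powr hom_dim)" by (rule C(2)) (use False t0 in auto)
      also have "\<dots> \<le> ennreal ((C * 3 powr hom_dim + B * 2 powr hom_dim) * t powr hom_dim)"
        using t0 B0 by (intro ennreal_leI) (simp add: powr_mult mult.assoc mult_right_mono)
      finally show ?thesis .
    qed
  qed (use C B0 in \<open>auto intro: add_pos_nonneg\<close>)
qed

end

section \<open>Test functions and pointwise estimates on boxes\<close>

lemma nn_integral_count_space_le:
  fixes c :: "'i \<Rightarrow> ennreal"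
  assumes I: "countable I" and F: "\<And>F. finite F \<Longrightarrow> F \<subseteq> I \<Longrightarrow> sum c F \<le> B"
  shows "(\<integral>\<^sup>+i. c i \<partial>count_space I) \<le> B"
proof (cases "finite I")
  case True
  then show ?thesis using F[of I] by (simp add: nn_integral_count_space_finite)
next
  case False
  then have bij: "bij_betw (from_nat_into I) UNIV I" using I by (intro bij_betw_from_nat_into)
  have "(\<integral>\<^sup>+i. c i \<partial>count_space I) = (\<integral>\<^sup>+n. c (from_nat_into I n) \<partial>count_space UNIV)"
    by (rule nn_integral_bij_count_space[OF bij, symmetric])
  also have "\<dots> = (\<Sum>n. c (from_nat_into I n))" by (rule nn_integral_count_space_nat)
  also have "\<dots> \<le> B"
  proof (rule suminf_le_const)
    fix n
    have "inj_on (from_nat_into I) {..<n}" using bij by (meson bij_betw_imp_inj_on inj_on_subset subset_UNIV)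
    then have "(\<Sum>k<n. c (from_nat_into I k)) = sum c (from_nat_into I ` {..<n})"
      by (simp add: sum.reindex)
    also have "\<dots> \<le> B" using bij by (intro F) (auto simp: bij_betw_def)
    finally show "(\<Sum>k<n. c (from_nat_into I k)) \<le> B" .
  qed simp
  finally show ?thesis .
qed

lemma ennreal_le_suminf: "g j \<le> (\<Sum>j. g j :: ennreal)"
  using sum_le_suminf[of g "{j}"] by simp

lemma holo_fun_on_cauchy_kernel:
  fixes a :: "complex ^ 'n::finite"
  assumes a: "a \<in> ball 0 1"
  shows "holo_fun_on (\<lambda>w. inverse (1 - herm w a)) (ball 0 1)"
  unfolding holo_fun_on_def
proof
  fix z :: "complex ^ 'n" assume z: "z \<in> ball 0 1"
  have lin: "linear (\<lambda>w. herm w a)"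
    by (rule linearI) (simp_all add: herm_add_left herm_scaleR_left, simp add: scaleR_conv_of_real)
  have "((\<lambda>w. herm w a) has_derivative (\<lambda>h. herm h a)) (at z)"
    using lin by (intro bounded_linear_imp_has_derivative) (simp add: linear_conv_bounded_linear)
  then have "((\<lambda>w. 1 - herm w a) has_derivative (\<lambda>h. 0 - herm h a)) (at z)"
    by (intro has_derivative_diff has_derivative_const)
  moreover have "1 - herm z a \<noteq> 0" using one_minus_herm_pos[OF a z] by auto
  ultimately have "((\<lambda>w. inverse (1 - herm w a)) has_derivative
      (\<lambda>h. - (inverse (1 - herm z a) * (0 - herm h a) * inverse (1 - herm z a)))) (at z)"
    by (intro Deriv.has_derivative_inverse)
  then show "\<exists>D. ((\<lambda>w. inverse (1 - herm w a)) has_derivative D) (at z) \<and> (\<forall>c v. D (c *s v) = c * D v)"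
    by (intro exI[of _ "\<lambda>h. - (inverse (1 - herm z a) * (0 - herm h a) * inverse (1 - herm z a))"] conjI)
       (simp_all add: herm_mult_left)
qed

definition lp_mass :: "real \<Rightarrow> real \<Rightarrow> (complex ^ 'n) set \<Rightarrow> (complex ^ 'n::finite \<Rightarrow> complex) \<Rightarrow> ennreal" where
  "lp_mass \<alpha> t E f = (\<integral>\<^sup>+w\<in>E. ennreal (cmod (f w) powr t) \<partial>V_alpha \<alpha>)"

context whitney_cover begin

text \<open>Decompose the ball according to the size of \<open>\<bar>1 - \<langle>w, a\<rangle>\<bar>\<close> on a dyadic scale that starts at \<open>\<delta>(a)\<close>. The
  tent at scale \<open>2\<^sup>j \<delta>(a)\<close> contributes its volume times a power of the scale, and the exponents are such
  that the contributions decrease geometrically.\<close>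

lemma cauchy_kernel_norm:
  fixes k :: nat and p :: real
  assumes p: "p > 0" and kp: "hom_dim < k * p"
  obtains C where "C > 0"
    "\<And>a. a \<in> ball 0 1 \<Longrightarrow> bergman_pow \<alpha> p (\<lambda>w :: complex ^ 'n. inverse (1 - herm w a) ^ k)
        \<le> ennreal (C * defect a powr (hom_dim - k * p))"
proof -
  obtain C where C: "C > 0"
    "\<And>a t. a \<in> ball 0 1 \<Longrightarrow> defect a \<le> 2 * t \<Longrightarrow> emeasure (V_alpha \<alpha>) (tent (a :: complex ^ 'n) t) \<le> ennreal (C * t powr hom_dim)"
    using emeasure_V_tent_inner by metis
  define e where "e = k * p"
  have e: "e > hom_dim" "e > 0" using kp hom_dim_pos by (auto simp: e_def)
  define x where "x = 2 powr (hom_dim - e)"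
  have "2 powr (hom_dim - e) < 2 powr 0" by (rule powr_less_mono) (use e in auto)
  then have x: "0 < x" "x < 1" by (auto simp: x_def)
  show ?thesis
  proof (rule that[of "C * 2 powr e * (1 / (1 - x))"])
    fix a :: "complex ^ 'n" assume a: "a \<in> ball 0 1"
    let ?f = "\<lambda>w. inverse (1 - herm w a) ^ k"
    have da: "defect a > 0" using a by (rule defect_pos)
    have pt: "ennreal (cmod (?f w) powr p)
        \<le> (\<Sum>j. ennreal ((2 ^ j * defect a / 2) powr (- e)) * indicator (tent a (2 ^ j * defect a)) w)"
      if w: "w \<in> ball 0 1" for w
    proof -
      define y where "y = cmod (1 - herm w a)"
      have y: "y > 0" unfolding y_def by (rule one_minus_herm_pos[OF a w])
      have "cmod (?f w) powr p = inverse (y ^ k) powr p"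
        by (simp add: y_def norm_power norm_inverse power_inverse)
      also have "\<dots> = inverse ((y powr real k) powr p)"
        using y by (simp add: inverse_powr powr_realpow)
      also have "\<dots> = y powr (- e)"
        by (simp add: powr_powr e_def powr_minus)
      finally have fy: "cmod (?f w) powr p = y powr (- e)" .
      have "\<exists>j. y < 2 ^ j * defect a"
      proof -
        obtain j where "y / defect a < 2 ^ j" using real_arch_pow[of 2 "y / defect a"] by auto
        then show ?thesis using da by (auto simp: divide_less_eq)
      qed
      then obtain j where j: "y < 2 ^ j * defect a" "\<And>i. i < j \<Longrightarrow> \<not> y < 2 ^ i * defect a"
        using exists_least_iff[of "\<lambda>j. y < 2 ^ j * defect a"] by auto
      have "2 ^ j * defect a / 2 \<le> y"
      proof (cases j)
        case 0
        have "0 < defect w" using w by (rule defect_pos)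
        then have "defect a \<le> 2 * y" using defect_le_one_minus_herm[of a w] unfolding y_def by linarith
        then show ?thesis using 0 by simp
      next
        case (Suc i)
        then show ?thesis using j(2)[of i] by simp
      qed
      then have "y powr (- e) \<le> (2 ^ j * defect a / 2) powr (- e)"
        using e da by (intro powr_mono2') auto
      then have "ennreal (cmod (?f w) powr p)
        \<le> ennreal ((2 ^ j * defect a / 2) powr (- e)) * indicator (tent a (2 ^ j * defect a)) w"
        using j(1) w unfolding fy by (simp add: tent_def y_def ennreal_leI)
      also have "\<dots> \<le> (\<Sum>j. ennreal ((2 ^ j * defect a / 2) powr (- e)) * indicator (tent a (2 ^ j * defect a)) w)"
        by (rule ennreal_le_suminf)
      finally show ?thesis .
    qed
    have ts: "tent a t \<in> sets (V_alpha \<alpha>)" for t by (rule in_sets_V_alpha[OF tent_borel tent_ball])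
    have "bergman_pow \<alpha> p ?f
      \<le> (\<integral>\<^sup>+w. (\<Sum>j. ennreal ((2 ^ j * defect a / 2) powr (- e)) * indicator (tent a (2 ^ j * defect a)) w) \<partial>V_alpha \<alpha>)"
      unfolding bergman_pow_def by (intro nn_integral_mono pt) simp
    also have "\<dots> = (\<Sum>j. \<integral>\<^sup>+w. ennreal ((2 ^ j * defect a / 2) powr (- e)) * indicator (tent a (2 ^ j * defect a)) w \<partial>V_alpha \<alpha>)"
      by (rule nn_integral_suminf) (use ts in simp)
    also have "\<dots> = (\<Sum>j. ennreal ((2 ^ j * defect a / 2) powr (- e)) * emeasure (V_alpha \<alpha>) (tent a (2 ^ j * defect a)))"
      using ts by (simp add: nn_integral_cmult)
    also have "\<dots> \<le> (\<Sum>j. ennreal (C * 2 powr e * defect a powr (hom_dim - e) * x ^ j))"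
    proof (rule suminf_le)
      fix j :: nat
      have j1: "(1::real) \<le> 2 ^ j" by simp
      have "1 * defect a \<le> 2 ^ j * defect a" using da by (intro mult_right_mono j1) auto
      then have t: "defect a \<le> 2 * (2 ^ j * defect a)" using da by linarith
      have xj: "x ^ j = (2 ^ j) powr hom_dim * (2 ^ j) powr (- e)"
        by (simp add: x_def powr_powr mult.commute flip: powr_realpow powr_add) (simp add: algebra_simps flip: powr_add)
      have "ennreal ((2 ^ j * defect a / 2) powr (- e)) * emeasure (V_alpha \<alpha>) (tent a (2 ^ j * defect a))
        \<le> ennreal ((2 ^ j * defect a / 2) powr (- e)) * ennreal (C * (2 ^ j * defect a) powr hom_dim)"
        by (intro mult_left_mono C(2)[OF a t]) simp
      also have "\<dots> = ennreal ((2 ^ j * defect a / 2) powr (- e) * (C * (2 ^ j * defect a) powr hom_dim))"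
        using C by (intro ennreal_mult[symmetric]) auto
      also have "(2 ^ j * defect a / 2) powr (- e) * (C * (2 ^ j * defect a) powr hom_dim)
        = C * 2 powr e * defect a powr (hom_dim - e) * x ^ j"
      proof -
        have "(2 ^ j * defect a / 2) powr (- e) = (2 ^ j) powr (- e) * defect a powr (- e) * 2 powr e"
          using da by (simp add: powr_mult powr_divide powr_minus field_simps)
        moreover have "(2 ^ j * defect a) powr hom_dim = (2 ^ j) powr hom_dim * defect a powr hom_dim"
          using da by (simp add: powr_mult)
        moreover have "defect a powr (hom_dim - e) = defect a powr hom_dim * defect a powr (- e)"
          by (simp flip: powr_add)
        ultimately show ?thesis unfolding xj by (simp only: mult_ac)
      qed
      finally show "ennreal ((2 ^ j * defect a / 2) powr (- e)) * emeasure (V_alpha \<alpha>) (tent a (2 ^ j * defect a))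
        \<le> ennreal (C * 2 powr e * defect a powr (hom_dim - e) * x ^ j)" .
    qed auto
    also have "\<dots> = ennreal (C * 2 powr e * defect a powr (hom_dim - e) * (1 / (1 - x)))"
      by (intro suminf_ennreal_eq sums_mult geometric_sums) (use x C in auto)
    also have "C * 2 powr e * defect a powr (hom_dim - e) * (1 / (1 - x)) = C * 2 powr e * (1 / (1 - x)) * defect a powr (hom_dim - k * p)"
      by (simp add: e_def)
    finally show "bergman_pow \<alpha> p ?f \<le> ennreal (C * 2 powr e * (1 / (1 - x)) * defect a powr (hom_dim - k * p))" .
  qed (use C x in simp)
qed

text \<open>Apply the sub-mean value inequality around \<open>z\<close>, over the anisotropic ball of \<open>a\<close> scaled by a
  small factor \<open>\<epsilon>\<close>. For this \<open>\<epsilon>\<close> the defect does not change by more than a bounded factor, so that the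
  density is comparable to a constant there.\<close>

lemma box_sup_estimate:
  assumes t: "t > 0"
  obtains C where "C > 0"
    "\<And>f a z E. holo_fun_on f (ball (0 :: complex ^ 'n) 1) \<Longrightarrow> a \<in> T \<Longrightarrow> z \<in> K a \<Longrightarrow> E \<in> sets borel \<Longrightarrow>
       tent a ((\<Gamma> + 1) * defect a) \<subseteq> E \<Longrightarrow> E \<subseteq> ball 0 1 \<Longrightarrow>
       ennreal (cmod (f z) powr t * defect a powr hom_dim)
        \<le> ennreal C * lp_mass \<alpha> t E f"
proof -
  let ?d = "DIM(complex ^ 'n)"
  obtain C0 where C0: "C0 > 0" "\<And>(f :: complex ^ 'n \<Rightarrow> complex) S D x. \<lbrakk>open S; holo_fun_on f S; compact D;
     \<And>c v. cmod c \<le> 1 \<Longrightarrow> v \<in> D \<Longrightarrow> c *s v \<in> D; convex D; \<And>v. v \<in> D \<Longrightarrow> x + v \<in> S\<rbrakk> \<Longrightarrow>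
     ennreal (cmod (f x) powr t) * emeasure lborel D
    \<le> ennreal C0 * (\<integral>\<^sup>+v. indicator D v * ennreal (cmod (f (x + v)) powr t) \<partial>lborel)"
    by (fact holo_sub_mean_value[OF t])
  obtain cv where cv: "cv > 0" "\<And>a. a \<in> T \<Longrightarrow> cv * defect a powr (CARD('n) + 1) \<le> aniso_vol a"
    using aniso_vol_bounds by metis
  define c0 where "c0 = c_alpha TYPE('n) \<alpha>"
  have c0: "c0 > 0" unfolding c0_def by (rule c_alpha_pos)
  \<comment> \<open>chosen so that the defect changes by at most \<open>\<delta>(a) / (2 \<Gamma>)\<close>, half of its minimum on the box\<close>
  define \<epsilon> where "\<epsilon> = 1 / (2 * \<Gamma> * (3 + 4 * \<Gamma>))"
  have G: "\<Gamma> > 0" "\<Gamma> \<ge> 4" using \<Gamma>_ge_4 by auto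
  have "1 \<le> 2 * \<Gamma> * (3 + 4 * \<Gamma>)" using mult_mono[of 1 "2 * \<Gamma>" 1 "3 + 4 * \<Gamma>"] G by simp
  then have \<epsilon>: "0 < \<epsilon>" "\<epsilon> \<le> 1" using G by (auto simp: \<epsilon>_def)
  have \<epsilon>G: "\<epsilon> * (3 + 4 * \<Gamma>) = 1 / (2 * \<Gamma>)" using G by (simp add: \<epsilon>_def)
  define w0 where "w0 = c0 * (2 * \<Gamma>) powr (- \<bar>\<alpha>\<bar>)"
  have w0: "w0 > 0" using c0 G by (simp add: w0_def)
  define A where "A = \<epsilon> ^ ?d * cv * w0"
  have A: "A > 0" using \<epsilon> cv w0 by (simp add: A_def)
  show ?thesis
  proof (rule that[of "C0 / A"])
    fix f a z E
    assume f: "holo_fun_on f (ball (0 :: complex ^ 'n) 1)" and a: "a \<in> T" and z: "z \<in> K a"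
      and E: "E \<in> sets borel" "tent a ((\<Gamma> + 1) * defect a) \<subseteq> E" "E \<subseteq> ball 0 1"
    note g = box_geometry[OF a z]
    have ab: "a \<in> ball 0 1" using a T_ball by blast
    have zb: "z \<in> ball 0 1" using K_ball a z by blast
    have da: "defect a > 0" using ab by (rule defect_pos)
    have geo: "z + v \<in> tent a ((\<Gamma> + 1) * defect a) \<and> defect a \<le> 2 * \<Gamma> * defect (z + v) \<and> defect (z + v) \<le> 2 * \<Gamma> * defect a"
      if v: "v \<in> aniso_ball a \<epsilon>" for v
    proof -
      have v1: "cmod (herm v a) \<le> \<epsilon> * defect a" and v2: "norm v \<le> \<epsilon> * sqrt (defect a)"
        using v by (simp_all add: aniso_ball_def)
      have za: "norm (z - a) \<le> 2 * \<Gamma> * sqrt (defect a)"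
        using diff_in_aniso_ball[OF zb ab g(3)] G by (simp add: aniso_ball_def)
      have "cmod (herm v z) \<le> cmod (herm v a) + cmod (herm v (z - a))"
        by (simp add: herm_diff_right) (metis add_diff_cancel_left' diff_add_cancel norm_triangle_ineq)
      also have "\<dots> \<le> \<epsilon> * defect a + (\<epsilon> * sqrt (defect a)) * (2 * \<Gamma> * sqrt (defect a))"
        using \<epsilon> da by (intro add_mono v1 order_trans[OF herm_Cauchy_Schwarz] mult_mono v2 za) auto
      also have "\<dots> = \<epsilon> * (1 + 2 * \<Gamma>) * defect a" using da by (simp add: algebra_simps)
      finally have vz: "cmod (herm v z) \<le> \<epsilon> * (1 + 2 * \<Gamma>) * defect a" .
      have "(norm v)\<^sup>2 \<le> (\<epsilon> * sqrt (defect a))\<^sup>2" using v2 by (intro power_mono) auto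
      also have "\<dots> = \<epsilon> * (\<epsilon> * defect a)" using da by (simp add: power_mult_distrib power2_eq_square)
      also have "\<dots> \<le> 1 * (\<epsilon> * defect a)" using \<epsilon> da by (intro mult_right_mono) auto
      finally have vv: "(norm v)\<^sup>2 \<le> \<epsilon> * defect a" by simp
      have dzv: "defect (z + v) = defect z - 2 * Re (herm v z) - (norm v)\<^sup>2"
        unfolding Re_herm defect_def power2_norm_eq_inner by (simp add: inner_add inner_commute)
      have "\<bar>defect (z + v) - defect z\<bar> \<le> 2 * (\<epsilon> * (1 + 2 * \<Gamma>) * defect a) + \<epsilon> * defect a"
        unfolding dzv using vz vv abs_Re_le_cmod[of "herm v z"] zero_le_power2[of "norm v"] by linarith
      also have "\<dots> = (\<epsilon> * (3 + 4 * \<Gamma>)) * defect a" by (simp add: algebra_simps)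
      also have "\<dots> = defect a / (2 * \<Gamma>)" unfolding \<epsilon>G by simp
      finally have dd: "\<bar>defect (z + v) - defect z\<bar> \<le> defect a / (2 * \<Gamma>)" .
      have dz: "defect a / \<Gamma> \<le> defect z" using g(2) G by (simp add: divide_le_eq mult.commute)
      have "defect a / (2 * \<Gamma>) = defect a / \<Gamma> - defect a / (2 * \<Gamma>)" using G by (simp add: field_simps)
      then have low: "defect a / (2 * \<Gamma>) \<le> defect (z + v)" using dd dz by linarith
      then have 1: "defect a \<le> 2 * \<Gamma> * defect (z + v)" using G by (simp add: divide_le_eq mult_ac)
      have "defect a / (2 * \<Gamma>) \<le> \<Gamma> * defect a"
      proof -
        have "defect a / (2 * \<Gamma>) \<le> defect a" using G da by (simp add: divide_le_eq)
        also have "\<dots> \<le> \<Gamma> * defect a" using G da by simp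
        finally show ?thesis .
      qed
      then have 2: "defect (z + v) \<le> 2 * \<Gamma> * defect a" using dd g(1) by linarith
      have "defect a / (2 * \<Gamma>) > 0" using da G by simp
      then have "0 < defect (z + v)" using low by (rule less_le_trans)
      then have "z + v \<in> ball 0 1" by (simp only: defect_pos_iff)
      moreover have "cmod (1 - herm (z + v) a) < (\<Gamma> + 1) * defect a"
      proof -
        have "1 - herm (z + v) a = (1 - herm z a) - herm v a" by (simp add: herm_add_left)
        then have "cmod (1 - herm (z + v) a) \<le> cmod (1 - herm z a) + cmod (herm v a)"
          by (metis norm_triangle_ineq4)
        also have "\<dots> \<le> \<Gamma> * defect a + \<epsilon> * defect a" by (intro add_mono g v1)
        also have "\<dots> < \<Gamma> * defect a + 1 * defect a"
        proof (intro add_strict_left_mono mult_strict_right_mono da)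
          have "1 < 2 * \<Gamma> * (3 + 4 * \<Gamma>)" using mult_strict_mono[of 1 "2 * \<Gamma>" 1 "3 + 4 * \<Gamma>"] G by simp
          then show "\<epsilon> < 1" by (simp add: \<epsilon>_def)
        qed
        finally show ?thesis by (simp add: algebra_simps)
      qed
      ultimately show ?thesis using 1 2 by (simp add: tent_def)
    qed
    have zE: "z + v \<in> E" if "v \<in> aniso_ball a \<epsilon>" for v using geo[OF that] E by blast
    define I where "I = lp_mass \<alpha> t E f"
    define F where "F = (\<lambda>w. indicator (ball 0 1) w *\<^sub>R f w)"
    have F [measurable]: "F \<in> borel_measurable borel"
      unfolding F_def using continuous_on_holo_fun[OF f] by (intro borel_measurable_continuous_on_indicator) auto
    have Ff: "F w = f w" if "w \<in> E" for w using that E by (auto simp: F_def)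
    have [measurable]: "E \<in> sets borel" by (rule E)
    have I: "I = (\<integral>\<^sup>+w. indicator E w * (ennreal (weight \<alpha> w) * ennreal (cmod (F w) powr t)) \<partial>lborel)"
    proof -
      have "I = (\<integral>\<^sup>+w. ennreal (cmod (F w) powr t) * indicator E w \<partial>V_alpha \<alpha>)"
        unfolding I_def lp_mass_def by (intro nn_integral_cong) (auto simp: indicator_def Ff)
      also have "\<dots> = (\<integral>\<^sup>+w. indicator (ball 0 1) w * (ennreal (weight \<alpha> w) * (ennreal (cmod (F w) powr t) * indicator E w)) \<partial>lborel)"
        by (rule nn_integral_V_alpha[OF measurable_V_alpha_borel]) measurable
      also have "\<dots> = (\<integral>\<^sup>+w. indicator E w * (ennreal (weight \<alpha> w) * ennreal (cmod (F w) powr t)) \<partial>lborel)"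
        using E by (intro nn_integral_cong) (auto simp: indicator_def)
      finally show ?thesis .
    qed
    have fF: "(\<integral>\<^sup>+v. indicator (aniso_ball a \<epsilon>) v * ennreal (cmod (f (z + v)) powr t) \<partial>lborel)
      = (\<integral>\<^sup>+v. indicator (aniso_ball a \<epsilon>) v * ennreal (cmod (F (z + v)) powr t) \<partial>lborel)"
      by (rule nn_integral_cong) (auto simp: indicator_def Ff zE)
    have "ennreal (w0 * defect a powr \<alpha>) * (\<integral>\<^sup>+v. indicator (aniso_ball a \<epsilon>) v * ennreal (cmod (f (z + v)) powr t) \<partial>lborel)
      = ennreal (w0 * defect a powr \<alpha>) * (\<integral>\<^sup>+v. indicator (aniso_ball a \<epsilon>) v * ennreal (cmod (F (z + v)) powr t) \<partial>lborel)"
      unfolding fF ..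
    also have "\<dots> = (\<integral>\<^sup>+v. ennreal (w0 * defect a powr \<alpha>) * (indicator (aniso_ball a \<epsilon>) v * ennreal (cmod (F (z + v)) powr t)) \<partial>lborel)"
      by (rule nn_integral_cmult[symmetric]) measurable
    also have "\<dots> \<le> (\<integral>\<^sup>+v. indicator E (z + v) * (ennreal (weight \<alpha> (z + v)) * ennreal (cmod (F (z + v)) powr t)) \<partial>lborel)"
    proof (rule nn_integral_mono)
      fix v
      show "ennreal (w0 * defect a powr \<alpha>) * (indicator (aniso_ball a \<epsilon>) v * ennreal (cmod (F (z + v)) powr t))
        \<le> indicator E (z + v) * (ennreal (weight \<alpha> (z + v)) * ennreal (cmod (F (z + v)) powr t))"
      proof (cases "v \<in> aniso_ball a \<epsilon>")
        case True
        have "(2 * \<Gamma>) powr (- \<bar>\<alpha>\<bar>) * defect a powr \<alpha> \<le> defect (z + v) powr \<alpha>"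
          by (rule powr_comparable(1)[OF da]) (use geo[OF True] G in auto)
        then have "w0 * defect a powr \<alpha> \<le> weight \<alpha> (z + v)"
          using c0 by (simp add: w0_def weight_def c0_def mult.assoc)
        then show ?thesis using True zE[OF True] by (simp add: mult_right_mono ennreal_leI)
      qed simp
    qed
    also have "\<dots> = I" unfolding I by (rule nn_integral_lborel_translate) measurable
    finally have J: "ennreal (w0 * defect a powr \<alpha>) *
      (\<integral>\<^sup>+v. indicator (aniso_ball a \<epsilon>) v * ennreal (cmod (f (z + v)) powr t) \<partial>lborel) \<le> I" .
    have "ennreal (cmod (f z) powr t * defect a powr hom_dim * A)
      \<le> ennreal (w0 * defect a powr \<alpha>) * (ennreal (cmod (f z) powr t) * emeasure lborel (aniso_ball a \<epsilon>))"
    proof -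
      have "cmod (f z) powr t * defect a powr hom_dim * A
        = (w0 * defect a powr \<alpha>) * (cmod (f z) powr t * (\<epsilon> ^ ?d * (cv * defect a powr (CARD('n) + 1))))"
        by (simp add: A_def hom_dim_def powr_add mult_ac del: DIM_cart)
      also have "\<dots> \<le> (w0 * defect a powr \<alpha>) * (cmod (f z) powr t * (\<epsilon> ^ ?d * aniso_vol a))"
        using w0 \<epsilon> by (intro mult_left_mono cv a) auto
      finally show ?thesis
        using w0 \<epsilon> by (simp add: emeasure_aniso_ball_aniso_vol aniso_vol_def ennreal_leI flip: ennreal_mult del: DIM_cart)
    qed
    also have "\<dots> \<le> ennreal (w0 * defect a powr \<alpha>) * (ennreal C0 *
        (\<integral>\<^sup>+v. indicator (aniso_ball a \<epsilon>) v * ennreal (cmod (f (z + v)) powr t) \<partial>lborel))"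
    proof (intro mult_left_mono C0(2)[OF open_ball f compact_aniso_ball _ convex_aniso_ball])
      show "z + v \<in> ball 0 1" if "v \<in> aniso_ball a \<epsilon>" for v using zE[OF that] E by blast
    qed (auto intro: balanced_aniso_ball)
    also have "\<dots> = ennreal C0 * (ennreal (w0 * defect a powr \<alpha>) *
        (\<integral>\<^sup>+v. indicator (aniso_ball a \<epsilon>) v * ennreal (cmod (f (z + v)) powr t) \<partial>lborel))"
      by (simp only: mult_ac)
    also have "\<dots> \<le> ennreal C0 * I" by (intro mult_left_mono J) simp
    finally have main: "ennreal (cmod (f z) powr t * defect a powr hom_dim * A) \<le> ennreal C0 * I" .
    have "ennreal (cmod (f z) powr t * defect a powr hom_dim)
      = ennreal (1 / A) * ennreal (cmod (f z) powr t * defect a powr hom_dim * A)"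
      using A by (simp flip: ennreal_mult)
    also have "\<dots> \<le> ennreal (1 / A) * (ennreal C0 * I)" by (intro mult_left_mono main) simp
    also have "\<dots> = ennreal (C0 / A) * I"
      using A C0(1) by (simp add: mult.assoc[symmetric] flip: ennreal_mult)
    finally show "ennreal (cmod (f z) powr t * defect a powr hom_dim) \<le> ennreal (C0 / A) * lp_mass \<alpha> t E f"
      unfolding I_def .
  qed (use A C0 in simp)
qed

end

section \<open>Testing the operator on Cauchy kernels\<close>

context whitney_cover begin

text \<open>Test the operator on a power \<open>k\<close> of the Cauchy kernel at \<open>a\<close>, with \<open>k\<close> so large that
  \<open>cauchy_kernel_norm\<close> applies. On the box of \<open>a\<close> the kernel is at least \<open>1 / (\<Gamma> \<delta>(a))\<close>, so the norm of the
  image controls the mass that is pulled back from the box. The powers of \<open>\<delta>(a)\<close> that depend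
  on \<open>k\<close> cancel.\<close>

lemma pullback_box_mass:
  fixes u :: "complex ^ 'm::finite \<Rightarrow> complex" and \<phi> :: "complex ^ 'm \<Rightarrow> complex ^ 'n"
  assumes p: "p > 0" and q: "q > 0"
    and bdd: "\<And>f. f \<in> bergman_space \<alpha> p \<Longrightarrow> (\<lambda>z. u z * f (\<phi> z)) \<in> bergman_space \<alpha> q"
    and C1: "\<And>f. f \<in> bergman_space \<alpha> p \<Longrightarrow>
        bergman_norm \<alpha> q (\<lambda>z. u z * f (\<phi> z)) \<le> C1 * bergman_norm \<alpha> p f"
  obtains C where "C > 0"
    "\<And>a. a \<in> T \<Longrightarrow> (\<integral>\<^sup>+z. indicator {z \<in> ball 0 1. \<phi> z \<in> K a} z * ennreal (cmod (u z) powr q) \<partial>V_alpha \<alpha>)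
      \<le> ennreal (C * defect a powr (hom_dim * q / p))"
proof -
  obtain k :: nat where k: "hom_dim < real k * p"
    using reals_Archimedean3[OF p] by blast
  obtain C where C: "C > 0"
    "\<And>a. a \<in> ball 0 1 \<Longrightarrow> bergman_pow \<alpha> p (\<lambda>w :: complex ^ 'n. inverse (1 - herm w a) ^ k)
        \<le> ennreal (C * defect a powr (hom_dim - k * p))"
    using cauchy_kernel_norm[OF p k] by metis
  \<comment> \<open>the bound \<open>C1\<close> of the operator is an arbitrary real number and may be negative\<close>
  define C2 where "C2 = \<bar>C1\<bar> + 1"
  have C2: "C2 > 0" "C1 \<le> C2" by (simp_all add: C2_def)
  have G: "\<Gamma> > 0" using \<Gamma>_ge_4 by simp
  show ?thesis
  proof (rule that[of "\<Gamma> powr (k * q) * (C2 powr q * C powr (q / p))"])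
    fix a assume a: "a \<in> T"
    then have ab: "a \<in> ball 0 1" using T_ball by blast
    then have da: "defect a > 0" by (rule defect_pos)
    define f where "f = (\<lambda>w :: complex ^ 'n. inverse (1 - herm w a) ^ k)"
    define g where "g = (\<lambda>z. u z * f (\<phi> z))"
    have bf: "bergman_pow \<alpha> p f \<le> ennreal (C * defect a powr (hom_dim - k * p))"
      unfolding f_def by (rule C(2)[OF ab])
    have f: "f \<in> bergman_space \<alpha> p"
    proof -
      have "bergman_pow \<alpha> p f < \<infinity>" using bf by (rule order_le_less_trans) simp
      then show ?thesis unfolding bergman_space_def f_def
        using holo_fun_on_power[OF holo_fun_on_cauchy_kernel[OF ab], of k] by simp
    qed
    have g: "g \<in> bergman_space \<alpha> q" unfolding g_def by (rule bdd[OF f])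
    define X where "X = enn2real (bergman_pow \<alpha> q g)"
    have X: "bergman_pow \<alpha> q g = ennreal X" "X \<ge> 0"
      using g unfolding X_def bergman_space_def by (simp_all add: less_top)
    have "X powr (1 / q) \<le> C1 * enn2real (bergman_pow \<alpha> p f) powr (1 / p)"
      using C1[OF f] unfolding bergman_norm_def X_def g_def .
    also have "\<dots> \<le> C2 * (C * defect a powr (hom_dim - k * p)) powr (1 / p)"
    proof (intro mult_mono powr_mono2)
      show "enn2real (bergman_pow \<alpha> p f) \<le> C * defect a powr (hom_dim - k * p)"
        by (rule enn2real_leI[OF _ bf]) (use C in auto)
    qed (use C2 p in auto)
    finally have "(X powr (1 / q)) powr q \<le> (C2 * (C * defect a powr (hom_dim - k * p)) powr (1 / p)) powr q"
      using q by (intro powr_mono2) auto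
    then have XX: "X \<le> C2 powr q * (C powr (q / p) * defect a powr ((hom_dim - k * p) * (q / p)))"
      using X q C2 C da by (simp add: powr_powr powr_mult)
    define c where "c = (\<Gamma> * defect a) powr (k * q)"
    have c0: "c \<ge> 0" by (simp add: c_def)
    have pt: "indicator {z \<in> ball 0 1. \<phi> z \<in> K a} z * ennreal (cmod (u z) powr q)
        \<le> ennreal c * ennreal (cmod (g z) powr q)" if z: "z \<in> ball 0 1" for z
    proof (cases "\<phi> z \<in> K a")
      case True
      define y where "y = cmod (1 - herm (\<phi> z) a)"
      have y: "0 < y" "y \<le> \<Gamma> * defect a"
        using box_geometry(3)[OF a True] one_minus_herm_pos[OF ab] True K_ball[OF a] by (auto simp: y_def)
      have "y powr (k * q) \<le> c" unfolding c_def by (rule powr_mono2) (use y q in auto)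
      then have "1 \<le> c * y powr (- (k * q))"
        using y by (simp add: powr_minus field_simps)
      then have "cmod (u z) powr q * 1 \<le> cmod (u z) powr q * (c * y powr (- (k * q)))"
        by (intro mult_left_mono) auto
      also have "\<dots> = c * cmod (g z) powr q"
      proof -
        have "cmod (f (\<phi> z)) powr q = inverse (y ^ k) powr q"
          by (simp add: f_def y_def norm_power norm_inverse power_inverse)
        also have "\<dots> = inverse ((y powr real k) powr q)"
          using y by (simp add: inverse_powr powr_realpow)
        also have "\<dots> = y powr (- (k * q))" by (simp add: powr_powr powr_minus)
        finally show ?thesis by (simp add: g_def norm_mult powr_mult mult_ac)
      qed
      finally show ?thesis using True z c0 by (simp add: ennreal_leI flip: ennreal_mult)
    qed simp
    have "(\<integral>\<^sup>+z. indicator {z \<in> ball 0 1. \<phi> z \<in> K a} z * ennreal (cmod (u z) powr q) \<partial>V_alpha \<alpha>)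
      \<le> (\<integral>\<^sup>+z. ennreal c * ennreal (cmod (g z) powr q) \<partial>V_alpha \<alpha>)"
      by (intro nn_integral_mono pt) simp
    also have "\<dots> = ennreal c * ennreal X"
    proof (subst nn_integral_cmult)
      have "g \<in> borel_measurable (V_alpha \<alpha>)"
        using g continuous_on_holo_fun by (intro measurable_V_alpha_continuous) (auto simp: bergman_space_def)
      then show "(\<lambda>z. ennreal (cmod (g z) powr q)) \<in> borel_measurable (V_alpha \<alpha>)" by measurable
    qed (simp add: X(1)[symmetric] bergman_pow_def)
    also have "\<dots> = ennreal (c * X)" using c0 X by (simp add: ennreal_mult)
    also have "\<dots> \<le> ennreal (c * (C2 powr q * (C powr (q / p) * defect a powr ((hom_dim - k * p) * (q / p)))))"
      by (intro ennreal_leI mult_left_mono XX c0)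
    also have "c * (C2 powr q * (C powr (q / p) * defect a powr ((hom_dim - k * p) * (q / p))))
      = \<Gamma> powr (k * q) * (C2 powr q * C powr (q / p)) * (defect a powr (k * q) * defect a powr ((hom_dim - k * p) * (q / p)))"
      using G da by (simp add: c_def powr_mult mult_ac)
    also have "defect a powr (k * q) * defect a powr ((hom_dim - k * p) * (q / p)) = defect a powr (hom_dim * q / p)"
    proof -
      have "k * q + (hom_dim - k * p) * (q / p) = hom_dim * q / p" using p by (simp add: field_simps)
      then show ?thesis by (simp flip: powr_add)
    qed
    finally show "(\<integral>\<^sup>+z. indicator {z \<in> ball 0 1. \<phi> z \<in> K a} z * ennreal (cmod (u z) powr q) \<partial>V_alpha \<alpha>)
      \<le> ennreal (\<Gamma> powr (k * q) * (C2 powr q * C powr (q / p)) * defect a powr (hom_dim * q / p))" .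
  qed (use G C2 C in simp)
qed

text \<open>Split the domain according to the box that contains \<open>\<phi> z\<close>, and on each box replace
  \<open>\<bar>f\<bar>\<^sup>q\<close> by the product of the bounds from \<open>box_sup_estimate\<close> for the exponents \<open>t1\<close> and \<open>t2\<close>.\<close>

lemma weighted_comp_le_box_sum:
  fixes u :: "complex ^ 'm::finite \<Rightarrow> complex" and \<phi> :: "complex ^ 'm \<Rightarrow> complex ^ 'n"
  assumes u: "continuous_on (ball 0 1) u" and \<phi>: "continuous_on (ball 0 1) \<phi>" "\<phi> ` ball 0 1 \<subseteq> ball 0 1"
    and Cm: "Cm > 0" "\<forall>a\<in>T.
      (\<integral>\<^sup>+z. indicator {z \<in> ball 0 1. \<phi> z \<in> K a} z * ennreal (cmod (u z) powr q) \<partial>V_alpha \<alpha>)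
      \<le> ennreal (Cm * defect a powr s)"
    and t: "t1 > 0" "t2 > 0" "t1 + t2 = q"
  obtains C where "C > 0"
    "\<And>f E. holo_fun_on f (ball (0 :: complex ^ 'n) 1) \<Longrightarrow>
      (\<And>a. a \<in> T \<Longrightarrow> E a \<in> sets borel \<and> tent a ((\<Gamma> + 1) * defect a) \<subseteq> E a \<and> E a \<subseteq> ball 0 1) \<Longrightarrow>
      bergman_pow \<alpha> q (\<lambda>z. u z * f (\<phi> z))
        \<le> (\<integral>\<^sup>+a. ennreal (C * defect a powr (s - 2 * hom_dim)) *
              (lp_mass \<alpha> t1 (E a) f *
               lp_mass \<alpha> t2 (E a) f) \<partial>count_space T)"
proof -
  obtain D1 where D1: "D1 > 0"
    "\<And>f a z E. holo_fun_on f (ball (0 :: complex ^ 'n) 1) \<Longrightarrow> a \<in> T \<Longrightarrow> z \<in> K a \<Longrightarrow> E \<in> sets borel \<Longrightarrow>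
       tent a ((\<Gamma> + 1) * defect a) \<subseteq> E \<Longrightarrow> E \<subseteq> ball 0 1 \<Longrightarrow>
       ennreal (cmod (f z) powr t1 * defect a powr hom_dim)
        \<le> ennreal D1 * lp_mass \<alpha> t1 E f"
    by (fact box_sup_estimate[OF t(1)])
  obtain D2 where D2: "D2 > 0"
    "\<And>f a z E. holo_fun_on f (ball (0 :: complex ^ 'n) 1) \<Longrightarrow> a \<in> T \<Longrightarrow> z \<in> K a \<Longrightarrow> E \<in> sets borel \<Longrightarrow>
       tent a ((\<Gamma> + 1) * defect a) \<subseteq> E \<Longrightarrow> E \<subseteq> ball 0 1 \<Longrightarrow>
       ennreal (cmod (f z) powr t2 * defect a powr hom_dim)
        \<le> ennreal D2 * lp_mass \<alpha> t2 E f"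
    by (fact box_sup_estimate[OF t(2)])
  show ?thesis
  proof (rule that[of "D1 * D2 * Cm"])
    fix f :: "complex ^ 'n \<Rightarrow> complex" and E :: "complex ^ 'n \<Rightarrow> (complex ^ 'n) set"
    assume f: "holo_fun_on f (ball 0 1)"
      and E: "\<And>a. a \<in> T \<Longrightarrow> E a \<in> sets borel \<and> tent a ((\<Gamma> + 1) * defect a) \<subseteq> E a \<and> E a \<subseteq> ball 0 1"
    define I1 where "I1 = (\<lambda>a. lp_mass \<alpha> t1 (E a) f)"
    define I2 where "I2 = (\<lambda>a. lp_mass \<alpha> t2 (E a) f)"
    define B where "B = (\<lambda>a. {z \<in> ball 0 1. \<phi> z \<in> K a})"
    have \<phi>_meas: "\<phi> \<in> measurable (V_alpha \<alpha>) borel"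
      by (rule measurable_V_alpha_continuous[OF \<phi>(1)])
    have B: "B a \<in> sets (V_alpha \<alpha>)" if "a \<in> T" for a
    proof -
      have "\<phi> -` K a \<inter> space (V_alpha \<alpha>) \<in> sets (V_alpha \<alpha>)"
        by (rule measurable_sets[OF \<phi>_meas K_borel[OF that]])
      also have "\<phi> -` K a \<inter> space (V_alpha \<alpha>) = B a" by (auto simp: B_def)
      finally show ?thesis .
    qed
    define g where "g = (\<lambda>z. ennreal (cmod (u z * f (\<phi> z)) powr q))"
    have "continuous_on (ball 0 1) (\<lambda>z. u z * f (\<phi> z))"
      by (intro continuous_intros u continuous_on_compose2[OF continuous_on_holo_fun[OF f] \<phi>])
    from measurable_V_alpha_continuous[OF this, of \<alpha>]
    have g [measurable]: "g \<in> borel_measurable (V_alpha \<alpha>)" unfolding g_def by measurable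
    have um: "(\<lambda>z. ennreal (cmod (u z) powr q)) \<in> borel_measurable (V_alpha \<alpha>)"
      using measurable_V_alpha_continuous[OF u, of \<alpha>] by measurable
    have "bergman_pow \<alpha> q (\<lambda>z. u z * f (\<phi> z)) = (\<integral>\<^sup>+z. g z \<partial>V_alpha \<alpha>)"
      by (simp add: bergman_pow_def g_def)
    also have "\<dots> \<le> (\<integral>\<^sup>+z. (\<integral>\<^sup>+a. indicator (B a) z * g z \<partial>count_space T) \<partial>V_alpha \<alpha>)"
    proof (rule nn_integral_mono)
      fix z :: "complex ^ 'm" assume "z \<in> space (V_alpha \<alpha>)"
      then have z: "z \<in> ball 0 1" by simp
      then have "\<phi> z \<in> (\<Union>a\<in>T. K a)" using \<phi>(2) unfolding K_cover by blast
      then obtain a where a: "a \<in> T" "\<phi> z \<in> K a" by blast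
      have "g z = indicator (B a) z * g z" using a z by (simp add: B_def)
      also have "\<dots> \<le> (\<integral>\<^sup>+a. indicator (B a) z * g z \<partial>count_space T)"
        by (rule nn_integral_ge_point[OF a(1)])
      finally show "g z \<le> (\<integral>\<^sup>+a. indicator (B a) z * g z \<partial>count_space T)" .
    qed
    also have "\<dots> = (\<integral>\<^sup>+a. (\<integral>\<^sup>+z. indicator (B a) z * g z \<partial>V_alpha \<alpha>) \<partial>count_space T)"
      by (rule nn_integral_count_space_nn_integral[OF countable_T]) (use B in measurable)
    also have "\<dots> \<le> (\<integral>\<^sup>+a. ennreal (D1 * D2 * Cm * defect a powr (s - 2 * hom_dim)) * (I1 a * I2 a) \<partial>count_space T)"
    proof (rule nn_integral_mono)
      fix a assume "a \<in> space (count_space T)"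
      then have a: "a \<in> T" by simp
      then have da: "defect a > 0" using T_ball defect_pos by blast
      define S where "S = ennreal (D1 * D2 * defect a powr (- 2 * hom_dim)) * (I1 a * I2 a)"
      have fS: "ennreal (cmod (f w) powr q) \<le> S" if w: "w \<in> K a" for w
      proof -
        have "cmod (f w) powr q = (cmod (f w) powr t1 * defect a powr hom_dim) * (cmod (f w) powr t2 * defect a powr hom_dim) * defect a powr (- 2 * hom_dim)"
        proof -
          have "defect a powr hom_dim * defect a powr hom_dim * defect a powr (- 2 * hom_dim) = 1"
            using da by (simp flip: powr_add)
          moreover have "cmod (f w) powr q = cmod (f w) powr t1 * cmod (f w) powr t2"
            by (simp add: t(3)[symmetric] powr_add)
          ultimately show ?thesis by (simp add: mult_ac)
        qed
        then have "ennreal (cmod (f w) powr q) = ennreal (cmod (f w) powr t1 * defect a powr hom_dim)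
           * ennreal (cmod (f w) powr t2 * defect a powr hom_dim) * ennreal (defect a powr (- 2 * hom_dim))"
          by (simp flip: ennreal_mult)
        also have "\<dots> \<le> (ennreal D1 * I1 a) * (ennreal D2 * I2 a) * ennreal (defect a powr (- 2 * hom_dim))"
          unfolding I1_def I2_def by (intro mult_mono D1(2) D2(2) f a w) (use E[OF a] in auto)
        also have "\<dots> = S"
          unfolding S_def using D1(1) D2(1) by (simp add: ennreal_mult mult_ac)
        finally show ?thesis .
      qed
      have "(\<integral>\<^sup>+z. indicator (B a) z * g z \<partial>V_alpha \<alpha>)
        \<le> (\<integral>\<^sup>+z. S * (indicator (B a) z * ennreal (cmod (u z) powr q)) \<partial>V_alpha \<alpha>)"
      proof (rule nn_integral_mono)
        fix z
        show "indicator (B a) z * g z \<le> S * (indicator (B a) z * ennreal (cmod (u z) powr q))"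
        proof (cases "z \<in> B a")
          case True
          have "g z = ennreal (cmod (f (\<phi> z)) powr q) * ennreal (cmod (u z) powr q)"
            by (simp add: g_def norm_mult powr_mult mult.commute flip: ennreal_mult)
          also have "\<dots> \<le> S * ennreal (cmod (u z) powr q)"
            by (intro mult_right_mono fS) (use True in \<open>auto simp: B_def\<close>)
          finally show ?thesis using True by simp
        qed simp
      qed
      also have "\<dots> = S * (\<integral>\<^sup>+z. indicator (B a) z * ennreal (cmod (u z) powr q) \<partial>V_alpha \<alpha>)"
        by (rule nn_integral_cmult) (use B[OF a] um in measurable)
      also have "\<dots> \<le> S * ennreal (Cm * defect a powr s)"
        unfolding B_def using Cm(2) a by (intro mult_left_mono) auto
      also have "\<dots> = ennreal (D1 * D2 * defect a powr (- 2 * hom_dim) * (Cm * defect a powr s)) * (I1 a * I2 a)"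
      proof -
        have "ennreal (D1 * D2 * defect a powr (- 2 * hom_dim) * (Cm * defect a powr s))
          = ennreal (D1 * D2 * defect a powr (- 2 * hom_dim)) * ennreal (Cm * defect a powr s)"
          by (rule ennreal_mult) (use D1(1) D2(1) Cm(1) in auto)
        then show ?thesis unfolding S_def by (simp only: mult_ac)
      qed
      also have "D1 * D2 * defect a powr (- 2 * hom_dim) * (Cm * defect a powr s) = D1 * D2 * Cm * defect a powr (s - 2 * hom_dim)"
        by (simp add: powr_diff powr_minus field_simps)
      finally show "(\<integral>\<^sup>+z. indicator (B a) z * g z \<partial>V_alpha \<alpha>)
        \<le> ennreal (D1 * D2 * Cm * defect a powr (s - 2 * hom_dim)) * (I1 a * I2 a)" .
    qed
    finally show "bergman_pow \<alpha> q (\<lambda>z. u z * f (\<phi> z))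
        \<le> (\<integral>\<^sup>+a. ennreal (D1 * D2 * Cm * defect a powr (s - 2 * hom_dim)) *
              (lp_mass \<alpha> t1 (E a) f *
               lp_mass \<alpha> t2 (E a) f) \<partial>count_space T)"
      unfolding I1_def I2_def .
  qed (use D1 D2 Cm in simp)
qed

end

section \<open>The combinatorics of one Bergman tree\<close>

text \<open>Hoelder's inequality with a weight, up to a constant. Pointwise, either \<open>f powr t \<le> \<lambda> * \<omega>\<close> or
  \<open>f powr t \<le> f powr p * (\<lambda> * \<omega>) powr (1 - p / t)\<close>, and \<open>\<lambda>\<close> is chosen to balance the two integrals.\<close>

lemma nn_integral_power_le_weighted:
  fixes f \<omega> :: "'a \<Rightarrow> real"
  assumes [measurable]: "f \<in> borel_measurable M" "\<omega> \<in> borel_measurable M" "E \<in> sets M"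
    and f: "\<And>x. f x \<ge> 0" and \<omega>: "\<And>x. \<omega> x \<ge> 1"
    and t: "0 < t" "t < p" and \<eta>: "\<eta> \<le> p / t - 1"
    and W: "(\<integral>\<^sup>+x\<in>E. ennreal (\<omega> x) \<partial>M) \<le> ennreal (C * v)" and v: "v > 0" and C: "C \<ge> 0"
    and G: "(\<integral>\<^sup>+x\<in>E. ennreal (f x powr p * \<omega> x powr (- \<eta>)) \<partial>M) = ennreal G" "G \<ge> 0"
  shows "(\<integral>\<^sup>+x\<in>E. ennreal (f x powr t) \<partial>M) \<le> ennreal ((C + 1) * v powr (1 - t / p) * G powr (t / p))"
proof (cases "G = 0")
  case True
  have "(\<integral>\<^sup>+x\<in>E. ennreal (f x powr p * \<omega> x powr (- \<eta>)) \<partial>M) = 0"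
    using G(1) True by simp
  then have "AE x in M. ennreal (f x powr p * \<omega> x powr (- \<eta>)) * indicator E x = 0"
    by (rule nn_integral_0_iff_AE[THEN iffD1, rotated]) measurable
  then have "AE x in M. ennreal (f x powr t) * indicator E x = 0"
  proof (rule eventually_mono)
    fix x assume *: "ennreal (f x powr p * \<omega> x powr (- \<eta>)) * indicator E x = 0"
    have "\<omega> x > 0" using \<omega>[of x] by simp
    then have "f x powr p * \<omega> x powr (- \<eta>) > 0" if "f x \<noteq> 0" using that by simp
    with * show "ennreal (f x powr t) * indicator E x = 0"
      by (cases "f x = 0") (auto simp: indicator_def split: if_splits)
  qed
  then have "(\<integral>\<^sup>+x\<in>E. ennreal (f x powr t) \<partial>M) = 0"
    by (subst nn_integral_0_iff_AE) auto
  then show ?thesis by simp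
next
  case False
  then have G0: "G > 0" using G by simp
  \<comment> \<open>the value for which both parts of the splitting have the same order of magnitude\<close>
  define lam where "lam = (G / v) powr (t / p)"
  have lam: "lam > 0" using G0 v by (simp add: lam_def)
  have pt: "f x powr t \<le> lam * \<omega> x + lam powr (1 - p / t) * (f x powr p * \<omega> x powr (- \<eta>))" for x
  proof (cases "f x powr t \<le> lam * \<omega> x")
    case True
    then show ?thesis by (simp add: add_increasing2)
  next
    case False
    have w0: "\<omega> x > 0" using \<omega>[of x] by simp
    have l0: "lam * \<omega> x > 0" using lam w0 by simp
    have fx: "f x powr t > 0" using False l0 by linarith
    have pt1: "p / t - 1 \<ge> 0" using t by simp
    have "(lam * \<omega> x) powr (p / t - 1) \<le> (f x powr t) powr (p / t - 1)"
      using False l0 pt1 by (intro powr_mono2) auto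
    then have "1 \<le> (f x powr t) powr (p / t - 1) * (lam * \<omega> x) powr (- (p / t - 1))"
      unfolding powr_minus_divide using powr_gt_zero[of "lam * \<omega> x" "p / t - 1"] l0
      by (simp only: times_divide_eq_right mult_1_right pos_le_divide_eq mult_1)
    then have "f x powr t * 1 \<le> f x powr t * ((f x powr t) powr (p / t - 1) * (lam * \<omega> x) powr (- (p / t - 1)))"
      using fx by (intro mult_left_mono) auto
    also have "f x powr t * ((f x powr t) powr (p / t - 1) * (lam * \<omega> x) powr (- (p / t - 1)))
      = (f x powr t * (f x powr t) powr (p / t - 1)) * (lam powr (1 - p / t) * \<omega> x powr (1 - p / t))"
      using lam w0 by (simp add: powr_mult)
    also have "f x powr t * (f x powr t) powr (p / t - 1) = f x powr p"
      using t by (simp add: powr_powr field_simps flip: powr_add)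
    also have "f x powr p * (lam powr (1 - p / t) * \<omega> x powr (1 - p / t))
       \<le> f x powr p * (lam powr (1 - p / t) * \<omega> x powr (- \<eta>))"
      using \<omega>[of x] \<eta> by (intro mult_left_mono powr_mono) auto
    finally show ?thesis using lam w0 by (simp add: mult_ac add_increasing)
  qed
  have "(\<integral>\<^sup>+x\<in>E. ennreal (f x powr t) \<partial>M)
    \<le> (\<integral>\<^sup>+x. ennreal lam * (ennreal (\<omega> x) * indicator E x)
        + ennreal (lam powr (1 - p / t)) * (ennreal (f x powr p * \<omega> x powr (- \<eta>)) * indicator E x) \<partial>M)"
  proof (rule nn_integral_mono)
    fix x
    have "0 \<le> \<omega> x" using \<omega>[of x] by simp
    then show "ennreal (f x powr t) * indicator E x \<le> ennreal lam * (ennreal (\<omega> x) * indicator E x)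
        + ennreal (lam powr (1 - p / t)) * (ennreal (f x powr p * \<omega> x powr (- \<eta>)) * indicator E x)"
      using pt[of x] lam by (auto simp: indicator_def simp flip: ennreal_mult ennreal_plus intro!: ennreal_leI)
  qed
  also have "\<dots> = ennreal lam * (\<integral>\<^sup>+x\<in>E. ennreal (\<omega> x) \<partial>M)
      + ennreal (lam powr (1 - p / t)) * (\<integral>\<^sup>+x\<in>E. ennreal (f x powr p * \<omega> x powr (- \<eta>)) \<partial>M)"
    by (subst nn_integral_add) (auto simp: nn_integral_cmult)
  also have "\<dots> \<le> ennreal lam * ennreal (C * v) + ennreal (lam powr (1 - p / t)) * ennreal G"
    unfolding G(1) by (intro add_right_mono mult_left_mono W) simp
  also have "\<dots> = ennreal (lam * (C * v) + lam powr (1 - p / t) * G)"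
    using lam C v G0 by (simp flip: ennreal_mult ennreal_plus)
  also have "lam * (C * v) + lam powr (1 - p / t) * G = (C + 1) * v powr (1 - t / p) * G powr (t / p)"
  proof -
    have "lam * v = v powr (1 - t / p) * G powr (t / p)"
      using G0 v by (simp add: lam_def powr_divide powr_diff)
    moreover have "lam powr (1 - p / t) * G = v powr (1 - t / p) * G powr (t / p)"
    proof -
      have e: "(t / p) * (1 - p / t) = t / p - 1" using t by (simp add: field_simps)
      have "lam powr (1 - p / t) = (G / v) powr (t / p - 1)"
        unfolding lam_def powr_powr e ..
      also have "\<dots> = G powr (t / p) / G * (v powr (1 - t / p))"
        using G0 v by (simp add: powr_divide powr_diff)
      finally show ?thesis using G0 by simp
    qed
    ultimately show ?thesis by (simp add: algebra_simps)
  qed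
  finally show ?thesis .
qed

lemma comparable_onE:
  assumes "comparable_on X F G"
  obtains c C where "c > 0" "C > 0" "\<And>x. x \<in> X \<Longrightarrow> c * G x \<le> F x" "\<And>x. x \<in> X \<Longrightarrow> F x \<le> C * G x"
  using assms unfolding comparable_on_def by blast

locale box_tree =
  fixes D :: "'n::finite dyadic_structure" and \<alpha> \<theta> r1 r2 :: real
  assumes grid: "dyadic_grid D" and btree: "bergman_tree \<theta> D" and boxes: "whitney_boxes \<alpha> \<theta> r1 r2 D"
    and \<theta>: "\<theta> > 0" and \<alpha>: "\<alpha> > -1"
begin

abbreviation "R \<equiv> child_rel D"
abbreviation "T \<equiv> tree D"
abbreviation "K \<equiv> upper_box D"

definition node_gen :: "complex ^ 'n \<Rightarrow> nat" where
  "node_gen a = (THE N. \<exists>j. (N, j) \<in> grid_index D \<and> a = center D N j)"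

lemma center_inj:
  "(N, j) \<in> grid_index D \<Longrightarrow> (N', j') \<in> grid_index D \<Longrightarrow> center D N j = center D N' j' \<Longrightarrow> N = N' \<and> j = j'"
  using btree unfolding bergman_tree_def inj_on_def by fastforce

lemma node_gen_center: "(N, j) \<in> grid_index D \<Longrightarrow> node_gen (center D N j) = N"
  unfolding node_gen_def by (rule the_equality) (use center_inj in blast)+

lemma tree_iff: "a \<in> T \<longleftrightarrow> (\<exists>N j. (N, j) \<in> grid_index D \<and> a = center D N j)"
  by (force simp: tree_def image_iff)

lemma countable_tree: "countable T"
  unfolding tree_def by simp

lemma child_in_tree: "(b, a) \<in> R \<Longrightarrow> b \<in> T \<and> a \<in> T \<and> node_gen b = Suc (node_gen a)"
  unfolding child_rel_def using node_gen_center by (auto simp: tree_iff)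

lemma parent_unique: "(b, a) \<in> R \<Longrightarrow> (b, a') \<in> R \<Longrightarrow> a = a'"
proof -
  assume "(b, a) \<in> R" "(b, a') \<in> R"
  then obtain N i j N' i' j' where *: "(Suc N, i) \<in> grid_index D" "(N, j) \<in> grid_index D"
     "b = center D (Suc N) i" "a = center D N j" "b /\<^sub>R norm b \<in> cube D N j"
     "(Suc N', i') \<in> grid_index D" "(N', j') \<in> grid_index D"
     "b = center D (Suc N') i'" "a' = center D N' j'" "b /\<^sub>R norm b \<in> cube D N' j'"
    unfolding child_rel_def by auto
  have N: "N' = N" using center_inj[OF *(1) *(6)] * by auto
  have "disjoint_family_on (cube D N) {1..num_cubes D N}"
    using grid unfolding dyadic_grid_def by blast
  moreover have "j \<in> {1..num_cubes D N}" "j' \<in> {1..num_cubes D N}"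
    using * N by (auto simp: grid_index_def)
  ultimately have "j = j'" using * N unfolding disjoint_family_on_def by blast
  then show "a = a'" using * N by simp
qed

lemma relpow_in_tree: "(b, a) \<in> R ^^ k \<Longrightarrow> a \<in> T \<Longrightarrow> b \<in> T \<and> node_gen b = node_gen a + k"
proof (induction k arbitrary: a)
  case (Suc k)
  then obtain c where c: "(b, c) \<in> R ^^ k" "(c, a) \<in> R" by auto
  then show ?case using Suc.IH[OF c(1)] child_in_tree[OF c(2)] by simp
qed simp

lemma relpow_unique: "(b, a) \<in> R ^^ k \<Longrightarrow> (b, a') \<in> R ^^ k \<Longrightarrow> a = a'"
proof (induction k arbitrary: a a')
  case (Suc k)
  then obtain c c' where "(b, c) \<in> R ^^ k" "(c, a) \<in> R" "(b, c') \<in> R ^^ k" "(c', a') \<in> R" by auto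
  then show ?case using Suc.IH parent_unique by blast
qed simp

lemma finite_children: "finite {b. (b, a) \<in> R}"
proof -
  have "{b. (b, a) \<in> R} \<subseteq> (\<lambda>i. center D (Suc (node_gen a)) i) ` {1..num_cubes D (Suc (node_gen a))}"
    unfolding child_rel_def by (auto simp: grid_index_def node_gen_center)
  then show ?thesis by (rule finite_subset) simp
qed

lemma card_descendants:
  "a \<in> T \<Longrightarrow> finite {b. (b, a) \<in> R ^^ k} \<and> card {b. (b, a) \<in> R ^^ k} \<le> exp (2 * real CARD('n) * \<theta>) ^ k"
proof (induction k arbitrary: a)
  case 0
  have "{b. (b, a) \<in> R ^^ 0} = {a}" by auto
  then show ?case by simp
next
  case (Suc k)
  let ?B = "exp (2 * real CARD('n) * \<theta>)"
  have eq: "{b. (b, a) \<in> R ^^ Suc k} = (\<Union>c\<in>{c. (c, a) \<in> R}. {b. (b, c) \<in> R ^^ k})" by auto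
  have ch: "finite {b. (b, c) \<in> R ^^ k} \<and> real (card {b. (b, c) \<in> R ^^ k}) \<le> ?B ^ k" if "(c, a) \<in> R" for c
    using Suc.IH child_in_tree[OF that] by blast
  have "card {b. (b, a) \<in> R ^^ Suc k} \<le> (\<Sum>c\<in>{c. (c, a) \<in> R}. card {b. (b, c) \<in> R ^^ k})"
    unfolding eq by (rule card_UN_le[OF finite_children])
  then have "real (card {b. (b, a) \<in> R ^^ Suc k}) \<le> (\<Sum>c\<in>{c. (c, a) \<in> R}. real (card {b. (b, c) \<in> R ^^ k}))"
    by (simp only: of_nat_sum[symmetric] of_nat_le_iff)
  also have "\<dots> \<le> real (card {c. (c, a) \<in> R}) * ?B ^ k"
    by (rule sum_bounded_above) (use ch in auto)
  also have "\<dots> \<le> ?B * ?B ^ k"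
    using boxes Suc.prems unfolding whitney_boxes_def by (intro mult_right_mono) auto
  finally show ?case using ch finite_children unfolding eq by (auto simp: eq)
qed

lemma dyadic_tent_layers: "dyadic_tent D a = (\<Union>k. \<Union>b\<in>{b. (b, a) \<in> R ^^ k}. K b)"
  unfolding dyadic_tent_def rtrancl_is_UN_relpow by blast

lemma box_borel: "a \<in> T \<Longrightarrow> K a \<in> sets borel"
  using boxes unfolding whitney_boxes_def by blast

lemma box_cover: "(\<Union>a\<in>T. K a) = ball 0 1"
  using boxes unfolding whitney_boxes_def by blast

lemma box_disjoint: "a \<in> T \<Longrightarrow> b \<in> T \<Longrightarrow> z \<in> K a \<Longrightarrow> z \<in> K b \<Longrightarrow> a = b"
  using boxes unfolding whitney_boxes_def disjoint_family_on_def by blast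

lemma tent_borel: "a \<in> T \<Longrightarrow> dyadic_tent D a \<in> sets borel"
proof -
  assume a: "a \<in> T"
  have "(\<Union>b\<in>{b. (b, a) \<in> R ^^ k}. K b) \<in> sets borel" for k
    by (rule sets.finite_UN) (use card_descendants[OF a] relpow_in_tree[OF _ a] box_borel in auto)
  then show ?thesis unfolding dyadic_tent_layers by (intro sets.countable_UN) auto
qed

lemma tent_ball: "a \<in> T \<Longrightarrow> dyadic_tent D a \<subseteq> ball 0 1"
  unfolding dyadic_tent_layers box_cover[symmetric] using relpow_in_tree by blast

lemma node_dist: "a \<in> T \<Longrightarrow> bergman_dist 0 a = (real (node_gen a) + 1 / 2) * \<theta>"
  using btree unfolding bergman_tree_def by (auto simp: tree_iff node_gen_center)

definition hom_dim :: real where "hom_dim = real CARD('n) + 1 + \<alpha>"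

lemma volume_bounds:
  obtains c C where "c > 0" "C > 0"
    "\<And>a. a \<in> T \<Longrightarrow> measure (V_alpha \<alpha>) (K a) \<le> C * exp (- 2 * real (node_gen a) * \<theta> * hom_dim)"
    "\<And>a. a \<in> T \<Longrightarrow> c * exp (- 2 * real (node_gen a) * \<theta> * hom_dim) \<le> measure (V_alpha \<alpha>) (dyadic_tent D a)"
proof -
  have b1: "comparable_on T (\<lambda>a. measure (V_alpha \<alpha>) (dyadic_tent D a)) (\<lambda>a. measure (V_alpha \<alpha>) (K a))"
    using boxes unfolding whitney_boxes_def by (elim conjE) assumption
  have b2: "comparable_on T (\<lambda>a. measure (V_alpha \<alpha>) (K a)) (\<lambda>a. (1 - (norm a)\<^sup>2) powr hom_dim)"
    using boxes unfolding whitney_boxes_def hom_dim_def by (elim conjE) assumption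
  obtain c1 C1 where c1: "c1 > 0" "C1 > 0"
    "\<And>a. a \<in> T \<Longrightarrow> c1 * measure (V_alpha \<alpha>) (K a) \<le> measure (V_alpha \<alpha>) (dyadic_tent D a)"
    "\<And>a. a \<in> T \<Longrightarrow> measure (V_alpha \<alpha>) (dyadic_tent D a) \<le> C1 * measure (V_alpha \<alpha>) (K a)"
    by (fact comparable_onE[OF b1])
  obtain c2 C2 where c2: "c2 > 0" "C2 > 0" "\<And>a. a \<in> T \<Longrightarrow> c2 * (1 - (norm a)\<^sup>2) powr hom_dim \<le> measure (V_alpha \<alpha>) (K a)"
     "\<And>a. a \<in> T \<Longrightarrow> measure (V_alpha \<alpha>) (K a) \<le> C2 * (1 - (norm a)\<^sup>2) powr hom_dim"
    by (fact comparable_onE[OF b2])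
  let ?X = "{(N, a). a \<in> T \<and> real N * \<theta> \<le> bergman_dist 0 a \<and> bergman_dist 0 a < (real N + 1) * \<theta>}"
  have b3: "comparable_on ?X
       (\<lambda>(N, a). (1 - (norm a)\<^sup>2) powr hom_dim) (\<lambda>(N, a). exp (- 2 * real N * \<theta> * hom_dim))"
    using boxes unfolding whitney_boxes_def hom_dim_def by (elim conjE) assumption
  obtain c3 C3 where c3: "c3 > 0" "C3 > 0"
    "\<And>x. x \<in> ?X \<Longrightarrow> c3 * (case x of (N, a) \<Rightarrow> exp (- 2 * real N * \<theta> * hom_dim)) \<le> (case x of (N, a) \<Rightarrow> (1 - (norm a)\<^sup>2) powr hom_dim)"
    "\<And>x. x \<in> ?X \<Longrightarrow> (case x of (N, a) \<Rightarrow> (1 - (norm a)\<^sup>2) powr hom_dim) \<le> C3 * (case x of (N, a) \<Rightarrow> exp (- 2 * real N * \<theta> * hom_dim))"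
    by (fact comparable_onE[OF b3])
  have X: "(node_gen a, a) \<in> ?X" if "a \<in> T" for a
    using node_dist[OF that] that \<theta> by (simp add: algebra_simps)
  show ?thesis
  proof (rule that[of "c1 * (c2 * c3)" "C2 * C3"])
    fix a assume a: "a \<in> T"
    have "measure (V_alpha \<alpha>) (K a) \<le> C2 * (C3 * exp (- 2 * real (node_gen a) * \<theta> * hom_dim))"
      using c2(4)[OF a] mult_left_mono[OF c3(4)[OF X[OF a], unfolded prod.case], of C2] c2(2) by linarith
    then show "measure (V_alpha \<alpha>) (K a) \<le> C2 * C3 * exp (- 2 * real (node_gen a) * \<theta> * hom_dim)"
      by (simp only: mult.assoc)
    have "c1 * (c2 * (c3 * exp (- 2 * real (node_gen a) * \<theta> * hom_dim))) \<le> c1 * (c2 * (1 - (norm a)\<^sup>2) powr hom_dim)"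
      using c1 c2 by (intro mult_left_mono c3(3)[OF X[OF a], unfolded prod.case]) auto
    also have "\<dots> \<le> c1 * measure (V_alpha \<alpha>) (K a)" using c1 by (intro mult_left_mono c2(3) a) auto
    also have "\<dots> \<le> measure (V_alpha \<alpha>) (dyadic_tent D a)" by (rule c1(3)[OF a])
    finally show "c1 * (c2 * c3) * exp (- 2 * real (node_gen a) * \<theta> * hom_dim) \<le> measure (V_alpha \<alpha>) (dyadic_tent D a)"
      by (simp only: mult.assoc)
  qed (use c1 c2 c3 in auto)
qed

end

section \<open>Averages over dyadic tents\<close>

lemma power_sum_descending_le:
  fixes y :: real and g :: "'a \<Rightarrow> nat"
  assumes y: "0 < y" "y < 1" and A: "finite A" "inj_on g A" "g ` A \<subseteq> {..m}"
  shows "(\<Sum>a\<in>A. y ^ (m - g a)) \<le> 1 / (1 - y)"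
proof -
  have "(\<Sum>a\<in>A. y ^ (m - g a)) = (\<Sum>i\<in>g ` A. y ^ (m - i))"
    by (simp add: sum.reindex[OF A(2)])
  also have "\<dots> \<le> (\<Sum>i\<le>m. y ^ (m - i))"
    using y A by (intro sum_mono2) auto
  also have "\<dots> = (\<Sum>i\<le>m. y ^ i)"
    by (rule sum.reindex_bij_witness[of _ "\<lambda>i. m - i" "\<lambda>i. m - i"]) auto
  also have "\<dots> \<le> (\<Sum>i. y ^ i)"
    using y by (intro sum_le_suminf summable_geometric) auto
  also have "\<dots> = 1 / (1 - y)" using y by (simp add: suminf_geometric)
  finally show ?thesis .
qed

definition dyadic_product :: "real \<Rightarrow> real \<Rightarrow> real \<Rightarrow> real \<Rightarrow> (complex ^ 'n::finite \<Rightarrow> complex) \<Rightarrow> (complex ^ 'n) set \<Rightarrow> ennreal" where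
  "dyadic_product \<alpha> s t1 t2 f E = ennreal (measure (V_alpha \<alpha>) E powr s) *
     average \<alpha> E (\<lambda>z. cmod (f z) powr t1) * average \<alpha> E (\<lambda>z. cmod (f z) powr t2)"

definition dyadic_sum :: "real \<Rightarrow> real \<Rightarrow> real \<Rightarrow> real \<Rightarrow> (complex ^ 'n::finite \<Rightarrow> complex) \<Rightarrow> 'n dyadic_structure \<Rightarrow> ennreal" where
  "dyadic_sum \<alpha> s t1 t2 f D =
     (\<Sum>\<^sub>\<infinity>(k, j)\<in>grid_index D. dyadic_product \<alpha> s t1 t2 f (dyadic_tent D (center D k j)))"

context box_tree begin

definition box_gen :: "complex ^ 'n \<Rightarrow> nat" where
  "box_gen z = node_gen (THE b. b \<in> T \<and> z \<in> K b)"

lemma box_gen_eq: "b \<in> T \<Longrightarrow> z \<in> K b \<Longrightarrow> box_gen z = node_gen b"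
  unfolding box_gen_def using box_disjoint by (subst the_equality[of _ b]) auto

lemma box_ball: "b \<in> T \<Longrightarrow> K b \<subseteq> ball 0 1"
  using box_cover by blast

lemma measurable_box_gen [measurable]: "box_gen \<in> measurable (V_alpha \<alpha>) (count_space UNIV)"
proof -
  have "box_gen -` {N} \<inter> ball 0 1 \<in> sets (V_alpha \<alpha>)" for N
  proof -
    have "box_gen -` {N} \<inter> ball 0 1 = (\<Union>b\<in>{b \<in> T. node_gen b = N}. K b)"
      unfolding box_cover[symmetric] using box_gen_eq by auto
    moreover have "(\<Union>b\<in>{b \<in> T. node_gen b = N}. K b) \<in> sets (V_alpha \<alpha>)"
    proof (rule sets.countable_UN')
      show "countable {b \<in> T. node_gen b = N}"
        by (rule countable_subset[OF _ countable_tree]) auto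
      show "K ` {b \<in> T. node_gen b = N} \<subseteq> sets (V_alpha \<alpha>)"
        using in_sets_V_alpha[OF box_borel box_ball] by blast
    qed
    ultimately show ?thesis by simp
  qed
  then show ?thesis by (simp add: measurable_count_space_eq2_countable)
qed

definition growth :: real where "growth = exp (\<theta> * (1 + \<alpha>))"

lemma growth: "growth > 1"
  using \<theta> \<alpha> by (simp add: growth_def)

text \<open>The base \<open>growth\<close> lies strictly between \<open>1\<close> and \<open>exp (2 * \<theta> * (1 + \<alpha>))\<close>, the factor by which the bound on the
  total volume of the descendants decreases from one generation to the next. The difference of generations is a
  truncated one, so that the weight is at least \<open>1\<close> everywhere, also outside the tent of \<open>a\<close>.\<close>

definition depth_weight :: "complex ^ 'n \<Rightarrow> complex ^ 'n \<Rightarrow> real" where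
  "depth_weight a z = growth ^ (box_gen z - node_gen a)"

lemma depth_weight_ge_1: "depth_weight a z \<ge> 1"
  using growth by (simp add: depth_weight_def)

lemma measurable_depth_weight [measurable]: "depth_weight a \<in> borel_measurable (V_alpha \<alpha>)"
  unfolding depth_weight_def by measurable

lemma tent_measure:
  assumes a: "a \<in> T"
  shows "measure (V_alpha \<alpha>) (dyadic_tent D a) > 0"
    "emeasure (V_alpha \<alpha>) (dyadic_tent D a) = ennreal (measure (V_alpha \<alpha>) (dyadic_tent D a))"
proof -
  obtain c C where "c > 0" "C > 0"
    "\<And>a. a \<in> T \<Longrightarrow> measure (V_alpha \<alpha>) (K a) \<le> C * exp (- 2 * real (node_gen a) * \<theta> * hom_dim)"
    "\<And>a. a \<in> T \<Longrightarrow> c * exp (- 2 * real (node_gen a) * \<theta> * hom_dim) \<le> measure (V_alpha \<alpha>) (dyadic_tent D a)"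
    by (fact volume_bounds)
  then show pos: "measure (V_alpha \<alpha>) (dyadic_tent D a) > 0"
    using a by (meson exp_gt_zero less_le_trans mult_pos_pos)
  show "emeasure (V_alpha \<alpha>) (dyadic_tent D a) = ennreal (measure (V_alpha \<alpha>) (dyadic_tent D a))"
    by (rule emeasure_eq_ennreal_measure) (use pos in \<open>auto simp: measure_def\<close>)
qed

lemma box_subset_tent: "K a \<subseteq> dyadic_tent D a"
  unfolding dyadic_tent_def by blast

lemma box_measure: "a \<in> T \<Longrightarrow> emeasure (V_alpha \<alpha>) (K a) = ennreal (measure (V_alpha \<alpha>) (K a))"
proof (rule emeasure_eq_ennreal_measure)
  assume a: "a \<in> T"
  have "emeasure (V_alpha \<alpha>) (K a) \<le> emeasure (V_alpha \<alpha>) (dyadic_tent D a)"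
    by (intro emeasure_mono box_subset_tent in_sets_V_alpha tent_borel tent_ball a)
  then show "emeasure (V_alpha \<alpha>) (K a) \<noteq> top"
    unfolding tent_measure(2)[OF a] by (auto simp: top_unique)
qed

text \<open>Generation by generation: there are at most \<open>exp (2 n \<theta> k)\<close> descendants at depth \<open>k\<close>, each smaller in volume
  by the factor \<open>exp (- 2 \<theta> k (n + 1 + \<alpha>))\<close>. The weight of depth \<open>k\<close> uses up half of the gain in the
  exponent, and the other half makes the series converge.\<close>

lemma depth_weight_integral:
  obtains C where "C > 0"
    "\<And>a. a \<in> T \<Longrightarrow> (\<integral>\<^sup>+z\<in>dyadic_tent D a. ennreal (depth_weight a z) \<partial>V_alpha \<alpha>)
      \<le> ennreal (C * measure (V_alpha \<alpha>) (dyadic_tent D a))"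
proof -
  obtain c C where cC: "c > 0" "C > 0"
    "\<And>a. a \<in> T \<Longrightarrow> measure (V_alpha \<alpha>) (K a) \<le> C * exp (- 2 * real (node_gen a) * \<theta> * hom_dim)"
    "\<And>a. a \<in> T \<Longrightarrow> c * exp (- 2 * real (node_gen a) * \<theta> * hom_dim) \<le> measure (V_alpha \<alpha>) (dyadic_tent D a)"
    by (fact volume_bounds)
  define B where "B = exp (2 * real CARD('n) * \<theta>)"
  define y where "y = exp (- \<theta> * (1 + \<alpha>))"
  have y: "0 < y" "y < 1" using \<theta> \<alpha> by (auto simp: y_def)
  have By: "growth * B * exp (- 2 * \<theta> * hom_dim) = y"
    by (simp add: growth_def B_def y_def hom_dim_def algebra_simps flip: exp_add)
  show ?thesis
  proof (rule that[of "C / (1 - y) / c"])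
    fix a assume a: "a \<in> T"
    define Desc where "Desc = (\<lambda>k. {b. (b, a) \<in> R ^^ k})"
    have Desc: "finite (Desc k)" "real (card (Desc k)) \<le> B ^ k" for k
      using card_descendants[OF a, of k] by (auto simp: Desc_def B_def)
    have DescT: "b \<in> T" "node_gen b = node_gen a + k" if "b \<in> Desc k" for b k
      using relpow_in_tree[OF _ a, of b k] that by (auto simp: Desc_def)
    have pt: "ennreal (depth_weight a z) * indicator (dyadic_tent D a) z
       \<le> (\<Sum>k. \<Sum>b\<in>Desc k. ennreal (growth ^ k) * indicator (K b) z)" for z
    proof (cases "z \<in> dyadic_tent D a")
      case True
      then obtain k b where kb: "b \<in> Desc k" "z \<in> K b" unfolding dyadic_tent_layers Desc_def by blast
      have "depth_weight a z = growth ^ k"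
        using box_gen_eq[OF DescT(1)[OF kb(1)] kb(2)] DescT(2)[OF kb(1)] by (simp add: depth_weight_def)
      then have "ennreal (depth_weight a z) * indicator (dyadic_tent D a) z = ennreal (growth ^ k) * indicator (K b) z"
        using True kb by simp
      also have "\<dots> \<le> (\<Sum>b\<in>Desc k. ennreal (growth ^ k) * indicator (K b) z)"
        by (rule member_le_sum[OF kb(1)]) (auto simp: Desc)
      also have "\<dots> \<le> (\<Sum>k. \<Sum>b\<in>Desc k. ennreal (growth ^ k) * indicator (K b) z)"
        by (rule ennreal_le_suminf)
      finally show ?thesis .
    qed simp
    have Kset: "K b \<in> sets (V_alpha \<alpha>)" if "b \<in> Desc k" for b k
      by (intro in_sets_V_alpha box_borel box_ball DescT(1)[OF that])
    define e0 where "e0 = exp (- 2 * real (node_gen a) * \<theta> * hom_dim)"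
    have "(\<integral>\<^sup>+z\<in>dyadic_tent D a. ennreal (depth_weight a z) \<partial>V_alpha \<alpha>)
      \<le> (\<integral>\<^sup>+z. (\<Sum>k. \<Sum>b\<in>Desc k. ennreal (growth ^ k) * indicator (K b) z) \<partial>V_alpha \<alpha>)"
      by (intro nn_integral_mono pt)
    also have "\<dots> = (\<Sum>k. \<integral>\<^sup>+z. (\<Sum>b\<in>Desc k. ennreal (growth ^ k) * indicator (K b) z) \<partial>V_alpha \<alpha>)"
      by (rule nn_integral_suminf) (use Kset in \<open>auto intro!: borel_measurable_sum\<close>)
    also have "\<dots> \<le> (\<Sum>k. ennreal (C * e0 * y ^ k))"
    proof (rule suminf_le)
      fix k
      have "(\<integral>\<^sup>+z. (\<Sum>b\<in>Desc k. ennreal (growth ^ k) * indicator (K b) z) \<partial>V_alpha \<alpha>)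
        = (\<Sum>b\<in>Desc k. \<integral>\<^sup>+z. ennreal (growth ^ k) * indicator (K b) z \<partial>V_alpha \<alpha>)"
        by (rule nn_integral_sum) (use Kset in auto)
      also have "\<dots> \<le> (\<Sum>b\<in>Desc k. ennreal (growth ^ k * (C * (e0 * exp (- 2 * \<theta> * hom_dim) ^ k))))"
      proof (rule sum_mono)
        fix b assume b: "b \<in> Desc k"
        have ee: "exp (- 2 * real (node_gen b) * \<theta> * hom_dim) = e0 * exp (- 2 * \<theta> * hom_dim) ^ k"
          unfolding e0_def DescT(2)[OF b] by (simp add: algebra_simps flip: exp_add exp_of_nat_mult)
        have "(\<integral>\<^sup>+z. ennreal (growth ^ k) * indicator (K b) z \<partial>V_alpha \<alpha>)
          = ennreal (growth ^ k) * ennreal (measure (V_alpha \<alpha>) (K b))"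
          using Kset[OF b] box_measure[OF DescT(1)[OF b]] by (simp add: nn_integral_cmult)
        also have "\<dots> = ennreal (growth ^ k * measure (V_alpha \<alpha>) (K b))"
          using growth by (intro ennreal_mult[symmetric]) auto
        also have "\<dots> \<le> ennreal (growth ^ k * (C * (e0 * exp (- 2 * \<theta> * hom_dim) ^ k)))"
          using cC(3)[OF DescT(1)[OF b]] growth unfolding ee by (intro ennreal_leI mult_left_mono) auto
        finally show "(\<integral>\<^sup>+z. ennreal (growth ^ k) * indicator (K b) z \<partial>V_alpha \<alpha>)
          \<le> ennreal (growth ^ k * (C * (e0 * exp (- 2 * \<theta> * hom_dim) ^ k)))" .
      qed
      also have "\<dots> = ennreal (real (card (Desc k)) * (growth ^ k * (C * (e0 * exp (- 2 * \<theta> * hom_dim) ^ k))))"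
        using growth cC by (simp add: e0_def ennreal_mult flip: ennreal_of_nat_eq_real_of_nat)
      also have "\<dots> \<le> ennreal (B ^ k * (growth ^ k * (C * (e0 * exp (- 2 * \<theta> * hom_dim) ^ k))))"
        using Desc(2)[of k] growth cC by (intro ennreal_leI mult_right_mono) (auto simp: e0_def)
      also have "B ^ k * (growth ^ k * (C * (e0 * exp (- 2 * \<theta> * hom_dim) ^ k))) = C * e0 * (growth * B * exp (- 2 * \<theta> * hom_dim)) ^ k"
        by (simp add: power_mult_distrib)
      also have "\<dots> = C * e0 * y ^ k" unfolding By ..
      finally show "(\<integral>\<^sup>+z. (\<Sum>b\<in>Desc k. ennreal (growth ^ k) * indicator (K b) z) \<partial>V_alpha \<alpha>)
        \<le> ennreal (C * e0 * y ^ k)" .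
    qed auto
    also have "\<dots> = ennreal (C * e0 * (1 / (1 - y)))"
      by (intro suminf_ennreal_eq sums_mult geometric_sums) (use y cC in \<open>auto simp: e0_def\<close>)
    also have "\<dots> \<le> ennreal (C / (1 - y) / c * measure (V_alpha \<alpha>) (dyadic_tent D a))"
    proof (rule ennreal_leI)
      have "C / (1 - y) / c * (c * e0) \<le> C / (1 - y) / c * measure (V_alpha \<alpha>) (dyadic_tent D a)"
        using cC(4)[OF a] cC(1,2) y unfolding e0_def by (intro mult_left_mono) auto
      moreover have "C / (1 - y) / c * (c * e0) = C * e0 * (1 / (1 - y))" using cC(1) by simp
      ultimately show "C * e0 * (1 / (1 - y)) \<le> C / (1 - y) / c * measure (V_alpha \<alpha>) (dyadic_tent D a)"
        by simp
    qed
    finally show "(\<integral>\<^sup>+z\<in>dyadic_tent D a. ennreal (depth_weight a z) \<partial>V_alpha \<alpha>)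
      \<le> ennreal (C / (1 - y) / c * measure (V_alpha \<alpha>) (dyadic_tent D a))" .
  qed (use cC y in simp)
qed

text \<open>The tents of the tree that contain a given point belong to nodes of distinct generations, all
  ancestors of the node of its box. Hence the discounts at this point are distinct powers of a number
  below \<open>1\<close>.\<close>

lemma discounted_tents_packing:
  assumes \<eta>: "\<eta> > 0" and h: "h \<in> borel_measurable (V_alpha \<alpha>)" and F: "finite F" "F \<subseteq> T"
  shows "(\<Sum>a\<in>F. \<integral>\<^sup>+z\<in>dyadic_tent D a. h z * ennreal (depth_weight a z powr (- \<eta>)) \<partial>V_alpha \<alpha>)
    \<le> ennreal (1 / (1 - growth powr (- \<eta>))) * (\<integral>\<^sup>+z. h z \<partial>V_alpha \<alpha>)"
proof -
  define y where "y = growth powr (- \<eta>)"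
  have "growth powr (- \<eta>) < growth powr 0" using growth \<eta> by (intro powr_less_mono) auto
  then have y: "0 < y" "y < 1" using growth by (auto simp: y_def)
  have yp: "depth_weight a z powr (- \<eta>) = y ^ (box_gen z - node_gen a)" for a z
    using growth by (simp add: depth_weight_def y_def powr_powr mult.commute flip: powr_realpow)
  have tset: "dyadic_tent D a \<in> sets (V_alpha \<alpha>)" if "a \<in> F" for a
    using that F by (intro in_sets_V_alpha tent_borel tent_ball) auto
  have "(\<Sum>a\<in>F. \<integral>\<^sup>+z\<in>dyadic_tent D a. h z * ennreal (depth_weight a z powr (- \<eta>)) \<partial>V_alpha \<alpha>)
    = (\<integral>\<^sup>+z. (\<Sum>a\<in>F. h z * ennreal (depth_weight a z powr (- \<eta>)) * indicator (dyadic_tent D a) z) \<partial>V_alpha \<alpha>)"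
    by (rule nn_integral_sum[symmetric]) (use h tset in measurable)
  also have "\<dots> \<le> (\<integral>\<^sup>+z. ennreal (1 / (1 - y)) * h z \<partial>V_alpha \<alpha>)"
  proof (rule nn_integral_mono)
    fix z :: "complex ^ 'n"
    define A where "A = {a \<in> F. z \<in> dyadic_tent D a}"
    have A: "finite A" using F by (simp add: A_def)
    have mem: "\<exists>b k. b \<in> T \<and> z \<in> K b \<and> (b, a) \<in> R ^^ k \<and> node_gen b = node_gen a + k" if aA: "a \<in> A" for a
    proof -
      obtain k b where "(b, a) \<in> R ^^ k" "z \<in> K b" using aA unfolding A_def dyadic_tent_layers by blast
      moreover have "a \<in> T" using aA F by (auto simp: A_def)
      ultimately show ?thesis using relpow_in_tree by blast
    qed
    have "inj_on node_gen A"
    proof (rule inj_onI)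
      fix a a' assume aa: "a \<in> A" "a' \<in> A" "node_gen a = node_gen a'"
      obtain b k where b: "b \<in> T" "z \<in> K b" "(b, a) \<in> R ^^ k" "node_gen b = node_gen a + k" using mem[OF aa(1)] by blast
      obtain b' k' where b': "b' \<in> T" "z \<in> K b'" "(b', a') \<in> R ^^ k'" "node_gen b' = node_gen a' + k'" using mem[OF aa(2)] by blast
      have "b' = b" using box_disjoint[OF b'(1) b(1) b'(2) b(2)] .
      moreover have "k' = k" using b(4) b'(4) aa(3) \<open>b' = b\<close> by simp
      ultimately show "a = a'" using relpow_unique b(3) b'(3) by blast
    qed
    moreover have "node_gen ` A \<subseteq> {..box_gen z}"
    proof
      fix m assume "m \<in> node_gen ` A"
      then obtain a where a: "a \<in> A" "m = node_gen a" by blast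
      obtain b k where b: "b \<in> T" "z \<in> K b" "node_gen b = node_gen a + k" using mem[OF a(1)] by blast
      then show "m \<in> {..box_gen z}" using box_gen_eq[OF b(1,2)] a by simp
    qed
    ultimately have "(\<Sum>a\<in>A. y ^ (box_gen z - node_gen a)) \<le> 1 / (1 - y)"
      by (rule power_sum_descending_le[OF y A])
    then have "h z * ennreal (\<Sum>a\<in>A. y ^ (box_gen z - node_gen a)) \<le> h z * ennreal (1 / (1 - y))"
      by (intro mult_left_mono ennreal_leI) auto
    moreover have "(\<Sum>a\<in>F. h z * ennreal (depth_weight a z powr (- \<eta>)) * indicator (dyadic_tent D a) z)
      = h z * ennreal (\<Sum>a\<in>A. y ^ (box_gen z - node_gen a))"
    proof -
      have "(\<Sum>a\<in>F. h z * ennreal (depth_weight a z powr (- \<eta>)) * indicator (dyadic_tent D a) z)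
        = (\<Sum>a\<in>A. h z * ennreal (y ^ (box_gen z - node_gen a)))"
        unfolding A_def yp using F(1) by (intro sum.mono_neutral_cong_right) auto
      also have "\<dots> = h z * ennreal (\<Sum>a\<in>A. y ^ (box_gen z - node_gen a))"
        using y by (simp add: sum_distrib_left[symmetric] sum_ennreal)
      finally show ?thesis .
    qed
    ultimately show "(\<Sum>a\<in>F. h z * ennreal (depth_weight a z powr (- \<eta>)) * indicator (dyadic_tent D a) z)
      \<le> ennreal (1 / (1 - y)) * h z"
      by (simp only: mult.commute[of "ennreal (1 / (1 - y))"])
  qed
  also have "\<dots> = ennreal (1 / (1 - y)) * (\<integral>\<^sup>+z. h z \<partial>V_alpha \<alpha>)"
    by (rule nn_integral_cmult[OF h])
  finally show ?thesis unfolding y_def .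
qed

text \<open>The exponents of the volume cancel: by \<open>nn_integral_power_le_weighted\<close>, the average of \<open>\<bar>f\<bar>\<^sup>t\<close> over a
  tent of volume \<open>v\<close> is at most a constant times \<open>(G / v) powr (t / p)\<close>, where \<open>G\<close> is the
  discounted integral of \<open>\<bar>f\<bar>\<^sup>p\<close>, with the same discount for both \<open>t1\<close> and \<open>t2\<close>. Thus each summand is at
  most a constant times \<open>G powr (q / p)\<close>. One factor \<open>G\<close> is kept for the packing estimate, and the
  remaining power of \<open>G\<close> is bounded by that of the integral over the whole ball.\<close>

lemma dyadic_product_sum_le:
  assumes t: "0 < t1" "t1 < p" "0 < t2" "t2 < p" "t1 + t2 = q" and pq: "p \<le> q"
  obtains C where "C > 0"
    "\<And>f F. f \<in> borel_measurable (V_alpha \<alpha>) \<Longrightarrow> F \<ge> 0 \<Longrightarrow> bergman_pow \<alpha> p f = ennreal F \<Longrightarrow>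
      dyadic_sum \<alpha> (q / p) t1 t2 f D \<le> ennreal (C * F powr (q / p))"
proof -
  obtain C where C: "C > 0"
    "\<And>a. a \<in> T \<Longrightarrow> (\<integral>\<^sup>+z\<in>dyadic_tent D a. ennreal (depth_weight a z) \<partial>V_alpha \<alpha>)
      \<le> ennreal (C * measure (V_alpha \<alpha>) (dyadic_tent D a))"
    by (fact depth_weight_integral)
  define \<eta> where "\<eta> = min (p / t1 - 1) (p / t2 - 1)"
  have \<eta>: "\<eta> > 0" "\<eta> \<le> p / t1 - 1" "\<eta> \<le> p / t2 - 1" using t by (auto simp: \<eta>_def)
  define S where "S = 1 / (1 - growth powr (- \<eta>))"
  have "growth powr (- \<eta>) < growth powr 0" using growth \<eta> by (intro powr_less_mono) auto
  then have S: "S > 0" using growth by (simp add: S_def)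
  show ?thesis
  proof (rule that[of "(C + 1)\<^sup>2 * S"])
    fix f :: "complex ^ 'n \<Rightarrow> complex" and F :: real
    assume f [measurable]: "f \<in> borel_measurable (V_alpha \<alpha>)" and F: "F \<ge> 0" "bergman_pow \<alpha> p f = ennreal F"
    define X where "X = (\<lambda>a. dyadic_product \<alpha> (q / p) t1 t2 f (dyadic_tent D a))"
    define Gi where "Gi = (\<lambda>a. \<integral>\<^sup>+z\<in>dyadic_tent D a. ennreal (cmod (f z) powr p * depth_weight a z powr (- \<eta>)) \<partial>V_alpha \<alpha>)"
    have Gi: "Gi a \<le> ennreal F" for a
    proof -
      have "Gi a \<le> bergman_pow \<alpha> p f"
        unfolding Gi_def bergman_pow_def
      proof (rule nn_integral_mono)
        fix z
        have "depth_weight a z powr (- \<eta>) \<le> depth_weight a z powr 0"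
          using depth_weight_ge_1[of a z] \<eta> by (intro powr_mono) auto
        then have "cmod (f z) powr p * depth_weight a z powr (- \<eta>) \<le> cmod (f z) powr p * 1"
          using depth_weight_ge_1[of a z] by (intro mult_left_mono) auto
        then show "ennreal (cmod (f z) powr p * depth_weight a z powr (- \<eta>)) * indicator (dyadic_tent D a) z
          \<le> ennreal (cmod (f z) powr p)"
          by (auto simp: indicator_def intro!: ennreal_leI)
      qed
      then show ?thesis unfolding F(2) .
    qed
    have XG: "X a \<le> ennreal ((C + 1)\<^sup>2 * F powr (q / p - 1)) * Gi a" if a: "a \<in> T" for a
    proof -
      let ?E = "dyadic_tent D a"
      define v where "v = measure (V_alpha \<alpha>) ?E"
      have v: "v > 0" "emeasure (V_alpha \<alpha>) ?E = ennreal v"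
        using tent_measure[OF a] by (auto simp: v_def)
      have E: "?E \<in> sets (V_alpha \<alpha>)" by (intro in_sets_V_alpha tent_borel tent_ball a)
      have "Gi a < top" using Gi[of a] by (rule order_le_less_trans) simp
      then obtain G where G: "Gi a = ennreal G" "G \<ge> 0" by (metis ennreal_cases less_irrefl)
      have GF: "G \<le> F" using Gi[of a] F(1) unfolding G(1) by simp
      have I: "(\<integral>\<^sup>+z\<in>?E. ennreal (cmod (f z) powr t) \<partial>V_alpha \<alpha>) \<le> ennreal ((C + 1) * v powr (1 - t / p) * G powr (t / p))"
        if "0 < t" "t < p" "\<eta> \<le> p / t - 1" for t
        by (rule nn_integral_power_le_weighted[where \<omega> = "depth_weight a" and \<eta> = \<eta>])
          (use that E depth_weight_ge_1 C v(1) G[unfolded Gi_def] in \<open>auto simp: v_def intro!: C(2)[OF a]\<close>)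
      have avg: "average \<alpha> ?E (\<lambda>z. cmod (f z) powr t) \<le> ennreal ((C + 1) * (v powr (- t / p) * G powr (t / p)))"
        if "0 < t" "t < p" "\<eta> \<le> p / t - 1" for t
      proof -
        have "average \<alpha> ?E (\<lambda>z. cmod (f z) powr t) \<le> ennreal ((C + 1) * v powr (1 - t / p) * G powr (t / p)) / ennreal v"
          unfolding average_def v(2) by (intro divide_right_mono_ennreal I that)
        also have "\<dots> = ennreal ((C + 1) * v powr (1 - t / p) * G powr (t / p) / v)"
          using C(1) v(1) by (intro divide_ennreal) auto
        also have "(C + 1) * v powr (1 - t / p) * G powr (t / p) / v = (C + 1) * (v powr (- t / p) * G powr (t / p))"
          using v(1) by (simp add: powr_diff powr_minus field_simps)
        finally show ?thesis .
      qed
      have "X a \<le> ennreal (v powr (q / p)) * ennreal ((C + 1) * (v powr (- t1 / p) * G powr (t1 / p)))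
          * ennreal ((C + 1) * (v powr (- t2 / p) * G powr (t2 / p)))"
        unfolding X_def dyadic_product_def v_def[symmetric] by (intro mult_mono avg t \<eta>) auto
      also have "\<dots> = ennreal (v powr (q / p) * ((C + 1) * (v powr (- t1 / p) * G powr (t1 / p)))
          * ((C + 1) * (v powr (- t2 / p) * G powr (t2 / p))))"
        using C(1) by (simp flip: ennreal_mult)
      also have "v powr (q / p) * ((C + 1) * (v powr (- t1 / p) * G powr (t1 / p)))
          * ((C + 1) * (v powr (- t2 / p) * G powr (t2 / p)))
        = (C + 1)\<^sup>2 * G powr (q / p)"
      proof -
        have "v powr (q / p) * v powr (- t1 / p) * v powr (- t2 / p) = 1"
          using v(1) t(5)[symmetric] by (simp add: add_divide_distrib flip: powr_add)
        moreover have "G powr (t1 / p) * G powr (t2 / p) = G powr (q / p)"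
          using t(5)[symmetric] by (simp add: add_divide_distrib powr_add)
        ultimately show ?thesis by (simp add: power2_eq_square mult_ac)
      qed
      also have "(C + 1)\<^sup>2 * G powr (q / p) \<le> (C + 1)\<^sup>2 * (F powr (q / p - 1) * G)"
      proof (intro mult_left_mono)
        have p0: "p > 0" using t by linarith
        show "G powr (q / p) \<le> F powr (q / p - 1) * G"
        proof (cases "G = 0")
          case False
          have "G powr (q / p) = G powr (q / p - 1) * G"
            using False G(2) by (simp add: powr_diff)
          also have "\<dots> \<le> F powr (q / p - 1) * G"
            using GF G(2) pq p0 by (intro mult_right_mono powr_mono2) auto
          finally show ?thesis .
        qed simp
      qed simp
      finally show ?thesis using G by (simp add: ennreal_leI ennreal_mult'' mult.assoc)
    qed
    have fin: "sum X A \<le> ennreal ((C + 1)\<^sup>2 * S * F powr (q / p))" if A: "finite A" "A \<subseteq> T" for A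
    proof -
      have "sum X A \<le> (\<Sum>a\<in>A. ennreal ((C + 1)\<^sup>2 * F powr (q / p - 1)) * Gi a)"
        by (intro sum_mono XG) (use A in auto)
      also have "\<dots> = ennreal ((C + 1)\<^sup>2 * F powr (q / p - 1)) * (\<Sum>a\<in>A. Gi a)"
        by (simp add: sum_distrib_left)
      also have "(\<Sum>a\<in>A. Gi a) = (\<Sum>a\<in>A. \<integral>\<^sup>+z\<in>dyadic_tent D a. ennreal (cmod (f z) powr p) * ennreal (depth_weight a z powr (- \<eta>)) \<partial>V_alpha \<alpha>)"
        unfolding Gi_def by (simp add: ennreal_mult)
      also have "\<dots> \<le> ennreal S * bergman_pow \<alpha> p f"
        unfolding S_def bergman_pow_def by (rule discounted_tents_packing[OF \<eta>(1) _ A]) measurable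
      also have "ennreal ((C + 1)\<^sup>2 * F powr (q / p - 1)) * (ennreal S * bergman_pow \<alpha> p f)
        = ennreal ((C + 1)\<^sup>2 * F powr (q / p - 1) * (S * F))"
        unfolding F(2) using S F(1) by (simp flip: ennreal_mult)
      also have "(C + 1)\<^sup>2 * F powr (q / p - 1) * (S * F) = (C + 1)\<^sup>2 * S * F powr (q / p)"
        using F(1) by (cases "F = 0") (auto simp: powr_diff)
      finally show ?thesis by (simp add: mult_left_mono)
    qed
    have "(\<Sum>\<^sub>\<infinity>(k, j)\<in>grid_index D. X (center D k j)) \<le> ennreal ((C + 1)\<^sup>2 * S * F powr (q / p))"
    proof (subst nonneg_infsum_complete)
      show "(SUP A\<in>{A. finite A \<and> A \<subseteq> grid_index D}. \<Sum>(k, j)\<in>A. X (center D k j)) \<le> ennreal ((C + 1)\<^sup>2 * S * F powr (q / p))"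
      proof (rule SUP_least)
        fix A assume "A \<in> {A. finite A \<and> A \<subseteq> grid_index D}"
        then have A: "finite A" "A \<subseteq> grid_index D" by auto
        let ?c = "\<lambda>(k, j). center D k j"
        have inj: "inj_on ?c A"
          using btree A(2) unfolding bergman_tree_def by (meson inj_on_subset)
        have "(\<Sum>(k, j)\<in>A. X (center D k j)) = sum (X \<circ> ?c) A"
          by (simp add: case_prod_unfold o_def)
        also have "\<dots> = sum X (?c ` A)" by (rule sum.reindex[OF inj, symmetric])
        also have "\<dots> \<le> ennreal ((C + 1)\<^sup>2 * S * F powr (q / p))"
          by (rule fin) (use A in \<open>auto simp: tree_def\<close>)
        finally show "(\<Sum>(k, j)\<in>A. X (center D k j)) \<le> ennreal ((C + 1)\<^sup>2 * S * F powr (q / p))" .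
      qed
    qed auto
    then show "dyadic_sum \<alpha> (q / p) t1 t2 f D \<le> ennreal ((C + 1)\<^sup>2 * S * F powr (q / p))"
      unfolding dyadic_sum_def X_def .
  qed (use C S in simp)
qed

end

section \<open>The two implications\<close>

lemma has_derivative_vec:
  fixes \<phi> :: "'a::real_normed_vector \<Rightarrow> complex ^ 'm::finite"
  assumes "\<And>i. ((\<lambda>z. \<phi> z $ i) has_derivative (\<lambda>h. D h $ i)) (at z)"
  shows "(\<phi> has_derivative D) (at z)"
proof (subst has_derivative_componentwise_within, intro ballI)
  fix b :: "complex ^ 'm" assume "b \<in> Basis"
  then obtain i u where b: "b = axis i u" by (auto simp: Basis_vec_def)
  have "((\<lambda>z. inner (\<phi> z $ i) u) has_derivative (\<lambda>h. inner (D h $ i) u)) (at z)"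
    by (rule has_derivative_inner_left[OF assms])
  then show "((\<lambda>x. \<phi> x \<bullet> b) has_derivative (\<lambda>x. D x \<bullet> b)) (at z)"
    by (simp add: b inner_axis)
qed

lemma holo_map_derivative:
  assumes "holo_map_on \<phi> S" "z \<in> S"
  obtains D where "(\<phi> has_derivative D) (at z)" "\<And>c v. D (c *s v) = c *s D v"
proof -
  have "\<forall>i. \<exists>E. ((\<lambda>z. \<phi> z $ i) has_derivative E) (at z) \<and> (\<forall>c v. E (c *s v) = c * E v)"
    using assms unfolding holo_map_on_def holo_fun_on_def by blast
  then obtain E where E: "\<And>i. ((\<lambda>z. \<phi> z $ i) has_derivative E i) (at z)" "\<And>i c v. E i (c *s v) = c * E i v"
    by metis
  show ?thesis
  proof (rule that[of "\<lambda>h. \<chi> i. E i h"])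
    show "(\<phi> has_derivative (\<lambda>h. \<chi> i. E i h)) (at z)"
      by (rule has_derivative_vec) (simp add: E(1))
  qed (simp add: vec_eq_iff E(2))
qed

lemma continuous_on_holo_map: "holo_map_on \<phi> S \<Longrightarrow> continuous_on S \<phi>"
  unfolding continuous_on_eq_continuous_within
  by (meson continuous_at_imp_continuous_at_within has_derivative_continuous holo_map_derivative)

lemma holo_fun_on_compose:
  assumes f: "holo_fun_on f S'" and \<phi>: "holo_map_on \<phi> S" "\<phi> ` S \<subseteq> S'"
  shows "holo_fun_on (\<lambda>z. f (\<phi> z)) S"
  unfolding holo_fun_on_def
proof
  fix z assume z: "z \<in> S"
  obtain D where D: "(\<phi> has_derivative D) (at z)" "\<And>c v. D (c *s v) = c *s D v"
    using holo_map_derivative[OF \<phi>(1) z] by blast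
  have "\<phi> z \<in> S'" using \<phi>(2) z by blast
  then obtain E where E: "(f has_derivative E) (at (\<phi> z))" "\<And>c v. E (c *s v) = c * E v"
    using f unfolding holo_fun_on_def by meson
  have "((\<lambda>z. f (\<phi> z)) has_derivative (\<lambda>h. E (D h))) (at z)"
    using diff_chain_at[OF D(1) E(1)] by (simp add: o_def)
  then show "\<exists>D. ((\<lambda>z. f (\<phi> z)) has_derivative D) (at z) \<and> (\<forall>a v. D (a *s v) = a * D v)"
    using D(2) E(2) by auto
qed

lemma sum_le_infsum_ennreal:
  fixes X :: "'i \<Rightarrow> ennreal"
  shows "finite A \<Longrightarrow> A \<subseteq> I \<Longrightarrow> sum X A \<le> infsum X I"
  by (subst nonneg_infsum_complete) (auto intro: SUP_upper)

lemma sum_bounded_fibers: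
  fixes X :: "'b \<Rightarrow> ennreal"
  assumes F: "finite F" and m: "\<And>y. y \<in> \<pi> ` F \<Longrightarrow> real (card {a \<in> F. \<pi> a = y}) \<le> m"
  shows "(\<Sum>a\<in>F. X (\<pi> a)) \<le> ennreal m * (\<Sum>y\<in>\<pi> ` F. X y)"
proof -
  have "(\<Sum>a\<in>F. X (\<pi> a)) = (\<Sum>y\<in>\<pi> ` F. \<Sum>a\<in>{a \<in> F. \<pi> a = y}. X (\<pi> a))"
    by (rule sum.image_gen[OF F])
  also have "\<dots> = (\<Sum>y\<in>\<pi> ` F. ennreal (real (card {a \<in> F. \<pi> a = y})) * X y)"
    by (intro sum.cong refl) (simp add: ennreal_of_nat_eq_real_of_nat)
  also have "\<dots> \<le> (\<Sum>y\<in>\<pi> ` F. ennreal m * X y)"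
    by (intro sum_mono mult_right_mono ennreal_leI m) auto
  finally show ?thesis by (simp add: sum_distrib_left)
qed

context whitney_cover begin

text \<open>The tent over \<open>z = (1 - t) a / \<bar>a\<bar>\<close> works, with \<open>t\<close> a fixed multiple of \<open>\<delta>(a)\<close>; if this multiple
  exceeds \<open>1\<close>, then \<open>\<delta>(a)\<close> is bounded below and the whole ball can be taken.\<close>

lemma enclosing_carleson_tent:
  assumes "c > 0"
  obtains C where "C > 0"
    "\<And>a. a \<in> ball 0 1 \<Longrightarrow> a \<noteq> 0 \<Longrightarrow> \<exists>z\<in>ball (0 :: complex ^ 'n) 1. tent a (c * defect a) \<subseteq> carleson_tent z \<and>
        measure (V_alpha \<alpha>) (carleson_tent z) \<le> C * defect a powr hom_dim"
proof -
  obtain Ct where Ct: "Ct > 0"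
    "\<And>b t. norm b = 1 \<Longrightarrow> t > 0 \<Longrightarrow> emeasure (V_alpha \<alpha>) (tent (b :: complex ^ 'n) t) \<le> ennreal (Ct * t powr hom_dim)"
    using emeasure_V_tent by metis
  define B where "B = measure (V_alpha \<alpha>) (ball (0 :: complex ^ 'n) 1)"
  have B: "B \<ge> 0" by (simp add: B_def)
  show ?thesis
  proof (rule that[of "(Ct + B) * (c + 1) powr hom_dim"])
    fix a :: "complex ^ 'n" assume a: "a \<in> ball 0 1" "a \<noteq> 0"
    have da: "defect a > 0" using a(1) by (rule defect_pos)
    define t where "t = (c + 1) * defect a"
    have t: "t > 0" using da assms by (simp add: t_def)
    let ?b = "a /\<^sub>R norm a"
    have nb: "norm ?b = 1" using a by simp
    have sub: "tent a (c * defect a) \<subseteq> tent ?b t"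
      using tent_change_vertex[of a "c * defect a"] a by (simp add: t_def algebra_simps)
    have Ct_le: "Ct * t powr hom_dim \<le> (Ct + B) * (c + 1) powr hom_dim * defect a powr hom_dim"
      "B * t powr hom_dim \<le> (Ct + B) * (c + 1) powr hom_dim * defect a powr hom_dim"
      using Ct B assms da by (simp_all add: t_def powr_mult mult.assoc mult_right_mono)
    show "\<exists>z\<in>ball (0 :: complex ^ 'n) 1. tent a (c * defect a) \<subseteq> carleson_tent z \<and>
        measure (V_alpha \<alpha>) (carleson_tent z) \<le> (Ct + B) * (c + 1) powr hom_dim * defect a powr hom_dim"
    proof (cases "t < 1")
      case True
      define z where "z = (1 - t) *\<^sub>R ?b"
      have "norm z = \<bar>1 - t\<bar> * norm ?b" unfolding z_def by (rule norm_scaleR)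
      then have nz: "norm z = 1 - t" unfolding nb using True by simp
      have z0: "z \<noteq> 0" using nz True by auto
      have "((1 - t) *\<^sub>R x) /\<^sub>R (1 - t) = x" for x :: "complex ^ 'n" using True by simp
      then have zb: "z /\<^sub>R norm z = ?b" unfolding nz unfolding z_def by this
      have eq: "carleson_tent z = tent ?b t"
        by (simp only: carleson_tent_eq_tent[OF z0] zb) (simp add: nz)
      have "measure (V_alpha \<alpha>) (tent ?b t) \<le> Ct * t powr hom_dim"
        unfolding measure_def by (rule enn2real_leI[OF _ Ct(2)[OF nb t]]) (use Ct(1) in simp)
      then have "measure (V_alpha \<alpha>) (carleson_tent z) \<le> (Ct + B) * (c + 1) powr hom_dim * defect a powr hom_dim"
        unfolding eq using Ct_le(1) by linarith
      moreover have "z \<in> ball 0 1" using nz t by simp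
      ultimately show ?thesis using sub eq by blast
    next
      case False
      have "B * 1 \<le> B * t powr hom_dim"
        using False hom_dim_pos B by (intro mult_left_mono ge_one_powr_ge_zero) auto
      then have "B \<le> (Ct + B) * (c + 1) powr hom_dim * defect a powr hom_dim" using Ct_le(2) by linarith
      then have "measure (V_alpha \<alpha>) (carleson_tent (0 :: complex ^ 'n)) \<le> (Ct + B) * (c + 1) powr hom_dim * defect a powr hom_dim"
        by (simp add: carleson_tent_def B_def)
      moreover have "tent a (c * defect a) \<subseteq> carleson_tent 0"
        by (simp add: carleson_tent_def tent_ball)
      ultimately show ?thesis by (intro bexI[of _ 0]) auto
    qed
  qed (use Ct B assms in \<open>auto intro!: mult_pos_pos add_pos_nonneg\<close>)
qed

lemma boxes_per_set_bounded:
  assumes A: "finite A" "A \<subseteq> T" and E: "E \<in> sets borel" "E \<subseteq> ball 0 1" "measure (V_alpha \<alpha>) E > 0"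
    and sub: "\<And>a. a \<in> A \<Longrightarrow> K a \<subseteq> E"
    and C: "C > 0" "\<And>a. a \<in> A \<Longrightarrow> measure (V_alpha \<alpha>) E \<le> C * defect a powr hom_dim"
  shows "real (card A) \<le> C / c\<^sub>V"
proof -
  have disj: "disjoint_family_on K A" using K_disjoint A(2) by (auto simp: disjoint_family_on_def)
  have Kset: "K ` A \<subseteq> sets (V_alpha \<alpha>)" using in_sets_V_alpha[OF K_borel K_ball] A(2) by blast
  have fin: "emeasure (V_alpha \<alpha>) (K a) \<noteq> \<infinity>" if "a \<in> A" for a
    using emeasure_V_finite[OF K_ball[OF subsetD[OF A(2) that]]] by simp
  have "real (card A) * (c\<^sub>V / C * measure (V_alpha \<alpha>) E) \<le> (\<Sum>a\<in>A. measure (V_alpha \<alpha>) (K a))"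
  proof (rule sum_bounded_below)
    fix a assume a: "a \<in> A"
    have "c\<^sub>V / C * measure (V_alpha \<alpha>) E \<le> c\<^sub>V / C * (C * defect a powr hom_dim)"
      using C c\<^sub>V a by (intro mult_left_mono) auto
    also have "\<dots> = c\<^sub>V * defect a powr hom_dim" using C by simp
    also have "\<dots> \<le> measure (V_alpha \<alpha>) (K a)" 
      unfolding hom_dim_def by (rule K_lower[OF subsetD[OF A(2) a]])
    finally show "c\<^sub>V / C * measure (V_alpha \<alpha>) E \<le> measure (V_alpha \<alpha>) (K a)" .
  qed
  also have "\<dots> = measure (V_alpha \<alpha>) (\<Union>a\<in>A. K a)"
    by (rule measure_finite_Union[OF A(1) Kset disj fin, symmetric])
  also have "\<dots> \<le> measure (V_alpha \<alpha>) E"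
  proof (rule measure_mono_fmeasurable)
    show "(\<Union>a\<in>A. K a) \<subseteq> E" using sub by blast
    show "(\<Union>a\<in>A. K a) \<in> sets (V_alpha \<alpha>)" using A(1) Kset by blast
    show "E \<in> fmeasurable (V_alpha \<alpha>)"
      by (rule fmeasurableI[OF in_sets_V_alpha[OF E(1,2)] emeasure_V_finite[OF E(2)]])
  qed
  finally have "(real (card A) * (c\<^sub>V / C)) * measure (V_alpha \<alpha>) E \<le> 1 * measure (V_alpha \<alpha>) E" by simp
  then have "real (card A) * (c\<^sub>V / C) \<le> 1" using E(3) by (simp only: mult_le_cancel_right_pos)
  then show ?thesis using c\<^sub>V C by (simp add: field_simps)
qed

end

lemma cmod_power_eq_powr: "N \<ge> 1 \<Longrightarrow> cmod z ^ N = cmod z powr real N"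
  by (cases "z = 0") (auto simp: powr_realpow)

text \<open>The boxes of one tree, each assigned to a dyadic tent \<open>tn (pr a)\<close> of some tree that contains its
  enclosing Carleson tent. The tents chosen for different boxes may coincide, but only boundedly
  often, since the boxes are disjoint and comparable to the tent in volume.\<close>

lemma weighted_comp_le_dyadic_sum:
  fixes p q \<alpha> \<theta> r1 r2 t1 t2 :: real and M :: nat
    and \<D> :: "nat \<Rightarrow> 'n::finite dyadic_structure"
    and u :: "complex ^ 'n \<Rightarrow> complex" and \<phi> :: "complex ^ 'n \<Rightarrow> complex ^ 'n"
  assumes pq: "q < 2 * p" "0 < p" "0 < q" and \<alpha>: "\<alpha> > -1" and \<theta>: "\<theta> > 0" and r: "r1 > 0" "r2 > 0"
    and trees: "\<And>i. i \<in> {1..M} \<Longrightarrow> box_tree (\<D> i) \<alpha> \<theta> r1 r2"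
    and dom: "tents_dominated \<alpha> M \<D>"
    and u: "holo_fun_on u (ball 0 1)"
    and \<phi>: "holo_map_on \<phi> (ball 0 1)" "\<phi> ` ball 0 1 \<subseteq> ball 0 1"
    and t: "t1 > 0" "t2 > 0" "t1 + t2 = q"
    and bdd: "bounded_bergman_operator \<alpha> p q (weighted_comp u \<phi>)"
  obtains C where "C > 0"
    "\<And>f. f \<in> bergman_space \<alpha> p \<Longrightarrow> bergman_pow \<alpha> q (weighted_comp u \<phi> f) \<le>
       ennreal C * (\<Sum>i=1..M. dyadic_sum \<alpha> (q / p) t1 t2 f (\<D> i))"
proof -
  obtain d1 d2 where d: "d1 > 0" "d2 > 0" "\<And>z. z \<in> ball 0 1 \<Longrightarrow> \<exists>l\<in>{1..M}. \<exists>a\<in>tree (\<D> l).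
        carleson_tent z \<subseteq> dyadic_tent (\<D> l) a \<and>
        d1 * measure (V_alpha \<alpha>) (carleson_tent z) \<le> measure (V_alpha \<alpha>) (dyadic_tent (\<D> l) a) \<and>
        measure (V_alpha \<alpha>) (dyadic_tent (\<D> l) a) \<le> d2 * measure (V_alpha \<alpha>) (carleson_tent z)"
    using dom unfolding tents_dominated_def by blast
  have ball0: "(0 :: complex ^ 'n) \<in> ball 0 1" by simp
  from d(3)[OF ball0] obtain l0 a0 where l0: "l0 \<in> {1..M}" and a0: "a0 \<in> tree (\<D> l0)"
    "measure (V_alpha \<alpha>) (dyadic_tent (\<D> l0) a0) \<le> d2 * measure (V_alpha \<alpha>) (carleson_tent (0 :: complex ^ 'n))"
    by blast
  interpret B: box_tree "\<D> l0" \<alpha> \<theta> r1 r2 by (rule trees[OF l0])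
  have "0 < d2 * measure (V_alpha \<alpha>) (carleson_tent (0 :: complex ^ 'n))"
    using B.tent_measure(1)[OF a0(1)] a0(2) by linarith
  then have "0 < measure (V_alpha \<alpha>) (ball (0 :: complex ^ 'n) 1)"
    using d(2) by (simp add: carleson_tent_def zero_less_mult_iff)
  then have fin: "emeasure (V_alpha \<alpha>) (ball (0 :: complex ^ 'n) 1) < \<infinity>"
    by (cases "emeasure (V_alpha \<alpha>) (ball (0 :: complex ^ 'n) 1) = top") (auto simp: measure_def less_top)
  have comp: "comparable_on (tree (\<D> l0)) (\<lambda>a. measure (V_alpha \<alpha>) (upper_box (\<D> l0) a))
    (\<lambda>a. (1 - (norm a)\<^sup>2) powr (real CARD('n) + 1 + \<alpha>))"
    using B.boxes unfolding whitney_boxes_def by (elim conjE) assumption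
  obtain cV CV where cV: "cV > 0" "CV > 0"
    "\<And>a. a \<in> tree (\<D> l0) \<Longrightarrow> cV * (1 - (norm a)\<^sup>2) powr (real CARD('n) + 1 + \<alpha>) \<le> measure (V_alpha \<alpha>) (upper_box (\<D> l0) a)"
    "\<And>a. a \<in> tree (\<D> l0) \<Longrightarrow> measure (V_alpha \<alpha>) (upper_box (\<D> l0) a) \<le> CV * (1 - (norm a)\<^sup>2) powr (real CARD('n) + 1 + \<alpha>)"
    by (fact comparable_onE[OF comp])
  have tree_ball: "tree (\<D> l0) \<subseteq> ball 0 1"
    using B.btree unfolding bergman_tree_def tree_def by auto
  have box_sub: "bergman_ball a r1 \<subseteq> upper_box (\<D> l0) a \<and> upper_box (\<D> l0) a \<subseteq> bergman_ball a r2"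
    if "a \<in> tree (\<D> l0)" for a
    using B.boxes that unfolding whitney_boxes_def by blast
  have disj: "disjoint_family_on (upper_box (\<D> l0)) (tree (\<D> l0))"
    using B.boxes unfolding whitney_boxes_def by blast
  interpret W: whitney_cover "tree (\<D> l0)" "upper_box (\<D> l0)" \<alpha> r1 r2 cV CV
    using B.countable_tree tree_ball B.box_borel disj B.box_cover r box_sub cV fin \<alpha>
    by unfold_locales (auto simp: defect_def add.commute)
  let ?T = "tree (\<D> l0)"
  have bd: "\<And>f. f \<in> bergman_space \<alpha> p \<Longrightarrow> (\<lambda>z. u z * f (\<phi> z)) \<in> bergman_space \<alpha> q"
    using bdd unfolding bounded_bergman_operator_def weighted_comp_def by blast
  obtain C1 where C1: "\<And>f. f \<in> bergman_space \<alpha> p \<Longrightarrow>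
        bergman_norm \<alpha> q (\<lambda>z. u z * f (\<phi> z)) \<le> C1 * bergman_norm \<alpha> p f"
    using bdd unfolding bounded_bergman_operator_def weighted_comp_def by blast
  have "\<exists>Cm>0. \<forall>a\<in>?T. (\<integral>\<^sup>+z. indicator {z \<in> ball 0 1. \<phi> z \<in> upper_box (\<D> l0) a} z * ennreal (cmod (u z) powr q) \<partial>V_alpha \<alpha>)
      \<le> ennreal (Cm * defect a powr (W.hom_dim * q / p))"
    by (rule W.pullback_box_mass[where u = u and \<phi> = \<phi>, OF pq(2,3)], erule bd, erule C1) blast
  then obtain Cm where Cm: "Cm > 0"
    "\<forall>a\<in>?T. (\<integral>\<^sup>+z. indicator {z \<in> ball 0 1. \<phi> z \<in> upper_box (\<D> l0) a} z * ennreal (cmod (u z) powr q) \<partial>V_alpha \<alpha>)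
      \<le> ennreal (Cm * defect a powr (W.hom_dim * q / p))"
    by (elim exE conjE)
  obtain C2 where C2: "C2 > 0"
    "\<And>f E. holo_fun_on f (ball (0 :: complex ^ 'n) 1) \<Longrightarrow>
      (\<And>a. a \<in> ?T \<Longrightarrow> E a \<in> sets borel \<and> tent a ((W.\<Gamma> + 1) * defect a) \<subseteq> E a \<and> E a \<subseteq> ball 0 1) \<Longrightarrow>
      bergman_pow \<alpha> q (\<lambda>z. u z * f (\<phi> z))
        \<le> (\<integral>\<^sup>+a. ennreal (C2 * defect a powr (W.hom_dim * q / p - 2 * W.hom_dim)) *
              (lp_mass \<alpha> t1 (E a) f *
               lp_mass \<alpha> t2 (E a) f) \<partial>count_space ?T)"
    by (fact W.weighted_comp_le_box_sum[where u = u and \<phi> = \<phi>, OF continuous_on_holo_fun[OF u]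
          continuous_on_holo_map[OF \<phi>(1)] \<phi>(2) Cm t])
  have \<Gamma>1: "W.\<Gamma> + 1 > 0" using W.\<Gamma>_ge_4 by simp
  obtain C3 where C3: "C3 > 0"
    "\<And>a. a \<in> ball 0 1 \<Longrightarrow> a \<noteq> 0 \<Longrightarrow> \<exists>z\<in>ball (0 :: complex ^ 'n) 1. tent a ((W.\<Gamma> + 1) * defect a) \<subseteq> carleson_tent z \<and>
        measure (V_alpha \<alpha>) (carleson_tent z) \<le> C3 * defect a powr W.hom_dim"
    by (fact W.enclosing_carleson_tent[OF \<Gamma>1])
  define C4 where "C4 = d2 * C3"
  have C4: "C4 > 0" using d C3 by (simp add: C4_def)
  have nz: "a \<noteq> 0" if "a \<in> ?T" for a
  proof
    assume "a = 0"
    then have "bergman_dist 0 a = 0" by (simp add: bergman_dist_def ball_invol_def line_proj_def)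
    moreover have "(real (B.node_gen a) + 1 / 2) * \<theta> > 0" using \<theta> by simp
    ultimately show False using B.node_dist[OF that] by simp
  qed
  have "\<exists>i k j. i \<in> {1..M} \<and> (k, j) \<in> grid_index (\<D> i) \<and>
      tent a ((W.\<Gamma> + 1) * defect a) \<subseteq> dyadic_tent (\<D> i) (center (\<D> i) k j) \<and>
      measure (V_alpha \<alpha>) (dyadic_tent (\<D> i) (center (\<D> i) k j)) \<le> C4 * defect a powr W.hom_dim" if a: "a \<in> ?T" for a
  proof -
    obtain z where z: "z \<in> ball 0 1" "tent a ((W.\<Gamma> + 1) * defect a) \<subseteq> carleson_tent z"
        "measure (V_alpha \<alpha>) (carleson_tent z) \<le> C3 * defect a powr W.hom_dim"
      using C3(2)[OF subsetD[OF tree_ball a] nz[OF a]] by blast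
    obtain i b where ib: "i \<in> {1..M}" "b \<in> tree (\<D> i)" "carleson_tent z \<subseteq> dyadic_tent (\<D> i) b"
      "measure (V_alpha \<alpha>) (dyadic_tent (\<D> i) b) \<le> d2 * measure (V_alpha \<alpha>) (carleson_tent z)"
      using d(3)[OF z(1)] by blast
    obtain k j where kj: "(k, j) \<in> grid_index (\<D> i)" "b = center (\<D> i) k j"
      using ib(2) unfolding tree_def by auto
    have "measure (V_alpha \<alpha>) (dyadic_tent (\<D> i) b) \<le> d2 * (C3 * defect a powr W.hom_dim)"
      using ib(4) mult_left_mono[OF z(3), of d2] d(2) by linarith
    then show ?thesis using ib z(2) kj unfolding C4_def mult.assoc by blast
  qed
  then obtain ii kk jj where \<pi>: "\<And>a. a \<in> ?T \<Longrightarrow> ii a \<in> {1..M} \<and> (kk a, jj a) \<in> grid_index (\<D> (ii a)) \<and>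
      tent a ((W.\<Gamma> + 1) * defect a) \<subseteq> dyadic_tent (\<D> (ii a)) (center (\<D> (ii a)) (kk a) (jj a)) \<and>
      measure (V_alpha \<alpha>) (dyadic_tent (\<D> (ii a)) (center (\<D> (ii a)) (kk a) (jj a))) \<le> C4 * defect a powr W.hom_dim"
    by metis
  define tn where "tn = (\<lambda>(i, k, j). dyadic_tent (\<D> i) (center (\<D> i) k j))"
  define pr where "pr = (\<lambda>a. (ii a, kk a, jj a))"
  define Ix where "Ix = Sigma {1..M} (\<lambda>i. grid_index (\<D> i))"
  have pr: "pr a \<in> Ix" "tent a ((W.\<Gamma> + 1) * defect a) \<subseteq> tn (pr a)"
    "measure (V_alpha \<alpha>) (tn (pr a)) \<le> C4 * defect a powr W.hom_dim" if "a \<in> ?T" for a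
    using \<pi>[OF that] by (auto simp: pr_def Ix_def tn_def)
  have tn: "tn y \<in> sets borel" "tn y \<subseteq> ball 0 1" "measure (V_alpha \<alpha>) (tn y) > 0"
    "emeasure (V_alpha \<alpha>) (tn y) = ennreal (measure (V_alpha \<alpha>) (tn y))" if y: "y \<in> Ix" for y
  proof -
    obtain i k j where ikj: "y = (i, k, j)" "i \<in> {1..M}" "(k, j) \<in> grid_index (\<D> i)"
      using y by (auto simp: Ix_def)
    interpret Bi: box_tree "\<D> i" \<alpha> \<theta> r1 r2 by (rule trees[OF ikj(2)])
    have c: "center (\<D> i) k j \<in> tree (\<D> i)" using ikj(3) by (force simp: tree_def)
    show "tn y \<in> sets borel" "tn y \<subseteq> ball 0 1" "measure (V_alpha \<alpha>) (tn y) > 0"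
      "emeasure (V_alpha \<alpha>) (tn y) = ennreal (measure (V_alpha \<alpha>) (tn y))"
      using Bi.tent_borel[OF c] Bi.tent_ball[OF c] Bi.tent_measure[OF c] by (auto simp: tn_def ikj(1))
  qed
  have fibre: "real (card {a \<in> F. pr a = y}) \<le> C4 / cV"
    if F: "finite F" "F \<subseteq> ?T" and y: "y \<in> pr ` F" for F y
  proof (rule W.boxes_per_set_bounded)
    have yI: "y \<in> Ix" using y F(2) pr(1) by auto
    show "tn y \<in> sets borel" "tn y \<subseteq> ball 0 1" "measure (V_alpha \<alpha>) (tn y) > 0" using tn[OF yI] by auto
    show "upper_box (\<D> l0) a \<subseteq> tn y" if a: "a \<in> {a \<in> F. pr a = y}" for a
    proof
      fix w assume w: "w \<in> upper_box (\<D> l0) a"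
      have aT: "a \<in> ?T" using a F(2) by auto
      have "defect a > 0" using subsetD[OF tree_ball aT] by (rule defect_pos)
      then have "cmod (1 - herm w a) < (W.\<Gamma> + 1) * defect a"
        using W.box_geometry(3)[OF aT w] by (simp add: algebra_simps)
      then have "w \<in> tent a ((W.\<Gamma> + 1) * defect a)"
        using w W.K_ball[OF aT] by (auto simp: tent_def)
      then show "w \<in> tn y" using pr(2)[OF aT] a by auto
    qed
    show "measure (V_alpha \<alpha>) (tn y) \<le> C4 * defect a powr W.hom_dim" if a: "a \<in> {a \<in> F. pr a = y}" for a
      using pr(3)[of a] a F(2) by auto
  qed (use F C4 in auto)
  \<comment> \<open>negative, so that the upper bound on the volume of the tent is the useful one\<close>
  define e where "e = q / p - 2"
  have e: "e \<le> 0" using pq by (simp add: e_def divide_le_eq)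
  define C5 where "C5 = C2 * C4 powr (- e) * (C4 / cV)"
  show ?thesis
  proof (rule that[of C5])
    show "C5 > 0" using C2 C4 cV by (simp add: C5_def)
    fix f :: "complex ^ 'n \<Rightarrow> complex" assume "f \<in> bergman_space \<alpha> p"
    then have f: "holo_fun_on f (ball 0 1)" by (simp add: bergman_space_def)
    define X where "X = (\<lambda>y. dyadic_product \<alpha> (q / p) t1 t2 f (tn y))"
    define Y where "Y = (\<lambda>a. ennreal (C2 * defect a powr (W.hom_dim * q / p - 2 * W.hom_dim)) *
              (lp_mass \<alpha> t1 (tn (pr a)) f *
               lp_mass \<alpha> t2 (tn (pr a)) f))"
    have YX: "Y a \<le> ennreal (C2 * C4 powr (- e)) * X (pr a)" if a: "a \<in> ?T" for a
    proof -
      define v where "v = measure (V_alpha \<alpha>) (tn (pr a))"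
      note tna = tn[OF pr(1)[OF a]]
      have v: "v > 0" "emeasure (V_alpha \<alpha>) (tn (pr a)) = ennreal v" "v \<le> C4 * defect a powr W.hom_dim"
        using tna pr(3)[OF a] by (auto simp: v_def)
      have da: "defect a > 0" using subsetD[OF tree_ball a] by (rule defect_pos)
      define I1 where "I1 = lp_mass \<alpha> t1 (tn (pr a)) f"
      define I2 where "I2 = lp_mass \<alpha> t2 (tn (pr a)) f"
      have "defect a powr (W.hom_dim * q / p - 2 * W.hom_dim) = (defect a powr W.hom_dim) powr e"
        by (simp add: powr_powr e_def algebra_simps)
      also have "\<dots> \<le> (v / C4) powr e"
        by (rule powr_mono2'[OF e]) (use v C4 in \<open>auto simp: divide_le_eq mult.commute\<close>)
      also have "\<dots> = C4 powr (- e) * v powr e"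
        using v(1) C4 by (simp add: powr_divide powr_minus field_simps)
      also have "v powr e = v powr (q / p) * (1 / v) * (1 / v)"
        using v(1) by (simp add: e_def powr_diff power2_eq_square)
      finally have de: "defect a powr (W.hom_dim * q / p - 2 * W.hom_dim) \<le> C4 powr (- e) * (v powr (q / p) * (1 / v) * (1 / v))" .
      have "Y a \<le> ennreal (C2 * (C4 powr (- e) * (v powr (q / p) * (1 / v) * (1 / v)))) * (I1 * I2)"
        unfolding Y_def I1_def I2_def using C2(1) by (intro mult_right_mono ennreal_leI mult_left_mono de) auto
      also have "\<dots> = ennreal (C2 * C4 powr (- e)) * (ennreal (v powr (q / p)) * (I1 * ennreal (1 / v)) * (I2 * ennreal (1 / v)))"
      proof -
        have "ennreal (x * (y * (V * w * w))) = ennreal (x * y) * (ennreal V * ennreal w * ennreal w)"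
          if "0 \<le> x" "0 \<le> y" "0 \<le> V" "0 \<le> w" for x y V w :: real
          using that by (simp add: ennreal_mult mult_ac)
        from this[of C2 "C4 powr (- e)" "v powr (q / p)" "1 / v"] C2(1) v(1) show ?thesis
          by (simp only: mult_ac less_imp_le powr_ge_zero zero_le_divide_1_iff simp_thms)
      qed
      finally have *: "Y a \<le> ennreal (C2 * C4 powr (- e)) *
          (ennreal (v powr (q / p)) * (I1 * ennreal (1 / v)) * (I2 * ennreal (1 / v)))" .
      have "I * ennreal (1 / v) = I / ennreal v" for I
        using v(1) by (simp add: divide_ennreal_def inverse_ennreal inverse_eq_divide)
      with * show ?thesis
        unfolding X_def dyadic_product_def average_def lp_mass_def[symmetric] v(2) v_def[symmetric] I1_def I2_def by simp
    qed
    have "bergman_pow \<alpha> q (weighted_comp u \<phi> f) \<le> (\<integral>\<^sup>+a. Y a \<partial>count_space ?T)"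
      unfolding weighted_comp_def Y_def
      by (rule C2(2)[OF f]) (use tn(1,2)[OF pr(1)] pr(2) in blast)
    also have "\<dots> \<le> ennreal C5 * (\<Sum>i=1..M. dyadic_sum \<alpha> (q / p) t1 t2 f (\<D> i))"
    proof (rule nn_integral_count_space_le[OF B.countable_tree])
      fix F assume F: "finite F" "F \<subseteq> ?T"
      have "sum Y F \<le> (\<Sum>a\<in>F. ennreal (C2 * C4 powr (- e)) * X (pr a))"
        by (intro sum_mono YX) (use F in auto)
      also have "\<dots> = ennreal (C2 * C4 powr (- e)) * (\<Sum>a\<in>F. X (pr a))" by (simp add: sum_distrib_left)
      also have "\<dots> \<le> ennreal (C2 * C4 powr (- e)) * (ennreal (C4 / cV) * (\<Sum>y\<in>pr ` F. X y))"
        by (intro mult_left_mono sum_bounded_fibers F(1) fibre[OF F]) auto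
      also have "\<dots> = ennreal C5 * (\<Sum>y\<in>pr ` F. X y)"
      proof -
        have "ennreal C5 = ennreal (C2 * C4 powr (- e)) * ennreal (C4 / cV)"
          unfolding C5_def by (rule ennreal_mult) (use C2(1) C4 cV(1) in auto)
        then show ?thesis by (simp only: mult.assoc)
      qed
      also have "(\<Sum>y\<in>pr ` F. X y) \<le> (\<Sum>i=1..M. dyadic_sum \<alpha> (q / p) t1 t2 f (\<D> i))"
      proof -
        define G where "G = (\<lambda>i. {kj. (i, kj) \<in> pr ` F})"
        have G: "finite (G i)" for i
        proof (rule finite_subset)
          show "G i \<subseteq> snd ` pr ` F"
          proof
            fix x assume "x \<in> G i"
            then have "snd (i, x) \<in> snd ` pr ` F" unfolding G_def by (intro imageI) simp
            then show "x \<in> snd ` pr ` F" by simp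
          qed
        qed (use F(1) in simp)
        have sub: "pr ` F \<subseteq> Ix" using F(2) pr(1) by auto
        then have GI: "G i \<subseteq> grid_index (\<D> i)" for i
          unfolding G_def Ix_def by blast
        have "pr ` F = Sigma {1..M} G"
        proof (intro set_eqI iffI)
          fix y assume y: "y \<in> pr ` F"
          then have "fst y \<in> {1..M}" using sub by (auto simp: Ix_def)
          then have "(fst y, snd y) \<in> Sigma {1..M} G" using y by (intro SigmaI) (simp_all add: G_def)
          then show "y \<in> Sigma {1..M} G" by simp
        next
          fix y assume "y \<in> Sigma {1..M} G"
          then show "y \<in> pr ` F" unfolding G_def by (elim SigmaE) simp
        qed
        then have "(\<Sum>y\<in>pr ` F. X y) = (\<Sum>i\<in>{1..M}. \<Sum>kj\<in>G i. X (i, kj))"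
          using G by (simp add: sum.Sigma)
        also have "\<dots> \<le> (\<Sum>i\<in>{1..M}. \<Sum>\<^sub>\<infinity>kj\<in>grid_index (\<D> i). X (i, kj))"
          by (intro sum_mono sum_le_infsum_ennreal G GI)
        finally show ?thesis by (simp add: dyadic_sum_def X_def tn_def case_prod_unfold)
      qed
      finally show "sum Y F \<le> ennreal C5 * (\<Sum>i=1..M. dyadic_sum \<alpha> (q / p) t1 t2 f (\<D> i))"
        by (simp add: mult_left_mono)
    qed
    finally show "bergman_pow \<alpha> q (weighted_comp u \<phi> f) \<le> ennreal C5 * (\<Sum>i=1..M. dyadic_sum \<alpha> (q / p) t1 t2 f (\<D> i))" .
  qed
qed

lemma bounded_of_dyadic_bound:
  fixes p q \<alpha> \<theta> r1 r2 t1 t2 C :: real and M :: nat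
    and \<D> :: "nat \<Rightarrow> 'n::finite dyadic_structure"
    and u :: "complex ^ 'n \<Rightarrow> complex" and \<phi> :: "complex ^ 'n \<Rightarrow> complex ^ 'n"
  assumes pq: "0 < p" "p \<le> q"
    and trees: "\<And>i. i \<in> {1..M} \<Longrightarrow> box_tree (\<D> i) \<alpha> \<theta> r1 r2"
    and u: "holo_fun_on u (ball 0 1)"
    and \<phi>: "holo_map_on \<phi> (ball 0 1)" "\<phi> ` ball 0 1 \<subseteq> ball 0 1"
    and t: "0 < t1" "t1 < p" "0 < t2" "t2 < p" "t1 + t2 = q"
    and C: "C > 0" and bound: "\<And>f. f \<in> bergman_space \<alpha> p \<Longrightarrow> bergman_pow \<alpha> q (weighted_comp u \<phi> f) \<le>
       ennreal C * (\<Sum>i=1..M. dyadic_sum \<alpha> (q / p) t1 t2 f (\<D> i))"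
  shows "bounded_bergman_operator \<alpha> p q (weighted_comp u \<phi>)"
proof -
  have "\<exists>A>0. \<forall>f\<in>borel_measurable (V_alpha \<alpha>). \<forall>F\<ge>0. bergman_pow \<alpha> p f = ennreal F \<longrightarrow>
      dyadic_sum \<alpha> (q / p) t1 t2 f (\<D> i)
       \<le> ennreal (A * F powr (q / p))" if i: "i \<in> {1..M}" for i
    by (rule box_tree.dyadic_product_sum_le[OF trees[OF i] t pq(2)]) blast
  then obtain A where A: "\<And>i. i \<in> {1..M} \<Longrightarrow> A i > 0"
    "\<And>i f F. i \<in> {1..M} \<Longrightarrow> f \<in> borel_measurable (V_alpha \<alpha>) \<Longrightarrow> F \<ge> 0 \<Longrightarrow> bergman_pow \<alpha> p f = ennreal F \<Longrightarrow>
      dyadic_sum \<alpha> (q / p) t1 t2 f (\<D> i)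
       \<le> ennreal (A i * F powr (q / p))"
    by metis
  define S where "S = C * (\<Sum>i=1..M. A i)"
  have S: "S \<ge> 0" unfolding S_def using C A(1) by (intro mult_nonneg_nonneg sum_nonneg) (auto intro: less_imp_le)
  have main: "bergman_pow \<alpha> q (weighted_comp u \<phi> f) \<le> ennreal (S * F powr (q / p))"
    if f: "f \<in> bergman_space \<alpha> p" and F: "F \<ge> 0" "bergman_pow \<alpha> p f = ennreal F" for f F
  proof -
    have fm: "f \<in> borel_measurable (V_alpha \<alpha>)"
      using f continuous_on_holo_fun by (intro measurable_V_alpha_continuous) (auto simp: bergman_space_def)
    have "bergman_pow \<alpha> q (weighted_comp u \<phi> f) \<le> ennreal C * (\<Sum>i=1..M. ennreal (A i * F powr (q / p)))"
      by (intro order_trans[OF bound[OF f]] mult_left_mono sum_mono A(2) fm F) auto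
    also have "(\<Sum>i=1..M. ennreal (A i * F powr (q / p))) = ennreal (\<Sum>i=1..M. A i * F powr (q / p))"
      by (intro sum_ennreal mult_nonneg_nonneg less_imp_le[OF A(1)]) auto
    also have "ennreal C * \<dots> = ennreal (C * (\<Sum>i=1..M. A i * F powr (q / p)))"
      using C by (simp add: ennreal_mult')
    also have "C * (\<Sum>i=1..M. A i * F powr (q / p)) = S * F powr (q / p)"
      by (simp add: S_def sum_distrib_right mult.assoc)
    finally show ?thesis .
  qed
  show ?thesis
    unfolding bounded_bergman_operator_def
  proof (intro conjI ballI exI[of _ "S powr (1 / q)"])
    fix f :: "complex ^ 'n \<Rightarrow> complex" assume f: "f \<in> bergman_space \<alpha> p"
    then have hf: "holo_fun_on f (ball 0 1)" and ff: "bergman_pow \<alpha> p f < \<infinity>" by (auto simp: bergman_space_def)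
    define F where "F = enn2real (bergman_pow \<alpha> p f)"
    have F: "F \<ge> 0" "bergman_pow \<alpha> p f = ennreal F" using ff by (simp_all add: F_def less_top)
    note m = main[OF f F]
    have "bergman_pow \<alpha> q (weighted_comp u \<phi> f) < \<infinity>" using m by (rule order_le_less_trans) simp
    moreover have "holo_fun_on (weighted_comp u \<phi> f) (ball 0 1)"
      unfolding weighted_comp_def by (intro holo_fun_on_mult u holo_fun_on_compose[OF hf \<phi>])
    ultimately show "weighted_comp u \<phi> f \<in> bergman_space \<alpha> q" by (simp add: bergman_space_def)
    have "enn2real (bergman_pow \<alpha> q (weighted_comp u \<phi> f)) \<le> S * F powr (q / p)"
      by (rule enn2real_leI[OF _ m]) (use S in auto)
    then have "bergman_norm \<alpha> q (weighted_comp u \<phi> f) \<le> (S * F powr (q / p)) powr (1 / q)"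
      unfolding bergman_norm_def using pq by (intro powr_mono2) auto
    also have "\<dots> = S powr (1 / q) * bergman_norm \<alpha> p f"
      using S pq by (simp add: bergman_norm_def F_def powr_mult powr_powr)
    finally show "bergman_norm \<alpha> q (weighted_comp u \<phi> f) \<le> S powr (1 / q) * bergman_norm \<alpha> p f" .
  qed
qed

lemma finite_Z_set: "finite (Z_set p q)"
proof -
  have "Z_set p q \<subseteq> {..nat \<lceil>p\<rceil>}" by (auto simp: Z_set_def) linarith
  then show ?thesis by (rule finite_subset) simp
qed

theorem theorem5p6:
  fixes p q \<alpha> lam \<theta> :: real
    and C\<^sub>1 C\<^sub>2 :: "real \<Rightarrow> real \<Rightarrow> real"
    and M :: nat
    and \<D> :: "nat \<Rightarrow> 'n::finite dyadic_structure"
    and u :: "complex ^ 'n \<Rightarrow> complex"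
    and \<phi> :: "complex ^ 'n \<Rightarrow> complex ^ 'n"
  assumes "2 * p > q" and "q > p" and "p \<ge> 1" and "\<alpha> > -1"
    and "lam > 0" and "\<theta> > 0"
    and "C\<^sub>1 lam \<theta> > 0" and "C\<^sub>2 lam \<theta> > 0"
    and "\<And>i. i \<in> {1..M} \<Longrightarrow> dyadic_grid (\<D> i)"
    and "\<And>i. i \<in> {1..M} \<Longrightarrow> bergman_tree \<theta> (\<D> i)"
    and "\<And>i. i \<in> {1..M} \<Longrightarrow> whitney_boxes \<alpha> \<theta> (C\<^sub>1 lam \<theta>) (C\<^sub>2 lam \<theta>) (\<D> i)"
    and "tents_dominated \<alpha> M \<D>"
    and "holo_fun_on u (ball 0 1)"
    and "holo_map_on \<phi> (ball 0 1)" and "\<phi> ` ball 0 1 \<subseteq> ball 0 1"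
    and "Z_set p q \<noteq> {}"
  shows "bounded_bergman_operator \<alpha> p q (weighted_comp u \<phi>) \<longleftrightarrow>
    (\<exists>C::real. C > 0 \<and> (\<forall>f\<in>bergman_space \<alpha> p.
       bergman_pow \<alpha> q (weighted_comp u \<phi> f) \<le>
         ennreal C * (INF N\<in>Z_set p q. \<Sum>i=1..M. \<Sum>\<^sub>\<infinity>(k, j)\<in>grid_index (\<D> i).
           ennreal ((measure (V_alpha \<alpha>) (dyadic_tent (\<D> i) (center (\<D> i) k j))) powr (q / p)) *
           average \<alpha> (dyadic_tent (\<D> i) (center (\<D> i) k j)) (\<lambda>z. cmod (f z) ^ N) *
           average \<alpha> (dyadic_tent (\<D> i) (center (\<D> i) k j)) (\<lambda>z. cmod (f z) powr (q - real N)))))"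
    (is "?lhs \<longleftrightarrow> (\<exists>C. C > 0 \<and> (\<forall>f\<in>_. ?B f \<le> ennreal C * (INF N\<in>_. ?S N f)))")
proof -
  have trees: "box_tree (\<D> i) \<alpha> \<theta> (C\<^sub>1 lam \<theta>) (C\<^sub>2 lam \<theta>)" if "i \<in> {1..M}" for i
    by unfold_locales (use assms that in auto)
  define P where "P = (\<lambda>N f. \<Sum>i=1..M. dyadic_sum \<alpha> (q / p) (real N) (q - real N) f (\<D> i))"
  have Z: "1 \<le> N" "0 < real N" "real N < p" "0 < q - real N" "q - real N < p" if "N \<in> Z_set p q" for N
    using that by (auto simp: Z_set_def)
  have SP: "?S N f = P N f" if "N \<in> Z_set p q" for N f
  proof -
    have "(\<lambda>z. cmod (f z) ^ N) = (\<lambda>z. cmod (f z) powr real N)"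
      by (intro ext cmod_power_eq_powr Z(1) that)
    then show ?thesis by (simp only: P_def dyadic_sum_def dyadic_product_def)
  qed
  have INF: "(INF N\<in>Z_set p q. ?S N f) = (INF N\<in>Z_set p q. P N f)" for f
    by (intro INF_cong refl SP)
  show ?thesis unfolding INF
  proof
    assume bdd: ?lhs
    have "\<exists>C>0. \<forall>f\<in>bergman_space \<alpha> p. ?B f \<le> ennreal C * P N f" if N: "N \<in> Z_set p q" for N
      unfolding P_def
      by (rule weighted_comp_le_dyadic_sum[OF assms(1) _ _ assms(4,6,7,8) trees assms(12-15) Z(2)[OF N] Z(4)[OF N] _ bdd])
         (use assms(2,3) in auto)
    then obtain c where c: "\<And>N. N \<in> Z_set p q \<Longrightarrow> c N > 0"
      "\<And>N f. N \<in> Z_set p q \<Longrightarrow> f \<in> bergman_space \<alpha> p \<Longrightarrow> ?B f \<le> ennreal (c N) * P N f"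
      by metis
    define C where "C = sum c (Z_set p q)"
    have cC: "c N \<le> C" if "N \<in> Z_set p q" for N
      unfolding C_def using c(1) by (intro member_le_sum[OF that]) (auto intro: less_imp_le finite_Z_set)
    have C: "C > 0" unfolding C_def using c(1) assms(16) finite_Z_set by (intro sum_pos) auto
    have "?B f \<le> ennreal C * (INF N\<in>Z_set p q. P N f)" if f: "f \<in> bergman_space \<alpha> p" for f
    proof -
      \<comment> \<open>a finite nonempty infimum is attained\<close>
      have "(INF N\<in>Z_set p q. P N f) \<in> (\<lambda>N. P N f) ` Z_set p q"
        using assms(16) finite_Z_set by (subst cInf_eq_Min) (auto intro!: Min_in)
      then obtain N where N: "N \<in> Z_set p q" "(INF N\<in>Z_set p q. P N f) = P N f" by blast
      have "?B f \<le> ennreal (c N) * P N f" by (rule c(2)[OF N(1) f])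
      also have "\<dots> \<le> ennreal C * P N f" by (intro mult_right_mono ennreal_leI cC N) auto
      finally show ?thesis unfolding N(2) .
    qed
    then show "\<exists>C. C > 0 \<and> (\<forall>f\<in>bergman_space \<alpha> p. ?B f \<le> ennreal C * (INF N\<in>Z_set p q. P N f))"
      using C by blast
  next
    assume "\<exists>C. C > 0 \<and> (\<forall>f\<in>bergman_space \<alpha> p. ?B f \<le> ennreal C * (INF N\<in>Z_set p q. P N f))"
    then obtain C where C: "C > 0"
      "\<And>f. f \<in> bergman_space \<alpha> p \<Longrightarrow> ?B f \<le> ennreal C * (INF N\<in>Z_set p q. P N f)" by blast
    obtain N where N: "N \<in> Z_set p q" using assms(16) by blast
    have bound: "?B f \<le> ennreal C * P N f" if "f \<in> bergman_space \<alpha> p" for f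
      by (intro order_trans[OF C(2)[OF that]] mult_left_mono INF_lower N) auto
    show ?lhs
      by (rule bounded_of_dyadic_bound[OF _ _ trees assms(13-15) Z(2,3)[OF N] Z(4,5)[OF N] _ C(1) bound[unfolded P_def]])
         (use assms(2,3) in auto)
  qed
qed

end
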